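(* Let $\alpha\in(1,2)$, let $c\in\mathbb{R}$ and let $m$ be a finite signed Borel measure on $\mathbb{R}$, and set $u_0(x)=c+\int_{-\infty}^x m(dy)=c+m((-\infty,x])$ for a.e. $x\in\mathbb{R}$. Put $u_-=c$ and $u_+=c+m(\mathbb{R})$, and assume $$u_0-u_-\in L^1((-\infty,0)),\qquad u_0-u_+\in L^1((0,\infty)),\qquad u_-<u_+.$$ Let $u$ be the unique solution of the Cauchy problem $u_t+\Lambda^\alpha u+uu_x=0$ on $\mathbb{R}\times(0,\infty)$, $u(\cdot,0)=u_0$, and let $w^R$ be the rarefaction wave $$w^R(x,t)=\begin{cases}u_-, & x/t\le u_-,\\ x/t, & u_-\le x/t\le u_+,\\ u_+, & x/t\ge u_+.\end{cases}$$ Then for every $p\in\big((3-\alpha)/(\alpha-1),\infty\big]$ there exists $C>0$ independent of $t$ such that $$\|u(t)-w^R(t)\|_p\le C\,t^{-[\alpha-1-(3-\alpha)/p]/2}\log(2+t)\qquad\text{for all } t>0.$$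
   Context: $\Lambda^\alpha=(-\partial_x^2)^{\alpha/2}$ is defined by $\widehat{\Lambda^\alpha v}(\xi)=|\xi|^\alpha\widehat v(\xi)$; for bounded smooth (not necessarily decaying) functions and $\alpha\in(1,2)$ it is given by $\Lambda^\alpha w(x)=-C(\alpha)\int_{\mathbb{R}}\frac{w(x+z)-w(x)-w_x(x)z}{|z|^{1+\alpha}}dz$ for a suitable constant $C(\alpha)>0$. For $u_0\in L^\infty(\mathbb{R})$ and $\alpha\in(1,2)$, "the solution" means the unique function $u$ such that for all $T>0$: $u\in C_b((0,T)\times\mathbb{R})$, $u\in C_b^\infty((a,T)\times\mathbb{R})$ for every $a\in(0,T)$, $u$ satisfies the equation on $(0,T)\times\mathbb{R}$, and $u(\cdot,t)\to u_0$ weak-$*$ in $L^\infty(\mathbb{R})$ as $t\to0$ (existence and uniqueness of such a solution is known). $\|\cdot\|_p$ is the $L^p(\mathbb{R})$ norm in $x$. *)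

theory Defs
  imports "HOL-Analysis.Analysis" "HOL-Probability.Essential_Supremum"
begin

text \<open>Finite signed Borel measure on the real line, represented by its Jordan
decomposition m = M1 - M2 with M1, M2 finite (nonnegative) Borel measures.\<close>
definition finite_signed_borel :: "real measure \<Rightarrow> real measure \<Rightarrow> bool" where
  "finite_signed_borel M1 M2 \<longleftrightarrow>
     sets M1 = sets borel \<and> sets M2 = sets borel \<and> finite_measure M1 \<and> finite_measure M2"

definition smeasure :: "real measure \<Rightarrow> real measure \<Rightarrow> real set \<Rightarrow> real" where
  "smeasure M1 M2 A = measure M1 A - measure M2 A"

text \<open>The constant C(alpha) of the singular integral representation of
Lambda^alpha = (-d^2/dx^2)^(alpha/2) in one dimension.\<close>
definition frac_const :: "real \<Rightarrow> real" where
  "frac_const \<alpha> = \<alpha> * 2 powr (\<alpha> - 1) * Gamma ((1 + \<alpha>) / 2) / (sqrt pi * Gamma (1 - \<alpha> / 2))"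

definition fraclap :: "real \<Rightarrow> (real \<Rightarrow> real) \<Rightarrow> real \<Rightarrow> real" where
  "fraclap \<alpha> w x = - frac_const \<alpha> *
     (LINT z|lborel. (w (x + z) - w x - deriv w x * z) / \<bar>z\<bar> powr (1 + \<alpha>))"

definition dt :: "(real \<Rightarrow> real \<Rightarrow> real) \<Rightarrow> real \<Rightarrow> real \<Rightarrow> real" where
  "dt f = (\<lambda>t x. deriv (\<lambda>s. f s x) t)"

definition dx :: "(real \<Rightarrow> real \<Rightarrow> real) \<Rightarrow> real \<Rightarrow> real \<Rightarrow> real" where
  "dx f = (\<lambda>t x. deriv (\<lambda>y. f t y) x)"

fun Dw :: "bool list \<Rightarrow> (real \<Rightarrow> real \<Rightarrow> real) \<Rightarrow> real \<Rightarrow> real \<Rightarrow> real" where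
  "Dw [] f = f"
| "Dw (b # bs) f = (if b then dt (Dw bs f) else dx (Dw bs f))"

definition Cb_inf_on :: "(real \<times> real) set \<Rightarrow> (real \<Rightarrow> real \<Rightarrow> real) \<Rightarrow> bool" where
  "Cb_inf_on S f \<longleftrightarrow>
     (\<forall>bs. continuous_on S (\<lambda>(t,x). Dw bs f t x)
        \<and> bounded ((\<lambda>(t,x). Dw bs f t x) ` S)
        \<and> (\<forall>(t,x)\<in>S. (\<lambda>s. Dw bs f s x) differentiable (at t)
                     \<and> (\<lambda>y. Dw bs f t y) differentiable (at x)))"

definition Cb_on :: "(real \<times> real) set \<Rightarrow> (real \<Rightarrow> real \<Rightarrow> real) \<Rightarrow> bool" where
  "Cb_on S f \<longleftrightarrow> continuous_on S (\<lambda>(t,x). f t x) \<and> bounded ((\<lambda>(t,x). f t x) ` S)"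

definition is_solution :: "real \<Rightarrow> (real \<Rightarrow> real) \<Rightarrow> (real \<Rightarrow> real \<Rightarrow> real) \<Rightarrow> bool" where
  "is_solution \<alpha> u0 u \<longleftrightarrow>
     (\<forall>T>0.
        Cb_on ({0<..<T} \<times> UNIV) u
      \<and> (\<forall>a. 0 < a \<and> a < T \<longrightarrow> Cb_inf_on ({a<..<T} \<times> UNIV) u)
      \<and> (\<forall>t x. 0 < t \<and> t < T \<longrightarrow> dt u t x + fraclap \<alpha> (u t) x + u t x * dx u t x = 0))
   \<and> (\<forall>\<phi>::real \<Rightarrow> real. integrable lborel \<phi> \<longrightarrow>
        ((\<lambda>t. LINT x|lborel. u t x * \<phi> x) \<longlongrightarrow> (LINT x|lborel. u0 x * \<phi> x)) (at_right 0))"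

definition rarefaction :: "real \<Rightarrow> real \<Rightarrow> real \<Rightarrow> real \<Rightarrow> real" where
  "rarefaction um up t x =
     (if x / t \<le> um then um else if x / t \<le> up then x / t else up)"

definition Lp_norm :: "ereal \<Rightarrow> (real \<Rightarrow> real) \<Rightarrow> ennreal" where
  "Lp_norm p f =
    (if p = \<infinity> then esssup lborel (\<lambda>x. ennreal \<bar>f x\<bar>)
     else (let I = (\<integral>\<^sup>+ x. ennreal (\<bar>f x\<bar> powr real_of_ereal p) \<partial>lborel)
           in if I = \<infinity> then \<infinity> else ennreal (enn2real I powr (1 / real_of_ereal p))))"

definition recip :: "ereal \<Rightarrow> real" where
  "recip p = (if p = \<infinity> then 0 else 1 / real_of_ereal p)"

end

theory Submission
  imports Defs "HOL-Probability.Distribution_Functions"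
begin

text \<open>
  Let \<open>w\<close> be the rarefaction wave and \<open>v = u - w\<close>. Two facts suffice: the bound
  \<open>\<parallel>v(t)\<parallel>\<^sub>1 \<le> C (1 + t)\<^bsup>2 - \<alpha>\<^esup>\<close> and Oleinik's inequality \<open>u\<^sub>x \<le> 1/t\<close>.
  As \<open>w\<close> is nondecreasing in space, \<open>v\<close> has slopes at most \<open>1/t\<close>, whence
  \<open>\<parallel>v\<parallel>\<^sub>\<infinity> \<le> 2 (\<parallel>v\<parallel>\<^sub>1 / t)\<^bsup>1/2\<^esup>\<close>, and interpolation between these two norms gives the claimed
  rate for large \<open>t\<close>, even without the logarithm.

  The \<open>L\<^sup>1\<close> bound is Kato's inequality for the difference of \<open>u\<close> and a smooth profile that solves the
  equation up to an error of \<open>L\<^sup>1\<close> norm \<open>O((1 + t)\<^bsup>1 - \<alpha>\<^esup>)\<close>. The initial value is attained only in the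
  weak-* sense, so the inequality is applied to the averages of \<open>u\<close> over \<open>[x, x + h]\<close>, which
  converge pointwise as \<open>t \<rightarrow> 0\<close>. The commutator error vanishes with \<open>h\<close> because
  \<open>\<bar>u\<^sub>x\<bar> \<le> B t\<^bsup>-1/\<alpha>\<^esup>\<close>, which is integrable near \<open>t = 0\<close>. Both gradient bounds come from a single
  maximum principle for \<open>u(x) - u(y) - g(t)(x - y)\<close>.
\<close>

subsection \<open>Integrals on the real line and the singular kernel\<close>

text \<open>One scaling fact forces the exponents: if f' has mass O(1) and f'' mass O(1/\<tau>),
  then the fractional Laplacian of f has L^1 norm O(\<tau>^(1-\<alpha>)). With \<tau> = 1 + t this
  is the residual of the profile, whose time integral grows like t^(2-\<alpha>); with \<tau> = R it
  makes the nonlocal term of the weight vanish. Dividing t^(2-\<alpha>) by t and taking the root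
  gives t^((1-\<alpha>)/2) for the supremum, and the powers 1 - 1/p and 1/p of the two norms combine
  to -[\<alpha> - 1 - (3 - \<alpha>)/p]/2. The bound on p makes this exponent negative, so small
  times only require bounded norms.

  The obstacle is that no decay of u - w is known in advance: integrability has to come out of the
  estimate. Four parameters are removed in a fixed order: the smoothing d of the absolute value, the
  initial time s, the averaging width h, the radius R of the weight. The order matters: the error of
  d carries a factor 1/h, and that of h the mass of the weight, which grows with R.\<close>

abbreviation L1norm :: "(real \<Rightarrow> real) \<Rightarrow> ennreal" where
  "L1norm f \<equiv> \<integral>\<^sup>+x. ennreal \<bar>f x\<bar> \<partial>lborel"

text \<open>Integrability is a conclusion here: a bounded monotone function has limits at both ends,
  and the fundamental theorem for nonnegative integrands then yields a finite integral. It is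
  applied with the arctangent, the logistic function and the profile as antiderivatives.\<close>

lemma integrable_deriv_of_bounded_mono:
  fixes f f' :: "real \<Rightarrow> real"
  assumes D: "\<And>x. (f has_real_derivative f' x) (at x)"
    and c: "\<And>x. isCont f' x" and nn: "\<And>x. 0 \<le> f' x"
    and b: "\<And>x. A \<le> f x" "\<And>x. f x \<le> B"
  shows "integrable lborel f'" "(LINT x|lborel. f' x) \<le> B - A"
proof -
  have m: "mono f"
    by (rule monoI) (meson D DERIV_nonneg_imp_nondecreasing nn)
  have bb: "bdd_above (range f)" "bdd_below (range f)"
    using b unfolding bdd_above_def bdd_below_def by auto
  have t: "(f \<longlongrightarrow> (SUP x. f x)) at_top"
  proof (rule increasing_tendsto)
    show "\<forall>\<^sub>F x in at_top. f x \<le> (SUP x. f x)" by (intro always_eventually allI cSUP_upper bb) auto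
    fix y assume "y < (SUP x. f x)"
    then obtain x0 where "y < f x0" using less_cSUP_iff[OF _ bb(1)] by auto
    then show "\<forall>\<^sub>F x in at_top. y < f x"
      unfolding eventually_at_top_linorder by (meson m monoD order_less_le_trans)
  qed
  have t': "(f \<longlongrightarrow> (INF x. f x)) at_bot"
  proof (rule decreasing_tendsto)
    show "\<forall>\<^sub>F x in at_bot. (INF x. f x) \<le> f x" by (intro always_eventually allI cINF_lower bb) auto
    fix y assume "(INF x. f x) < y"
    then obtain x0 where "f x0 < y" using cINF_less_iff[OF _ bb(2)] by auto
    then show "\<forall>\<^sub>F x in at_bot. f x < y"
      unfolding eventually_at_bot_linorder by (meson m monoD order_le_less_trans)
  qed
  have S: "set_integrable lborel (einterval (-\<infinity>) \<infinity>) f'"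
    "(LBINT x=-\<infinity>..\<infinity>. f' x) = (SUP x. f x) - (INF x. f x)"
    by (rule interval_integral_FTC_nonneg[where F=f]; 
        use D c nn t t' in \<open>simp add: ereal_tendsto_simps\<close>)+
  show "integrable lborel f'" using S(1) by (simp add: set_integrable_def)
  have "(LINT x|lborel. f' x) = (SUP x. f x) - (INF x. f x)"
    using S(2) by (simp add: interval_lebesgue_integral_def set_lebesgue_integral_def)
  also have "\<dots> \<le> B - A"
    by (intro diff_mono cSUP_least cINF_greatest) (use b in auto)
  finally show "(LINT x|lborel. f' x) \<le> B - A" .
qed

lemma integral_deriv_eq_0:
  fixes f f' :: "real \<Rightarrow> real"
  assumes D: "\<And>x. (f has_real_derivative f' x) (at x)"
    and c: "\<And>x. isCont f' x" and i: "integrable lborel f'"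
    and t: "(f \<longlongrightarrow> 0) at_top" "(f \<longlongrightarrow> 0) at_bot"
  shows "(LINT x|lborel. f' x) = 0"
proof -
  have "(LBINT x=-\<infinity>..\<infinity>. f' x) = 0 - 0"
    by (rule interval_integral_FTC_integrable[where F=f])
      (use D c i t in \<open>simp_all add: ereal_tendsto_simps set_integrable_def 
        has_real_derivative_iff_has_vector_derivative\<close>)
  then show ?thesis
    by (simp add: interval_lebesgue_integral_def set_lebesgue_integral_def)
qed

lemma DERIV_integral_dominated:
  fixes f f' :: "real \<Rightarrow> 'a \<Rightarrow> real"
  assumes r: "a < r" "r < b"
    and D: "\<And>s x. a < s \<Longrightarrow> s < b \<Longrightarrow> x \<in> space M \<Longrightarrow> ((\<lambda>s. f s x) has_real_derivative f' s x) (at s)"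
    and B: "\<And>s x. a < s \<Longrightarrow> s < b \<Longrightarrow> x \<in> space M \<Longrightarrow> \<bar>f' s x\<bar> \<le> B x"
    and i: "\<And>s. a < s \<Longrightarrow> s < b \<Longrightarrow> integrable M (f s)" "integrable M B"
    and m: "f' r \<in> borel_measurable M"
  shows "((\<lambda>s. LINT x|M. f s x) has_real_derivative (LINT x|M. f' r x)) (at r)"
proof -
  have "((\<lambda>h. ((LINT x|M. f (r + h) x) - (LINT x|M. f r x)) / h) \<longlongrightarrow> (LINT x|M. f' r x)) (at 0)"
  proof (subst tendsto_at_iff_sequentially, intro allI impI)
    fix h :: "nat \<Rightarrow> real" assume h0: "\<forall>i. h i \<in> UNIV - {0}" and hl: "h \<longlonglongrightarrow> 0"
    have "(\<lambda>i. r + h i) \<longlonglongrightarrow> r" using tendsto_add[OF tendsto_const hl, of r] by simp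
    then have ev: "\<forall>\<^sub>F i in sequentially. r + h i \<in> {a<..<b}"
      by (rule topological_tendstoD) (use r in auto)
    then obtain N where N: "\<And>i. i \<ge> N \<Longrightarrow> r + h i \<in> {a<..<b}"
      by (auto simp: eventually_sequentially)
    \<comment> \<open>Dominated convergence asks for all indices, so the finitely many steps that
      leave (a, b) are cut off; \<open>LIMSEQ_offset\<close> restores them at the end.\<close>
    define k where "k i = h (i + N)" for i
    have k: "a < r + k i" "r + k i < b" "k i \<noteq> 0" for i using N[of "i+N"] h0 by (auto simp: k_def)
    have kl: "k \<longlonglongrightarrow> 0" unfolding k_def using hl by (rule LIMSEQ_ignore_initial_segment)
    have "(\<lambda>i. LINT x|M. (f (r + k i) x - f r x) / k i) \<longlonglongrightarrow> (LINT x|M. f' r x)"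
    proof (rule integral_dominated_convergence[where w=B])
      show "(\<lambda>x. (f (r + k i) x - f r x) / k i) \<in> borel_measurable M" for i
        using i(1)[of r] i(1)[of "r + k i"] k[of i] r by auto
      show "AE x in M. (\<lambda>i. (f (r + k i) x - f r x) / k i) \<longlonglongrightarrow> f' r x"
      proof (rule AE_I2)
        fix x assume "x \<in> space M"
        then have "((\<lambda>h. (f (r + h) x - f r x) / h) \<longlongrightarrow> f' r x) (at 0)"
          using D[OF r] by (auto simp: DERIV_def)
        then show "(\<lambda>i. (f (r + k i) x - f r x) / k i) \<longlonglongrightarrow> f' r x"
          unfolding tendsto_at_iff_sequentially using k kl by (auto simp: o_def)
      qed
      show "AE x in M. norm ((f (r + k i) x - f r x) / k i) \<le> B x" for i
      proof (rule AE_I2)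
        fix x assume x: "x \<in> space M"
        have "\<bar>f (r + k i) x - f r x\<bar> \<le> B x * \<bar>(r + k i) - r\<bar>"
        proof (rule field_differentiable_bound[of "{a<..<b}" "\<lambda>s. f s x" "\<lambda>s. f' s x", unfolded real_norm_def])
          fix s assume "s \<in> {a<..<b}"
          then show "((\<lambda>s. f s x) has_field_derivative f' s x) (at s within {a<..<b})" "\<bar>f' s x\<bar> \<le> B x"
            using D B x by (auto intro: has_field_derivative_at_within)
        qed (use k r in auto)
        then show "norm ((f (r + k i) x - f r x) / k i) \<le> B x"
          using k[of i] by (simp add: field_simps abs_mult)
      qed
    qed (use m i in auto)
    moreover have "(LINT x|M. (f (r + k i) x - f r x) / k i) = 
        ((LINT x|M. f (r + k i) x) - (LINT x|M. f r x)) / k i" for i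
      using i(1)[of r] i(1)[of "r + k i"] k[of i] r by (simp add: Bochner_Integration.integral_diff)
    ultimately show "((\<lambda>h. ((LINT x|M. f (r + h) x) - (LINT x|M. f r x)) / h) \<circ> h) \<longlonglongrightarrow> (LINT x|M. f' r x)"
      by (intro LIMSEQ_offset[of "((\<lambda>h. ((LINT x|M. f (r + h) x) - (LINT x|M. f r x)) / h) \<circ> h)" N])
        (simp only: o_def k_def)
  qed
  then show ?thesis by (simp add: DERIV_def)
qed

locale frac_order =
  fixes \<alpha> :: real
  assumes alpha: "1 < \<alpha>" "\<alpha> < 2"
begin

text \<open>Up to a factor, an integrable majorant of the singular integrand: a Taylor remainder is
  O(z^2) near 0 and O(|z|) far away. The resulting powers |z|^(1-\<alpha>) and |z|^(-\<alpha>) are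
  integrable in their ranges exactly because 1 < \<alpha> < 2.\<close>

definition kap :: "real \<Rightarrow> real" where
  "kap z = min (z\<^sup>2) \<bar>z\<bar> / \<bar>z\<bar> powr (1 + \<alpha>)"

definition kint :: real where
  "kint = (LINT z|lborel. kap z)"

lemma kap_nonneg: "0 \<le> kap z"
  by (simp add: kap_def)

lemma kap_measurable [measurable]: "kap \<in> borel_measurable borel"
  unfolding kap_def by measurable

lemma integrable_kap: "integrable lborel kap"
proof -
  have near: "set_integrable lborel {0..1} (\<lambda>z::real. z powr (1 - \<alpha>))"
  proof -
    have "(\<lambda>z::real. z powr (1 - \<alpha>)) integrable_on {0..1}"
      by (rule integrable_on_powr_from_0) (use alpha in auto)
    then have "(\<lambda>z::real. z powr (1 - \<alpha>)) absolutely_integrable_on {0..1}"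
      by (intro nonnegative_absolutely_integrable_1) auto
    then show ?thesis
      unfolding set_integrable_def by (subst (asm) integrable_completion) auto
  qed
  have far: "set_integrable lborel {1..} (\<lambda>z::real. z powr (- \<alpha>))"
  proof -
    have "(\<lambda>z::real. z powr (- \<alpha>)) integrable_on {1..}"
      using has_integral_powr_to_inf[of "-\<alpha>" 1] alpha by (auto simp: integrable_on_def)
    then have "(\<lambda>z::real. z powr (- \<alpha>)) absolutely_integrable_on {1..}"
      by (intro nonnegative_absolutely_integrable_1) auto
    then show ?thesis
      unfolding set_integrable_def by (subst (asm) integrable_completion) auto
  qed
  define q where "q z = indicator {0..1} z * z powr (1 - \<alpha>) + indicator {1..} z * z powr (- \<alpha>)" for z::real
  have q: "integrable lborel q"
    using near far unfolding q_def set_integrable_def by simp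
  have q': "integrable lborel (\<lambda>z. q (- z))"
    using lborel_integrable_real_affine[OF q, of "-1" 0] by simp
  show ?thesis
  proof (rule Bochner_Integration.integrable_bound[OF Bochner_Integration.integrable_add[OF q q']])
    have "kap z \<le> q z" if "0 < z" for z
    proof (cases "z \<le> 1")
      case True
      have "kap z \<le> z powr 2 / z powr (1 + \<alpha>)"
        using that by (auto simp: kap_def intro!: divide_right_mono)
      also have "\<dots> = z powr (1 - \<alpha>)" by (simp add: powr_diff[symmetric])
      also have "\<dots> \<le> q z" using that True by (simp add: q_def)
      finally show ?thesis .
    next
      case False
      have "kap z \<le> z powr 1 / z powr (1 + \<alpha>)"
        using that by (auto simp: kap_def intro!: divide_right_mono)
      also have "\<dots> = z powr (- \<alpha>)" by (subst powr_diff[symmetric]) simp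
      also have "\<dots> = q z" using that False by (simp add: q_def)
      finally show ?thesis .
    qed
    moreover have "q z \<ge> 0" for z by (simp add: q_def)
    moreover have "kap (-z) = kap z" for z by (simp add: kap_def)
    moreover have "kap 0 = 0" by (simp add: kap_def)
    ultimately have "kap z \<le> q z + q (-z)" for z
      by (cases z "0::real" rule: linorder_cases) (smt (verit))+
    then show "AE x in lborel. norm (kap x) \<le> norm (q x + q (- x))"
      using kap_nonneg by (auto intro!: AE_I2) (smt (verit))
  qed simp
qed

lemma kint_nonneg: "0 \<le> kint"
  unfolding kint_def by (intro Bochner_Integration.integral_nonneg kap_nonneg)

text \<open>Substitution z = \<tau> z'. The factor \<tau>^(1-\<alpha>) is the source of the decay of
  both the profile residual (\<tau> = 1 + t) and the nonlocal term of the weight (\<tau> =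
  R).\<close>

lemma kap_scale:
  assumes "0 < \<tau>"
  shows "integrable lborel (\<lambda>z. min (z\<^sup>2 / \<tau>) \<bar>z\<bar> / \<bar>z\<bar> powr (1 + \<alpha>))"
    "(LINT z|lborel. min (z\<^sup>2 / \<tau>) \<bar>z\<bar> / \<bar>z\<bar> powr (1 + \<alpha>)) = \<tau> powr (1 - \<alpha>) * kint"
proof -
  have e: "min (z\<^sup>2 / \<tau>) \<bar>z\<bar> / \<bar>z\<bar> powr (1 + \<alpha>) = \<tau> powr (- \<alpha>) * kap (0 + (1 / \<tau>) * z)" for z
  proof (cases "z = 0")
    case False
    have "min (z\<^sup>2 / \<tau>) \<bar>z\<bar> = \<tau> * min ((z / \<tau>)\<^sup>2) \<bar>z / \<tau>\<bar>"
      using assms by (simp add: min_mult_distrib_left power2_eq_square)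
    moreover have "\<bar>z\<bar> powr (1 + \<alpha>) = \<tau> powr (1 + \<alpha>) * \<bar>z / \<tau>\<bar> powr (1 + \<alpha>)"
      using assms by (simp add: powr_mult[symmetric])
    ultimately have "min (z\<^sup>2 / \<tau>) \<bar>z\<bar> / \<bar>z\<bar> powr (1 + \<alpha>) = 
        (\<tau> / \<tau> powr (1 + \<alpha>)) * (min ((z / \<tau>)\<^sup>2) \<bar>z / \<tau>\<bar> / \<bar>z / \<tau>\<bar> powr (1 + \<alpha>))"
      by (simp only: times_divide_times_eq)
    moreover have "\<tau> / \<tau> powr (1 + \<alpha>) = \<tau> powr (- \<alpha>)"
      using assms by (simp add: powr_add powr_minus divide_simps)
    ultimately show ?thesis by (simp add: kap_def)
  qed (simp add: kap_def)
  show "integrable lborel (\<lambda>z. min (z\<^sup>2 / \<tau>) \<bar>z\<bar> / \<bar>z\<bar> powr (1 + \<alpha>))"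
    unfolding e using lborel_integrable_real_affine[OF integrable_kap, of "1/\<tau>" 0] assms by simp
  have "kint = (1 / \<tau>) * (LINT z|lborel. kap (0 + (1 / \<tau>) * z))"
    unfolding kint_def using lborel_integral_real_affine[of "1/\<tau>" kap 0] assms by simp
  then have "(LINT z|lborel. kap (0 + (1 / \<tau>) * z)) = \<tau> * kint" using assms by simp
  moreover have "\<tau> powr (- \<alpha>) * \<tau> = \<tau> powr (1 - \<alpha>)" using assms by (simp add: powr_diff powr_minus field_simps)
  ultimately show "(LINT z|lborel. min (z\<^sup>2 / \<tau>) \<bar>z\<bar> / \<bar>z\<bar> powr (1 + \<alpha>)) = \<tau> powr (1 - \<alpha>) * kint"
    unfolding e by simp
qed

end

subsection \<open>The fractional Laplacian of functions with Lipschitz derivative\<close>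

text \<open>The derivative is a separate argument, so that the remainder of a composite function can
  be written with its computed derivative instead of \<open>deriv\<close>.\<close>

definition trem :: "(real \<Rightarrow> real) \<Rightarrow> (real \<Rightarrow> real) \<Rightarrow> real \<Rightarrow> real \<Rightarrow> real" where
  "trem f f' x z = f (x + z) - f x - f' x * z"

text \<open>This regularity makes the singular integral converge absolutely. One constant serves
  both bounds, and no second derivative is named, so that box averages and compositions with
  \<open>eta\<close> stay in the class by direct estimates.\<close>

definition C11 :: "(real \<Rightarrow> real) \<Rightarrow> (real \<Rightarrow> real) \<Rightarrow> real \<Rightarrow> bool" where
  "C11 f f' K \<longleftrightarrow> (\<forall>x. (f has_real_derivative f' x) (at x)) \<and> (\<forall>x. \<bar>f' x\<bar> \<le> K) \<and>
     (\<forall>x y. \<bar>f' x - f' y\<bar> \<le> K * \<bar>x - y\<bar>)"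

lemma C11D:
  assumes "C11 f f' K"
  shows "(f has_real_derivative f' x) (at x)" "\<bar>f' x\<bar> \<le> K" "\<bar>f' x - f' y\<bar> \<le> K * \<bar>x - y\<bar>" "0 \<le> K"
    "deriv f x = f' x"
proof -
  show 1: "(f has_real_derivative f' x) (at x)" and 2: "\<bar>f' x\<bar> \<le> K" and "\<bar>f' x - f' y\<bar> \<le> K * \<bar>x - y\<bar>"
    using assms unfolding C11_def by blast+
  show "0 \<le> K" using 2 abs_ge_zero[of "f' x"] by linarith
  show "deriv f x = f' x" using 1 by (rule DERIV_imp_deriv)
qed

lemma DERIV_bound_imp_lipschitz:
  fixes f :: "real \<Rightarrow> real"
  assumes "\<And>x. (f has_real_derivative f' x) (at x)" "\<And>x. \<bar>f' x\<bar> \<le> K"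
  shows "\<bar>f x - f y\<bar> \<le> K * \<bar>x - y\<bar>"
  using field_differentiable_bound[of UNIV f f' K x y] assms by auto

lemma C11I:
  assumes "\<And>x. (f has_real_derivative f' x) (at x)" "\<And>x. (f' has_real_derivative f'' x) (at x)"
    "\<And>x. \<bar>f' x\<bar> \<le> K" "\<And>x. \<bar>f'' x\<bar> \<le> K"
  shows "C11 f f' K"
  unfolding C11_def using DERIV_bound_imp_lipschitz[of f' f'' K] assms by blast

lemma C11_diff:
  assumes f: "C11 f f' K" and g: "C11 g g' L"
  shows "C11 (\<lambda>x. f x - g x) (\<lambda>x. f' x - g' x) (K + L)"
  unfolding C11_def
proof (intro conjI allI)
  fix x y
  show "((\<lambda>x. f x - g x) has_real_derivative f' x - g' x) (at x)"
    using C11D(1)[OF f] C11D(1)[OF g] by (intro DERIV_diff)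
  show "\<bar>f' x - g' x\<bar> \<le> K + L" using C11D(2)[OF f, of x] C11D(2)[OF g, of x] by linarith
  show "\<bar>f' x - g' x - (f' y - g' y)\<bar> \<le> (K + L) * \<bar>x - y\<bar>"
    using C11D(3)[OF f, of x y] C11D(3)[OF g, of x y] by (simp add: distrib_right)
qed

lemma C11_continuous:
  assumes "C11 f f' K"
  shows "isCont f x" "isCont f' x"
proof -
  show "isCont f x" using C11D(1)[OF assms] by (rule DERIV_isCont)
  have "K-lipschitz_on UNIV f'"
    using C11D(3,4)[OF assms] by (intro lipschitz_onI) (auto simp: dist_real_def)
  then show "isCont f' x"
    using lipschitz_on_continuous_on[of K UNIV f'] by (simp add: continuous_on_eq_continuous_at)
qed

lemma borel_measurable_isCont:
  fixes f :: "real \<Rightarrow> real"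
  shows "(\<And>x. isCont f x) \<Longrightarrow> f \<in> borel_measurable borel"
  by (intro borel_measurable_continuous_onI) (simp add: continuous_at_imp_continuous_on)

lemma C11_measurable:
  assumes "C11 f f' K"
  shows "f \<in> borel_measurable borel" "f' \<in> borel_measurable borel"
  using C11_continuous[OF assms] by (auto intro: borel_measurable_isCont)

text \<open>By the mean value theorem the remainder is z (f'(\<xi>) - f'(x)) with |\<xi> - x| \<le>
  |z|. The Lipschitz bound on f' gives the quadratic estimate, the bound on f' itself the linear
  one.\<close>

lemma trem_bound:
  assumes "C11 f f' K"
  shows "\<bar>trem f f' x z\<bar> \<le> 2 * K * min (z\<^sup>2) \<bar>z\<bar>"
proof -
  have K: "0 \<le> K" by (rule C11D(4)[OF assms])
  have 1: "\<bar>f (x + z) - f x\<bar> \<le> K * \<bar>z\<bar>"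
    using DERIV_bound_imp_lipschitz[of f f' K "x+z" x] C11D[OF assms] by simp
  have 2: "\<bar>f' x * z\<bar> \<le> K * \<bar>z\<bar>"
    using C11D(2)[OF assms, of x] by (simp add: abs_mult mult_right_mono)
  have le1: "\<bar>trem f f' x z\<bar> \<le> 2 * K * \<bar>z\<bar>" using 1 2 unfolding trem_def by linarith
  have "\<exists>\<xi>. \<bar>\<xi> - x\<bar> \<le> \<bar>z\<bar> \<and> f (x + z) - f x = z * f' \<xi>"
  proof (cases "z" "0::real" rule: linorder_cases)
    case less
    then obtain \<xi> where "x + z < \<xi>" "\<xi> < x" "f x - f (x + z) = (x - (x + z)) * f' \<xi>"
      using MVT2[of "x+z" x f f'] C11D(1)[OF assms] by auto
    then show ?thesis by (intro exI[of _ \<xi>]) (auto simp: algebra_simps)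
  next
    case greater
    then obtain \<xi> where "x < \<xi>" "\<xi> < x + z" "f (x + z) - f x = (x + z - x) * f' \<xi>"
      using MVT2[of x "x+z" f f'] C11D(1)[OF assms] by auto
    then show ?thesis by (intro exI[of _ \<xi>]) (auto simp: algebra_simps)
  qed simp
  then obtain \<xi> where xi: "\<bar>\<xi> - x\<bar> \<le> \<bar>z\<bar>" "f (x + z) - f x = z * f' \<xi>" by blast
  have "trem f f' x z = z * (f' \<xi> - f' x)" using xi(2) by (simp add: trem_def algebra_simps)
  then have "\<bar>trem f f' x z\<bar> = \<bar>z\<bar> * \<bar>f' \<xi> - f' x\<bar>" by (simp add: abs_mult)
  also have "\<dots> \<le> \<bar>z\<bar> * (K * \<bar>z\<bar>)"
    using order_trans[OF C11D(3)[OF assms, of \<xi> x] mult_left_mono[OF xi(1) K]] by (intro mult_left_mono) auto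
  also have "\<dots> = K * z\<^sup>2" by (simp add: power2_eq_square)
  also have "\<dots> \<le> 2 * K * z\<^sup>2" using K by simp
  finally have le2: "\<bar>trem f f' x z\<bar> \<le> 2 * K * z\<^sup>2" .
  show ?thesis using le1 le2 K by (simp add: min_def)
qed

lemma frac_const_pos:
  assumes "0 < \<alpha>" "\<alpha> < 2"
  shows "0 < frac_const \<alpha>"
  using assms unfolding frac_const_def by (intro divide_pos_pos mult_pos_pos Gamma_real_pos) auto

context frac_order
begin

text \<open>The integral in \<open>fraclap\<close> without its factor -C(\<alpha>). It has the sign
  of a second derivative: nonpositive at a global maximum.\<close>

definition Lop :: "(real \<Rightarrow> real) \<Rightarrow> (real \<Rightarrow> real) \<Rightarrow> real \<Rightarrow> real" where
  "Lop f f' x = (LINT z|lborel. trem f f' x z / \<bar>z\<bar> powr (1 + \<alpha>))"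

abbreviation CA :: real where "CA \<equiv> frac_const \<alpha>"

lemma CA_pos: "0 < CA"
  using alpha by (intro frac_const_pos) auto

lemma fraclap_eq_Lop:
  assumes "C11 f f' K"
  shows "fraclap \<alpha> f x = - CA * Lop f f' x"
  unfolding fraclap_def Lop_def trem_def C11D(5)[OF assms] ..

lemma trem_kap:
  assumes "C11 f f' K"
  shows "\<bar>trem f f' x z / \<bar>z\<bar> powr (1 + \<alpha>)\<bar> \<le> 2 * K * kap z"
  using divide_right_mono[OF trem_bound[OF assms, of x z], of "\<bar>z\<bar> powr (1 + \<alpha>)"]
  by (simp add: kap_def abs_divide)

lemma trem_measurable [measurable (raw)]:
  assumes [measurable]: "f \<in> borel_measurable borel" "f' \<in> borel_measurable borel"
    "X \<in> borel_measurable M" "Z \<in> borel_measurable M"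
  shows "(\<lambda>w. trem f f' (X w) (Z w)) \<in> borel_measurable M"
  unfolding trem_def by measurable

lemma integrable_trem:
  assumes "C11 f f' K"
  shows "integrable lborel (\<lambda>z. trem f f' x z / \<bar>z\<bar> powr (1 + \<alpha>))"
proof (rule Bochner_Integration.integrable_bound[OF integrable_mult_right[OF integrable_kap, of "2*K"]])
  note [measurable] = C11_measurable[OF assms]
  show "(\<lambda>z. trem f f' x z / \<bar>z\<bar> powr (1 + \<alpha>)) \<in> borel_measurable lborel" by measurable
  show "AE z in lborel. norm (trem f f' x z / \<bar>z\<bar> powr (1 + \<alpha>)) \<le> norm (2 * K * kap z)"
    using trem_kap[OF assms] kap_nonneg C11D(4)[OF assms] by (auto simp: abs_mult)
qed

lemma Lop_bound:
  assumes "C11 f f' K"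
  shows "\<bar>Lop f f' x\<bar> \<le> 2 * K * kint"
proof -
  have "\<bar>Lop f f' x\<bar> \<le> (LINT z|lborel. \<bar>trem f f' x z / \<bar>z\<bar> powr (1 + \<alpha>)\<bar>)"
    unfolding Lop_def using integral_norm_bound[of lborel "\<lambda>z. trem f f' x z / \<bar>z\<bar> powr (1 + \<alpha>)"] by simp
  also have "\<dots> \<le> (LINT z|lborel. 2 * K * kap z)"
    by (intro integral_mono integrable_abs integrable_trem[OF assms] integrable_mult_right integrable_kap)
      (use trem_kap[OF assms] in auto)
  finally show ?thesis by (simp add: kint_def)
qed

lemma Lop_measurable [measurable (raw)]:
  assumes [measurable]: "f \<in> borel_measurable borel" "f' \<in> borel_measurable borel"
  shows "Lop f f' \<in> borel_measurable borel"
  unfolding Lop_def by measurable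

lemma Lop_diff:
  assumes f: "C11 f f' K" and g: "C11 g g' L"
  shows "Lop (\<lambda>x. f x - g x) (\<lambda>x. f' x - g' x) x = Lop f f' x - Lop g g' x"
proof -
  have "trem (\<lambda>x. f x - g x) (\<lambda>x. f' x - g' x) x z / \<bar>z\<bar> powr (1 + \<alpha>) =
      trem f f' x z / \<bar>z\<bar> powr (1 + \<alpha>) - trem g g' x z / \<bar>z\<bar> powr (1 + \<alpha>)" for z
    by (simp add: trem_def diff_divide_distrib[symmetric] algebra_simps)
  then show ?thesis unfolding Lop_def
    by (simp add: Bochner_Integration.integral_diff[OF integrable_trem[OF f] integrable_trem[OF g]])
qed

end

lemma nn_integral_shift:
  fixes f :: "real \<Rightarrow> ennreal"
  assumes [measurable]: "f \<in> borel_measurable borel"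
  shows "(\<integral>\<^sup>+x. f (x + a) \<partial>lborel) = (\<integral>\<^sup>+x. f x \<partial>lborel)"
  using nn_integral_real_affine[OF assms, of 1 a] by (simp add: add.commute)

lemma integral_shift:
  fixes f :: "real \<Rightarrow> real"
  shows "(LINT x|lborel. f (x + a)) = (LINT x|lborel. f x)"
  using lborel_integral_real_affine[of 1 f a] by (simp add: add.commute)

lemma integrable_shift:
  fixes f :: "real \<Rightarrow> real"
  shows "integrable lborel f \<Longrightarrow> integrable lborel (\<lambda>x. f (x + a))"
  using lborel_integrable_real_affine[of f 1 a] by (simp add: add.commute)

text \<open>Taylor's formula writes the left-hand integrand as the integral of z (f'(x + s z) -
  c(x)) over s in [0, 1]; Tonelli does the rest. The choice c = 0 gives increments, c = f' gives
  Taylor remainders.\<close>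

lemma L1_increment_gen:
  fixes f f' c :: "real \<Rightarrow> real"
  assumes D: "\<And>x. (f has_real_derivative f' x) (at x)" and cont: "\<And>x. isCont f' x"
    and [measurable]: "c \<in> borel_measurable borel"
  shows "L1norm (\<lambda>x. f (x + z) - f x - c x * z) \<le> 
     (\<integral>\<^sup>+s. indicator {0..1} s * (ennreal \<bar>z\<bar> * L1norm (\<lambda>x. f' (x + s * z) - c x)) \<partial>lborel)"
proof -
  have [measurable]: "f' \<in> borel_measurable borel" using cont by (rule borel_measurable_isCont)
  have "ennreal \<bar>f (x + z) - f x - c x * z\<bar> \<le> 
      (\<integral>\<^sup>+s. indicator {0..1} s * (ennreal \<bar>z\<bar> * ennreal \<bar>f' (x + s * z) - c x\<bar>) \<partial>lborel)" for x
  proof -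
    define G where "G s = f (x + s * z) - c x * z * s" for s
    define g where "g s = z * (f' (x + s * z) - c x)" for s
    have Dg: "(G has_real_derivative g s) (at s)" for s
      unfolding G_def g_def
      by (auto intro!: derivative_eq_intros DERIV_chain2[OF D] simp: algebra_simps)
    have cg: "continuous_on {0..1} g"
    proof -
      have "continuous_on UNIV f'" using cont by (simp add: continuous_at_imp_continuous_on)
      then show ?thesis unfolding g_def by (auto intro!: continuous_intros intro: continuous_on_compose2)
    qed
    have i: "set_integrable lborel {0..1} g" by (rule borel_integrable_atLeastAtMost'[OF cg])
    have "(LINT s|lborel. indicator {0..1} s *\<^sub>R g s) = G 1 - G 0"
      by (rule integral_FTC_atLeastAtMost) 
        (use Dg cg in \<open>auto simp: has_real_derivative_iff_has_vector_derivative[symmetric] intro: DERIV_subset\<close>)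
    then have "\<bar>f (x + z) - f x - c x * z\<bar> = \<bar>LINT s|lborel. indicator {0..1} s *\<^sub>R g s\<bar>"
      by (simp add: G_def)
    then have "ennreal \<bar>f (x + z) - f x - c x * z\<bar> \<le> (\<integral>\<^sup>+s. norm (indicator {0..1} s *\<^sub>R g s) \<partial>lborel)"
      using integral_norm_bound_ennreal[OF i[unfolded set_integrable_def]] by simp
    also have "\<dots> = (\<integral>\<^sup>+s. indicator {0..1} s * (ennreal \<bar>z\<bar> * ennreal \<bar>f' (x + s * z) - c x\<bar>) \<partial>lborel)"
      by (intro nn_integral_cong) (auto simp: g_def indicator_def abs_mult ennreal_mult)
    finally show ?thesis .
  qed
  then have "L1norm (\<lambda>x. f (x + z) - f x - c x * z) \<le>
     (\<integral>\<^sup>+x. (\<integral>\<^sup>+s. indicator {0..1} s * (ennreal \<bar>z\<bar> * ennreal \<bar>f' (x + s * z) - c x\<bar>) \<partial>lborel) \<partial>lborel)"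
    by (intro nn_integral_mono)
  also have "\<dots> = (\<integral>\<^sup>+s. (\<integral>\<^sup>+x. indicator {0..1} s * (ennreal \<bar>z\<bar> * ennreal \<bar>f' (x + s * z) - c x\<bar>) \<partial>lborel) \<partial>lborel)"
    by (rule lborel_pair.Fubini') measurable
  also have "\<dots> = (\<integral>\<^sup>+s. indicator {0..1} s * (ennreal \<bar>z\<bar> * L1norm (\<lambda>x. f' (x + s * z) - c x)) \<partial>lborel)"
    by (simp add: nn_integral_cmult)
  finally show ?thesis .
qed

lemma L1_increment:
  fixes f f' :: "real \<Rightarrow> real"
  assumes D: "\<And>x. (f has_real_derivative f' x) (at x)" and cont: "\<And>x. isCont f' x"
    and le: "L1norm f' \<le> ennreal A"
  shows "L1norm (\<lambda>x. f (x + z) - f x) \<le> ennreal \<bar>z\<bar> * ennreal A"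
proof -
  have [measurable]: "f' \<in> borel_measurable borel" using cont by (rule borel_measurable_isCont)
  have "L1norm (\<lambda>x. f (x + z) - f x) \<le> 
     (\<integral>\<^sup>+s. indicator {0..1} s * (ennreal \<bar>z\<bar> * L1norm (\<lambda>x. f' (x + s * z))) \<partial>lborel)"
    using L1_increment_gen[OF D cont, of "\<lambda>_. 0" z] by simp
  also have "\<dots> \<le> (\<integral>\<^sup>+s. (ennreal \<bar>z\<bar> * ennreal A) * indicator {0..1::real} s \<partial>lborel)"
    by (intro nn_integral_mono) (auto simp: indicator_def nn_integral_shift[of "\<lambda>x. ennreal \<bar>f' x\<bar>"] intro!: mult_left_mono le)
  also have "\<dots> = ennreal \<bar>z\<bar> * ennreal A" by (subst nn_integral_cmult_indicator) auto
  finally show ?thesis .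
qed

text \<open>\<open>\<tau>\<close> is the length scale of \<open>f\<close>, the ratio of the two
  masses. One use of the increment formula gives 2 A |z|, a second one, on f', gives A z^2 /
  \<tau>.\<close>

lemma L1_trem:
  fixes f f' f'' :: "real \<Rightarrow> real"
  assumes D: "\<And>x. (f has_real_derivative f' x) (at x)" "\<And>x. (f' has_real_derivative f'' x) (at x)" 
    and cont: "\<And>x. isCont f'' x" and \<tau>: "0 < \<tau>" and A: "0 \<le> A"
    and le: "L1norm f' \<le> ennreal A" "L1norm f'' \<le> ennreal (A / \<tau>)"
  shows "L1norm (\<lambda>x. trem f f' x z) \<le> ennreal (2 * A * min (z\<^sup>2 / \<tau>) \<bar>z\<bar>)"
proof -
  have cont': "isCont f' x" for x using D(2) by (rule DERIV_isCont)
  have contf: "isCont f x" for x using D(1) by (rule DERIV_isCont)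
  have [measurable]: "f \<in> borel_measurable borel" "f' \<in> borel_measurable borel" "f'' \<in> borel_measurable borel"
    using cont cont' contf by (auto intro: borel_measurable_isCont)
  have "L1norm (\<lambda>x. trem f f' x z) \<le> 
      (\<integral>\<^sup>+x. ennreal \<bar>f (x + z) - f x\<bar> + ennreal \<bar>z\<bar> * ennreal \<bar>f' x\<bar> \<partial>lborel)"
  proof (intro nn_integral_mono)
    fix x
    have "\<bar>trem f f' x z\<bar> \<le> \<bar>f (x + z) - f x\<bar> + \<bar>z\<bar> * \<bar>f' x\<bar>"
      unfolding trem_def using abs_triangle_ineq4[of "f (x+z) - f x" "f' x * z"] by (simp add: abs_mult mult.commute)
    then show "ennreal \<bar>trem f f' x z\<bar> \<le> ennreal \<bar>f (x + z) - f x\<bar> + ennreal \<bar>z\<bar> * ennreal \<bar>f' x\<bar>"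
      by (simp add: ennreal_mult[symmetric] ennreal_plus[symmetric] ennreal_leI del: ennreal_plus)
  qed
  also have "\<dots> = L1norm (\<lambda>x. f (x + z) - f x) + ennreal \<bar>z\<bar> * L1norm f'"
    by (simp add: nn_integral_add nn_integral_cmult)
  also have "\<dots> \<le> ennreal \<bar>z\<bar> * ennreal A + ennreal \<bar>z\<bar> * ennreal A"
    by (intro add_mono L1_increment[OF D(1) cont' le(1)] mult_left_mono le) auto
  also have "\<dots> = ennreal (2 * A * \<bar>z\<bar>)"
    using A by (simp add: ennreal_mult[symmetric] ennreal_plus[symmetric] algebra_simps del: ennreal_plus)
  finally have 1: "L1norm (\<lambda>x. trem f f' x z) \<le> ennreal (2 * A * \<bar>z\<bar>)" .
  have "L1norm (\<lambda>x. trem f f' x z) \<le> 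
      (\<integral>\<^sup>+s. indicator {0..1} s * (ennreal \<bar>z\<bar> * L1norm (\<lambda>x. f' (x + s * z) - f' x)) \<partial>lborel)"
    unfolding trem_def by (rule L1_increment_gen[OF D(1) cont']) measurable
  also have "\<dots> \<le> (\<integral>\<^sup>+s. (ennreal \<bar>z\<bar> * (ennreal \<bar>z\<bar> * ennreal (A / \<tau>))) * indicator {0..1::real} s \<partial>lborel)"
  proof (intro nn_integral_mono)
    fix s :: real
    show "indicator {0..1} s * (ennreal \<bar>z\<bar> * L1norm (\<lambda>x. f' (x + s * z) - f' x)) \<le>
        (ennreal \<bar>z\<bar> * (ennreal \<bar>z\<bar> * ennreal (A / \<tau>))) * indicator {0..1} s"
    proof (cases "s \<in> {0..1}")
      case True
      have "L1norm (\<lambda>x. f' (x + s * z) - f' x) \<le> ennreal \<bar>s * z\<bar> * ennreal (A / \<tau>)"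
        by (rule L1_increment[OF D(2) cont le(2)])
      also have "\<dots> \<le> ennreal \<bar>z\<bar> * ennreal (A / \<tau>)"
        using True by (intro mult_right_mono ennreal_leI) (auto simp: abs_mult mult_left_le_one_le)
      finally show ?thesis using True by (auto intro!: mult_left_mono)
    qed simp
  qed
  also have "\<dots> = ennreal (A * (z\<^sup>2 / \<tau>))"
    using A \<tau> by (subst nn_integral_cmult_indicator) (auto simp: ennreal_mult[symmetric] power2_eq_square algebra_simps)
  also have "\<dots> \<le> ennreal (2 * A * (z\<^sup>2 / \<tau>))"
    using A \<tau> by (intro ennreal_leI) (auto intro!: divide_right_mono mult_right_mono)
  finally have 2: "L1norm (\<lambda>x. trem f f' x z) \<le> ennreal (2 * A * (z\<^sup>2 / \<tau>))" .
  show ?thesis using 1 2 by (simp add: min_def)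
qed

context frac_order
begin

text \<open>The iterated integral is kept, and not only the norm of \<open>Lop\<close>, because it
  also supplies the absolute integrability for Fubini when the operator is moved onto the
  weight.\<close>

lemma L1_L1_trem:
  fixes f f' f'' :: "real \<Rightarrow> real"
  assumes D: "\<And>x. (f has_real_derivative f' x) (at x)" "\<And>x. (f' has_real_derivative f'' x) (at x)" 
    and cont: "\<And>x. isCont f'' x" and \<tau>: "0 < \<tau>" and A: "0 \<le> A"
    and le: "L1norm f' \<le> ennreal A" "L1norm f'' \<le> ennreal (A / \<tau>)"
  shows "(\<integral>\<^sup>+z. L1norm (\<lambda>x. trem f f' x z / \<bar>z\<bar> powr (1 + \<alpha>)) \<partial>lborel) 
    \<le> ennreal (2 * A * (\<tau> powr (1 - \<alpha>) * kint))"
proof -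
  have cont': "isCont f' x" for x using D(2) by (rule DERIV_isCont)
  have contf: "isCont f x" for x using D(1) by (rule DERIV_isCont)
  have [measurable]: "f \<in> borel_measurable borel" "f' \<in> borel_measurable borel"
    using cont' contf by (auto intro: borel_measurable_isCont)
  have "(\<integral>\<^sup>+z. L1norm (\<lambda>x. trem f f' x z / \<bar>z\<bar> powr (1 + \<alpha>)) \<partial>lborel) \<le>
      (\<integral>\<^sup>+z. ennreal (2 * A * (min (z\<^sup>2 / \<tau>) \<bar>z\<bar> / \<bar>z\<bar> powr (1 + \<alpha>))) \<partial>lborel)"
  proof (intro nn_integral_mono)
    fix z :: real
    have "L1norm (\<lambda>x. trem f f' x z / \<bar>z\<bar> powr (1 + \<alpha>)) =
        (\<integral>\<^sup>+x. ennreal (1 / \<bar>z\<bar> powr (1 + \<alpha>)) * ennreal \<bar>trem f f' x z\<bar> \<partial>lborel)"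
      by (intro nn_integral_cong) (auto simp: ennreal_mult[symmetric])
    also have "\<dots> = ennreal (1 / \<bar>z\<bar> powr (1 + \<alpha>)) * L1norm (\<lambda>x. trem f f' x z)"
      by (rule nn_integral_cmult) measurable
    also have "\<dots> \<le> ennreal (1 / \<bar>z\<bar> powr (1 + \<alpha>)) * ennreal (2 * A * min (z\<^sup>2 / \<tau>) \<bar>z\<bar>)"
      by (intro mult_left_mono L1_trem[OF D cont \<tau> A le]) auto
    also have "\<dots> = ennreal (2 * A * (min (z\<^sup>2 / \<tau>) \<bar>z\<bar> / \<bar>z\<bar> powr (1 + \<alpha>)))"
      using A \<tau> by (subst ennreal_mult[symmetric]) auto
    finally show "L1norm (\<lambda>x. trem f f' x z / \<bar>z\<bar> powr (1 + \<alpha>)) \<le> 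
      ennreal (2 * A * (min (z\<^sup>2 / \<tau>) \<bar>z\<bar> / \<bar>z\<bar> powr (1 + \<alpha>)))" .
  qed
  also have "\<dots> = ennreal (LINT z|lborel. 2 * A * (min (z\<^sup>2 / \<tau>) \<bar>z\<bar> / \<bar>z\<bar> powr (1 + \<alpha>)))"
    using A \<tau> by (intro nn_integral_eq_integral integrable_mult_right kap_scale(1) AE_I2) auto
  also have "\<dots> = ennreal (2 * A * (\<tau> powr (1 - \<alpha>) * kint))"
    by (subst integral_mult_right_zero) (simp only: kap_scale(2)[OF \<tau>])
  finally show ?thesis .
qed

lemma L1_Lop:
  fixes f f' f'' :: "real \<Rightarrow> real"
  assumes D: "\<And>x. (f has_real_derivative f' x) (at x)" "\<And>x. (f' has_real_derivative f'' x) (at x)" 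
    and cont: "\<And>x. isCont f'' x" and \<tau>: "0 < \<tau>" and A: "0 \<le> A"
    and le: "L1norm f' \<le> ennreal A" "L1norm f'' \<le> ennreal (A / \<tau>)"
    and C: "C11 f f' K"
  shows "L1norm (\<lambda>x. Lop f f' x) \<le> ennreal (2 * A * (\<tau> powr (1 - \<alpha>) * kint))"
proof -
  note [measurable] = C11_measurable[OF C]
  have "L1norm (\<lambda>x. Lop f f' x) \<le> 
      (\<integral>\<^sup>+x. L1norm (\<lambda>z. trem f f' x z / \<bar>z\<bar> powr (1 + \<alpha>)) \<partial>lborel)"
    unfolding Lop_def using integral_norm_bound_ennreal[OF integrable_trem[OF C]] by (intro nn_integral_mono) simp
  also have "\<dots> = (\<integral>\<^sup>+z. L1norm (\<lambda>x. trem f f' x z / \<bar>z\<bar> powr (1 + \<alpha>)) \<partial>lborel)"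
    by (rule lborel_pair.Fubini') measurable
  also have "\<dots> \<le> ennreal (2 * A * (\<tau> powr (1 - \<alpha>) * kint))"
    by (rule L1_L1_trem[OF D cont \<tau> A le])
  finally show ?thesis .
qed

end

subsection \<open>A maximum principle with doubled variables\<close>

lemma cauchy_schwarz_sqrt: "1 + x * y \<le> sqrt (1 + x\<^sup>2) * sqrt (1 + (y::real)\<^sup>2)"
proof -
  have "(1 + x * y)\<^sup>2 \<le> (1 + x\<^sup>2) * (1 + y\<^sup>2)"
    using zero_le_power2[of "x - y"] by (simp add: power2_eq_square algebra_simps)
  then have "1 + x * y \<le> sqrt ((1 + x\<^sup>2) * (1 + y\<^sup>2))" by (rule real_le_rsqrt)
  then show ?thesis by (simp add: real_sqrt_mult)
qed

text \<open>A convex penalty with linear growth and bounded first and second derivatives. It forces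
  a maximum to be attained, while its slope and its nonlocal term stay bounded and cost only
  O(\<epsilon>). Rescaled, it is also the smoothed absolute value \<open>eta\<close>.\<close>

definition psi :: "real \<Rightarrow> real" where "psi x = sqrt (1 + x\<^sup>2)"
definition psi' :: "real \<Rightarrow> real" where "psi' x = x / sqrt (1 + x\<^sup>2)"

lemma psi_pos: "0 < psi x" "\<bar>x\<bar> \<le> psi x"
  unfolding psi_def by (auto intro!: real_le_rsqrt add_pos_nonneg)

lemma psi'_le: "\<bar>psi' x\<bar> \<le> 1"
  using psi_pos[of x] by (simp add: psi'_def psi_def divide_simps abs_mult)

lemma sqrt_1_sq_pos: "0 < sqrt (1 + (x::real)\<^sup>2)"
  by (simp add: add_pos_nonneg)

lemma C11_psi: "C11 psi psi' 1"
proof (rule C11I)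
  fix x :: real
  have p: "0 < 1 + x\<^sup>2" by (simp add: add_pos_nonneg)
  show "(psi has_real_derivative psi' x) (at x)"
    unfolding psi_def psi'_def using p
    by (auto intro!: derivative_eq_intros simp: divide_simps)
  have s: "sqrt (1 + x\<^sup>2) * sqrt (1 + x\<^sup>2) = 1 + x\<^sup>2" using p by simp
  show "(psi' has_real_derivative 1 / (sqrt (1 + x\<^sup>2)) ^ 3) (at x)"
    unfolding psi'_def using p s
    by (auto intro!: derivative_eq_intros simp: field_simps power2_eq_square power3_eq_cube)
  show "\<bar>psi' x\<bar> \<le> 1" by (rule psi'_le)
  have "1 \<le> sqrt (1 + x\<^sup>2) ^ 3" by (intro one_le_power) simp
  moreover have "\<bar>1 / q\<bar> \<le> 1" if "1 \<le> q" for q :: real using that by (simp add: divide_simps)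
  ultimately show "\<bar>1 / (sqrt (1 + x\<^sup>2)) ^ 3\<bar> \<le> 1" by blast
qed

text \<open>Convexity: the tangent lies below the graph. After multiplication by sqrt(1 + x^2) this
  is the Cauchy-Schwarz inequality for (1, x) and (1, x + z).\<close>

lemma trem_psi_nonneg: "0 \<le> trem psi psi' x z"
proof -
  have "(psi x + psi' x * z) * sqrt (1 + x\<^sup>2) = 1 + x * (x + z)"
  proof -
    define S where "S = sqrt (1 + x\<^sup>2)"
    have "S \<noteq> 0" "S * S = 1 + x\<^sup>2" using sqrt_1_sq_pos[of x] by (auto simp: S_def)
    then show ?thesis unfolding psi_def psi'_def S_def[symmetric] by (simp add: field_simps power2_eq_square)
  qed
  also have "\<dots> \<le> psi (x + z) * sqrt (1 + x\<^sup>2)"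
    using cauchy_schwarz_sqrt[of x "x+z"] by (simp add: psi_def mult.commute)
  finally have "psi x + psi' x * z \<le> psi (x + z)" using sqrt_1_sq_pos[of x] by (simp only: mult_le_cancel_right_pos)
  then show ?thesis by (simp add: trem_def)
qed

lemma exists_antiderivative:
  fixes f :: "real \<Rightarrow> real"
  assumes "\<And>x. isCont f x"
  shows "\<exists>F. \<forall>x. (F has_real_derivative f x) (at x)"
  using einterval_antiderivative[of "-\<infinity>" "\<infinity>" f] assms
  by (auto simp: has_real_derivative_iff_has_vector_derivative)

lemma LINT_interval_le:
  fixes f G g :: "real \<Rightarrow> real"
  assumes f: "\<And>x. isCont f x" and G: "\<And>x. (G has_real_derivative g x) (at x)" and le: "\<And>x. f x \<le> g x"
    and ab: "a \<le> b" and g: "\<And>x. isCont g x"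
  shows "integrable lborel (\<lambda>x. indicator {a..b} x * f x)" "(LINT x|lborel. indicator {a..b} x * f x) \<le> G b - G a"
proof -
  have i: "integrable lborel (\<lambda>x. indicator {a..b} x * h x)" if "\<And>x. isCont h x" for h :: "real \<Rightarrow> real"
    using borel_integrable_atLeastAtMost'[of a b h] that by (simp add: set_integrable_def continuous_at_imp_continuous_on)
  show "integrable lborel (\<lambda>x. indicator {a..b} x * f x)" by (rule i[OF f])
  have "(LINT x|lborel. indicator {a..b} x *\<^sub>R g x) = G b - G a"
    by (rule integral_FTC_atLeastAtMost[OF ab])
      (use G g in \<open>auto simp: has_real_derivative_iff_has_vector_derivative[symmetric] 
        intro: has_field_derivative_at_within continuous_at_imp_continuous_on\<close>)
  moreover have "(LINT x|lborel. indicator {a..b} x * f x) \<le> (LINT x|lborel. indicator {a..b} x * g x)"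
    by (intro integral_mono i f g) (auto simp: indicator_def le)
  ultimately show "(LINT x|lborel. indicator {a..b} x * f x) \<le> G b - G a" by simp
qed

context frac_order
begin

text \<open>The integrand on the left is everywhere at most that of \<open>\<epsilon> psi\<close>. On \<open>[-r, r]\<close> the kernel may therefore be
  replaced by its minimum, which turns the nonlocal term into a difference of integrals of \<open>f\<close> over two
  intervals of length \<open>2 r\<close>, at distance \<open>k\<close>.\<close>

lemma nonlocal_gain:
  fixes x k r \<epsilon> \<sigma> M K :: real
  assumes f: "C11 f f' K" and M: "\<And>x. \<bar>f x\<bar> \<le> M" and r: "0 < r" and eps: "0 \<le> \<epsilon>" and k: "0 \<le> k"
    and s: "\<bar>\<sigma>\<bar> = 1"
    and le: "\<And>z. \<sigma> * (trem f f' x z - trem f f' (x - k) z) \<le> \<epsilon> * trem psi psi' x z"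
  shows "\<sigma> * (Lop f f' x - Lop f f' (x - k)) \<le> 
    (2 * M * k - 2 * r * (\<sigma> * (f x - f (x - k)))) / r powr (1 + \<alpha>) + \<epsilon> * (2 * kint)"
proof -
  let ?p = "\<lambda>z::real. \<bar>z\<bar> powr (1 + \<alpha>)"
  define D where "D = \<sigma> * (f x - f (x - k))"
  define c where "c = \<sigma> * (f' x - f' (x - k))"
  define I where "I z = \<sigma> * (trem f f' x z - trem f f' (x - k) z) - \<epsilon> * trem psi psi' x z" for z
  define J where "J z = \<sigma> * (f (x + z) - f (x - k + z)) - D - c * z" for z
  have cf: "isCont f z" "isCont psi z" for z using C11_continuous f C11_psi by blast+
  have comp: "isCont (\<lambda>z. h (w + z)) z" if "\<And>z. isCont h z" for h :: "real \<Rightarrow> real" and w z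
    using that by (intro isCont_o2[of z "\<lambda>z. w + z" h]) auto
  have cI: "isCont I z" for z
    unfolding I_def trem_def by (intro continuous_intros comp cf)
  have cJ: "isCont J z" for z
    unfolding J_def by (intro continuous_intros comp cf)
  have I0: "I z \<le> 0" for z using le by (simp add: I_def)
  have IJ: "I z \<le> J z" for z
  proof -
    have "\<sigma> * (trem f f' x z - trem f f' (x - k) z) = J z"
      unfolding J_def c_def D_def trem_def by (simp add: algebra_simps)
    then show ?thesis using trem_psi_nonneg[of x z] eps by (simp add: I_def)
  qed
  obtain P where P: "\<And>x. (P has_real_derivative f x) (at x)" using exists_antiderivative[of f] cf by auto
  define H where "H z = \<sigma> * (P (x + z) - P (x - k + z)) - D * z - c * z\<^sup>2 / 2" for z
  have DH: "(H has_real_derivative J z) (at z)" for z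
    unfolding H_def J_def
    by (auto intro!: derivative_eq_intros DERIV_chain2[OF P] simp: algebra_simps)
  have PM: "\<bar>P (v + k) - P v\<bar> \<le> M * k" for v
    using DERIV_bound_imp_lipschitz[OF P M, of "v+k" v] k by simp
  \<comment> \<open>The windows around x and x - k differ by two end pieces of length k, each
    contributing at most M k. In \<open>Hle\<close> the quadratic term with \<open>c\<close> is even
    and cancels.\<close>
  have "\<bar>\<sigma> * (P (x + r) - P (x - k + r) - (P (x - r) - P (x - k - r)))\<bar> \<le> M * k + M * k"
    unfolding abs_mult s using PM[of "x - k + r"] PM[of "x - k - r"] by simp
  then have Hle: "H r - H (-r) \<le> 2 * M * k - 2 * r * D"
    by (simp add: H_def algebra_simps)
  have "integrable lborel (\<lambda>z. indicator {-r..r} z * I z)" and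
    LI: "(LINT z|lborel. indicator {-r..r} z * I z) \<le> H r - H (-r)"
    using LINT_interval_le[OF cI DH IJ, of "-r" r] cJ r by auto
  note intI = this(1)
  have iI: "integrable lborel (\<lambda>z. I z / ?p z)"
    and LIeq: "(LINT z|lborel. I z / ?p z) = \<sigma> * (Lop f f' x - Lop f f' (x - k)) - \<epsilon> * Lop psi psi' x"
  proof -
    have e: "I z / ?p z = \<sigma> * (trem f f' x z / ?p z - trem f f' (x - k) z / ?p z) - \<epsilon> * (trem psi psi' x z / ?p z)" for z
      unfolding I_def by (simp add: diff_divide_distrib right_diff_distrib)
    note i = integrable_trem[OF f, of x] integrable_trem[OF f, of "x - k"] integrable_trem[OF C11_psi, of x]
    show "integrable lborel (\<lambda>z. I z / ?p z)"
      unfolding e by (intro Bochner_Integration.integrable_diff integrable_mult_right i)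
    show "(LINT z|lborel. I z / ?p z) = \<sigma> * (Lop f f' x - Lop f f' (x - k)) - \<epsilon> * Lop psi psi' x"
      unfolding e Lop_def 
      by (subst Bochner_Integration.integral_diff integral_mult_right_zero; 
          (intro Bochner_Integration.integrable_diff integrable_mult_right i)?)+ simp
  qed
  have "(LINT z|lborel. I z / ?p z) \<le> (LINT z|lborel. (indicator {-r..r} z * I z) / r powr (1 + \<alpha>))"
  proof (intro integral_mono iI integrable_divide intI)
    fix z
    show "I z / ?p z \<le> (indicator {-r..r} z * I z) / r powr (1 + \<alpha>)"
    proof (cases "z \<in> {-r..r} \<and> z \<noteq> 0")
      case True
      then have "?p z \<le> r powr (1 + \<alpha>)" using alpha by (intro powr_mono2) auto
      then show ?thesis using True I0[of z] by (auto intro!: divide_left_mono_neg)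
    next
      case False
      then show ?thesis using I0[of z] by (auto simp: I_def trem_def indicator_def divide_nonpos_nonneg)
    qed
  qed
  also have "\<dots> = (LINT z|lborel. indicator {-r..r} z * I z) / r powr (1 + \<alpha>)" by simp
  also have "\<dots> \<le> (2 * M * k - 2 * r * D) / r powr (1 + \<alpha>)"
    using LI Hle by (intro divide_right_mono) auto
  finally have "\<sigma> * (Lop f f' x - Lop f f' (x - k)) \<le> (2 * M * k - 2 * r * D) / r powr (1 + \<alpha>) + \<epsilon> * Lop psi psi' x"
    unfolding LIeq by simp
  moreover have "\<epsilon> * Lop psi psi' x \<le> \<epsilon> * (2 * kint)"
    using Lop_bound[OF C11_psi, of x] eps by (intro mult_left_mono) auto
  ultimately show ?thesis unfolding D_def by linarith
qed

end

section \<open>Regularity of the solution at positive times and the maximum principle\<close>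

locale frac_burgers = frac_order +
  fixes u0 :: "real \<Rightarrow> real" and u :: "real \<Rightarrow> real \<Rightarrow> real"
  assumes sol: "is_solution \<alpha> u0 u"
begin

lemma u_Cb_inf: "0 < a \<Longrightarrow> a < T \<Longrightarrow> Cb_inf_on ({a<..<T} \<times> UNIV) u"
  using sol unfolding is_solution_def by (meson less_trans)

lemma Dw_bounded:
  assumes "0 < a" "a < T"
  obtains K where "\<And>t x. a < t \<Longrightarrow> t < T \<Longrightarrow> \<bar>Dw bs u t x\<bar> \<le> K"
proof -
  have "bounded ((\<lambda>(t,x). Dw bs u t x) ` ({a<..<T} \<times> UNIV))"
    using u_Cb_inf[OF assms] unfolding Cb_inf_on_def by blast
  then obtain K where "\<forall>y\<in>(\<lambda>(t,x). Dw bs u t x) ` ({a<..<T} \<times> UNIV). norm y \<le> K"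
    unfolding bounded_iff by blast
  then show thesis by (intro that[of K]) force
qed

lemma Dw_differentiable:
  assumes "0 < t"
  shows "(\<lambda>s. Dw bs u s x) differentiable (at t)" "(\<lambda>y. Dw bs u t y) differentiable (at x)"
proof -
  have "Cb_inf_on ({t/2<..<t+1} \<times> UNIV) u" using assms by (intro u_Cb_inf) auto
  moreover have "(t,x) \<in> {t/2<..<t+1} \<times> UNIV" using assms by auto
  ultimately have "case (t,x) of (t,x) \<Rightarrow> (\<lambda>s. Dw bs u s x) differentiable (at t) \<and> (\<lambda>y. Dw bs u t y) differentiable (at x)"
    unfolding Cb_inf_on_def by blast
  then show "(\<lambda>s. Dw bs u s x) differentiable (at t)" "(\<lambda>y. Dw bs u t y) differentiable (at x)" by auto
qed

lemma u_DERIV: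
  assumes "0 < t"
  shows "((\<lambda>s. u s x) has_real_derivative dt u t x) (at t)"
    "(u t has_real_derivative dx u t x) (at x)" "(dx u t has_real_derivative dx (dx u) t x) (at x)"
    "isCont (dt u t) x"
  using Dw_differentiable[OF assms, of "[]" x] Dw_differentiable[OF assms, of "[False]" x] 
    Dw_differentiable(2)[OF assms, of "[True]" x]
  by (simp_all add: dt_def dx_def DERIV_deriv_iff_real_differentiable differentiable_imp_continuous_within)

lemma u_continuous: "continuous_on ({0<..} \<times> UNIV) (\<lambda>(t,x). u t x)"
proof (rule continuous_at_imp_continuous_on, rule ballI)
  fix p :: "real \<times> real" assume p: "p \<in> {0<..} \<times> UNIV"
  let ?S = "{fst p / 2<..<fst p + 1} \<times> (UNIV :: real set)"
  have "continuous_on ?S (\<lambda>(t,x). Dw [] u t x)"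
    using u_Cb_inf[of "fst p / 2" "fst p + 1"] p unfolding Cb_inf_on_def by (force dest: spec[of _ "[]"])
  then have "continuous_on ?S (\<lambda>(t,x). u t x)" by simp
  moreover have "open ?S" "p \<in> ?S" using p by (auto intro!: open_Times simp: mem_Times_iff)
  ultimately show "isCont (\<lambda>(t,x). u t x) p" using continuous_on_eq_continuous_at by blast
qed

lemma u_bounded:
  obtains M where "1 \<le> M" "\<And>t x. 0 < t \<Longrightarrow> t < T \<Longrightarrow> \<bar>u t x\<bar> \<le> M"
proof (cases "0 < T")
  case True
  then have "bounded ((\<lambda>(t,x). u t x) ` ({0<..<T} \<times> UNIV))"
    using sol unfolding is_solution_def Cb_on_def by blast
  then obtain K where "\<forall>y\<in>(\<lambda>(t,x). u t x) ` ({0<..<T} \<times> UNIV). norm y \<le> K"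
    unfolding bounded_iff by blast
  then show thesis by (intro that[of "max 1 K"]) (force simp: le_max_iff_disj)+
qed (auto intro: that[of 1])

lemma u_C11:
  assumes "0 < a" "a < T"
  obtains K where "\<And>t. a < t \<Longrightarrow> t < T \<Longrightarrow> C11 (u t) (dx u t) K" 
    "\<And>t x. a < t \<Longrightarrow> t < T \<Longrightarrow> \<bar>dt u t x\<bar> \<le> K"
proof -
  obtain K1 where K1: "\<And>t x. a < t \<Longrightarrow> t < T \<Longrightarrow> \<bar>Dw [False] u t x\<bar> \<le> K1" using Dw_bounded[OF assms] by blast
  obtain K2 where K2: "\<And>t x. a < t \<Longrightarrow> t < T \<Longrightarrow> \<bar>Dw [False,False] u t x\<bar> \<le> K2" using Dw_bounded[OF assms] by blast
  obtain K3 where K3: "\<And>t x. a < t \<Longrightarrow> t < T \<Longrightarrow> \<bar>Dw [True] u t x\<bar> \<le> K3" using Dw_bounded[OF assms] by blast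
  show thesis
  proof (rule that[of "max (max K1 K2) K3"])
    fix t assume t: "a < t" "t < T"
    then have t0: "0 < t" using assms by simp
    show "C11 (u t) (dx u t) (max (max K1 K2) K3)"
      by (rule C11I[OF u_DERIV(2)[OF t0] u_DERIV(3)[OF t0]])
        (use K1[OF t] K2[OF t] in \<open>auto simp: le_max_iff_disj\<close>)
    show "\<bar>dt u t x\<bar> \<le> max (max K1 K2) K3" for x using K3[OF t] by (auto simp: le_max_iff_disj)
  qed
qed

lemma u_C11_at:
  assumes "0 < t"
  obtains K where "C11 (u t) (dx u t) K"
proof -
  obtain K where "\<And>s. t/2 < s \<Longrightarrow> s < t+1 \<Longrightarrow> C11 (u s) (dx u s) K"
    by (rule u_C11[of "t/2" "t+1"]) (use assms in auto)
  then have "C11 (u t) (dx u t) K" using assms by simp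
  then show thesis by (rule that)
qed

lemma u_eq:
  assumes "0 < t"
  shows "dt u t x = CA * Lop (u t) (dx u t) x - u t x * dx u t x"
proof -
  obtain K where "C11 (u t) (dx u t) K" using u_C11_at[OF assms] .
  moreover have "dt u t x + fraclap \<alpha> (u t) x + u t x * dx u t x = 0"
    using sol assms unfolding is_solution_def by (meson less_add_one zero_less_one add_pos_pos)
  ultimately show ?thesis by (simp add: fraclap_eq_Lop)
qed

lemma u_continuous_on_comp:
  fixes f g :: "'b::topological_space \<Rightarrow> real"
  assumes "continuous_on S f" "continuous_on S g" "\<And>p. p \<in> S \<Longrightarrow> 0 < f p"
  shows "continuous_on S (\<lambda>p. u (f p) (g p))"
  using continuous_on_compose2[OF u_continuous, of S "\<lambda>p. (f p, g p)"] assms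
  by (force intro: continuous_on_Pair)

text \<open>Comparing values at two points instead of estimating \<open>u\<^sub>x\<close> avoids differentiating the equation. At a
  maximum the slopes of \<open>u\<close> at both points equal \<open>g\<close> up to the penalty \<open>\<epsilon> psi\<close>, which is there only to
  make the maximum exist; \<open>D\<close> stands for the difference of the two values.\<close>

theorem modulus_barrier:
  fixes g g' :: "real \<Rightarrow> real" and \<sigma> M a T gm :: real
  assumes a: "0 < a" and \<sigma>: "\<bar>\<sigma>\<bar> = 1"
    and M: "1 \<le> M" "\<And>t x. 0 < t \<Longrightarrow> t < T \<Longrightarrow> \<bar>u t x\<bar> \<le> M"
    and g: "\<And>t. a < t \<Longrightarrow> t < T \<Longrightarrow> (g has_real_derivative g' t) (at t)"
    and gm: "0 < gm" "\<And>t. a < t \<Longrightarrow> t < T \<Longrightarrow> gm \<le> g t"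
    and blow: "filterlim g at_top (at_right a)"
    and barrier: "\<And>t k D. a < t \<Longrightarrow> t < T \<Longrightarrow> 0 < k \<Longrightarrow> g t * k < D \<Longrightarrow> D \<le> 2 * M \<Longrightarrow>
       \<exists>r>0. CA * ((2 * M * k - 2 * r * D) / r powr (1 + \<alpha>)) - \<sigma> * g t * D \<le> g' t * k"
    and t: "a < t" "t < T" and xy: "y \<le> x"
  shows "\<sigma> * (u t x - u t y) \<le> g t * (x - y)"
proof (rule ccontr)
  assume neg: "\<not> \<sigma> * (u t x - u t y) \<le> g t * (x - y)"
  define k1 where "k1 = x - y"
  define \<mu> where "\<mu> = \<sigma> * (u t x - u t y) - g t * k1"
  have \<mu>: "0 < \<mu>" using neg by (simp add: \<mu>_def k1_def)
  have k1: "0 \<le> k1" using xy by (simp add: k1_def)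
  have ss: "\<sigma> * \<sigma> = 1" using \<sigma> by (metis abs_mult_self mult_1)
  obtain K where KC: "\<And>s. a/2 < s \<Longrightarrow> s < T \<Longrightarrow> C11 (u s) (dx u s) K"
    by (rule u_C11[of "a/2" T]) (use a t in auto)
  have KC: "C11 (u s) (dx u s) K" if "a < s" "s < T" for s using KC that a by simp
  \<comment> \<open>This rate pays for the penalty: 2 CA \<open>kint\<close> for its nonlocal term,
    M for its share in the transport term; the final 1 makes the contradiction strict.\<close>
  define lam where "lam = M + 2 * CA * kint + 1"
  have lam: "0 < lam" using M CA_pos kint_nonneg by (simp add: lam_def add_pos_nonneg)
  have t0: "0 < t" using a t by simp
  \<comment> \<open>With this value the penalty at the point of violation equals \<mu>/2, so
    \<open>F\<close> is still positive there.\<close>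
  define \<epsilon> where "\<epsilon> = \<mu> / (2 * (psi x + lam * t))"
  have den: "0 < psi x + lam * t" using psi_pos[of x] lam t0 by (simp add: add_pos_pos)
  have eps: "0 < \<epsilon>" using \<mu> den by (simp add: \<epsilon>_def)
  have "m / (2 * W) * W = m / 2" if "0 < W" for m W :: real using that by simp
  from this[OF den] have epsmu: "\<epsilon> * (psi x + lam * t) < \<mu>" using \<mu> by (simp only: \<epsilon>_def)
  define F where "F s \<xi> k = \<sigma> * (u s \<xi> - u s (\<xi> - k)) - g s * k - \<epsilon> * psi \<xi> - \<epsilon> * lam * s" for s \<xi> k
  have F1: "0 < F t x k1"
    using epsmu unfolding F_def \<mu>_def k1_def by (simp add: algebra_simps)
  have "eventually (\<lambda>s. K < g s) (at_right a)" using blow by (simp add: filterlim_at_top_dense)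
  then obtain b where b: "a < b" "\<And>s. a < s \<Longrightarrow> s < b \<Longrightarrow> K < g s"
    unfolding eventually_at_right_field by blast
  \<comment> \<open>At \<open>a1\<close> the barrier slope exceeds the Lipschitz constant
    \<open>K\<close> of the solution, so a positive maximum of \<open>F\<close> cannot sit at the
    initial time.\<close>
  define a1 where "a1 = (a + min b t) / 2"
  have a1: "a < a1" "a1 < t" "a1 < b" using b t by (auto simp: a1_def min_def field_simps)
  \<comment> \<open>Outside the box given by \<open>X\<close> and \<open>B\<close>,
    \<open>Fle\<close> makes \<open>F\<close> nonpositive, so a maximum over the compact set is one
    over all \<xi> and all k \<ge> 0. The other summands keep the point of violation inside.\<close>
  define X where "X = 2 * M / \<epsilon> + \<bar>x\<bar> + 1"
  define B where "B = 2 * M / gm + k1 + 1"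
  define S where "S = {a1..t} \<times> {-X..X} \<times> {0..B}"
  have udiff: "\<sigma> * (u s \<xi> - u s \<eta>) \<le> 2 * M" if "0 < s" "s < T" for s \<xi> \<eta>
  proof -
    have "\<sigma> * (u s \<xi> - u s \<eta>) \<le> \<bar>\<sigma>\<bar> * \<bar>u s \<xi> - u s \<eta>\<bar>" by (metis abs_ge_self abs_mult)
    also have "\<dots> \<le> 2 * M" using M(2)[OF that, of \<xi>] M(2)[OF that, of \<eta>] \<sigma> by simp
    finally show ?thesis .
  qed
  have Fle: "F s \<xi> k \<le> 2 * M - gm * k - \<epsilon> * \<bar>\<xi>\<bar>" if "a1 \<le> s" "s \<le> t" "0 \<le> k" for s \<xi> k
  proof -
    have s: "a < s" "s < T" "0 < s" using that a1 a t by auto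
    have "gm * k \<le> g s * k" using gm(2)[OF s(1,2)] that by (intro mult_right_mono) auto
    moreover have "\<epsilon> * \<bar>\<xi>\<bar> \<le> \<epsilon> * psi \<xi>" using eps psi_pos(2)[of \<xi>] by (intro mult_left_mono) auto
    moreover have "0 \<le> \<epsilon> * lam * s" using eps lam s by simp
    ultimately show ?thesis using udiff[OF s(3,2), of \<xi> "\<xi> - k"] unfolding F_def by linarith
  qed
  have "compact S" unfolding S_def by (intro compact_Times compact_Icc)
  have cg: "continuous_on {a1..t} g"
    using a1 t g by (intro continuous_at_imp_continuous_on ballI DERIV_isCont[OF g]) auto
  have cpsi: "continuous_on UNIV psi" unfolding psi_def by (intro continuous_intros)
  have "continuous_on S (\<lambda>p. F (fst p) (fst (snd p)) (snd (snd p)))"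
    unfolding F_def using a1 a
    by (intro continuous_intros u_continuous_on_comp continuous_on_compose2[OF cg] continuous_on_compose2[OF cpsi])
      (auto simp: S_def)
  moreover have tin: "(t, x, k1) \<in> S"
  proof -
    have "0 \<le> 2 * M / \<epsilon>" "0 \<le> 2 * M / gm" using M eps gm by auto
    then show ?thesis using a1 k1 by (auto simp: S_def X_def B_def)
  qed
  ultimately obtain p where p: "p \<in> S" "\<And>q. q \<in> S \<Longrightarrow> F (fst q) (fst (snd q)) (snd (snd q)) \<le> F (fst p) (fst (snd p)) (snd (snd p))"
    using continuous_attains_sup[OF \<open>compact S\<close>, of "\<lambda>p. F (fst p) (fst (snd p)) (snd (snd p))"] by blast
  obtain s0 \<xi>0 k0 where p_eq: "p = (s0, \<xi>0, k0)" by (cases p)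
  have s0: "a1 \<le> s0" "s0 \<le> t" "a < s0" "s0 < T" "0 < s0" and k0: "0 \<le> k0" using p(1) p_eq a1 a t by (auto simp: S_def)
  have max: "F s \<xi> k \<le> F s0 \<xi>0 k0" if "(s,\<xi>,k) \<in> S" for s \<xi> k using p(2)[OF that] by (simp add: p_eq)
  have Fpos: "0 < F s0 \<xi>0 k0" using F1 max[OF tin] by simp
  have gmax: "F s \<xi> k \<le> F s0 \<xi>0 k0" if "a1 \<le> s" "s \<le> t" "0 \<le> k" for s \<xi> k
  proof (cases "(s,\<xi>,k) \<in> S")
    case False
    then have "X < \<bar>\<xi>\<bar> \<or> B < k" using that by (auto simp: S_def)
    then have "F s \<xi> k \<le> 0"
    proof
      assume "X < \<bar>\<xi>\<bar>"
      then have "2 * M / \<epsilon> < \<bar>\<xi>\<bar>" by (auto simp: X_def)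
      then have "2 * M < \<epsilon> * \<bar>\<xi>\<bar>" using eps by (simp add: divide_less_eq mult.commute)
      then show ?thesis using Fle[OF that, of \<xi>] gm(1) that(3) mult_nonneg_nonneg[of gm k] by linarith
    next
      assume "B < k"
      then have "2 * M / gm < k" using k1 by (auto simp: B_def)
      then have "2 * M < gm * k" using gm by (simp add: divide_less_eq mult.commute)
      then show ?thesis using Fle[OF that, of \<xi>] eps mult_nonneg_nonneg[of \<epsilon> "\<bar>\<xi>\<bar>"] by linarith
    qed
    then show ?thesis using Fpos by simp
  qed (rule max)
  define y0 where "y0 = \<xi>0 - k0"
  define D where "D = \<sigma> * (u s0 \<xi>0 - u s0 y0)"
  have pen: "0 < \<epsilon> * psi \<xi>0 + \<epsilon> * lam * s0"
    using eps psi_pos(1)[of \<xi>0] lam s0 by (simp add: add_pos_pos)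
  have Dg: "g s0 * k0 < D" using Fpos pen unfolding F_def D_def y0_def by linarith
  have D2M: "D \<le> 2 * M" unfolding D_def using udiff[OF s0(5,4)] .
  have k0pos: "0 < k0"
  proof (rule ccontr)
    assume "\<not> 0 < k0"
    then have "k0 = 0" using k0 by simp
    then show False using Dg by (simp add: D_def y0_def)
  qed
  have C0: "C11 (u s0) (dx u s0) K" by (rule KC[OF s0(3,4)])
  have s0a1: "a1 < s0"
  proof (rule ccontr)
    assume "\<not> a1 < s0"
    then have "K < g s0" using s0 a1 b by auto
    then have "K * k0 < g s0 * k0" using k0pos by simp
    moreover have "D \<le> K * k0"
    proof -
      have "D \<le> \<bar>\<sigma>\<bar> * \<bar>u s0 \<xi>0 - u s0 y0\<bar>" unfolding D_def by (metis abs_ge_self abs_mult)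
      also have "\<dots> \<le> K * \<bar>\<xi>0 - y0\<bar>" 
        using DERIV_bound_imp_lipschitz[OF C11D(1)[OF C0] C11D(2)[OF C0], of \<xi>0 y0] \<sigma> by simp
      finally show ?thesis using k0 by (simp add: y0_def)
    qed
    ultimately show False using Dg by simp
  qed
  note us = u_DERIV[OF s0(5)]
  \<comment> \<open>The maximum may lie at the final time t, so it is compared with earlier times
    only; this still fixes the sign of the time derivative.\<close>
  have time: "0 \<le> \<sigma> * (dt u s0 \<xi>0 - dt u s0 y0) - g' s0 * k0 - \<epsilon> * lam"
  proof (rule ccontr)
    assume "\<not> ?thesis"
    then have n: "\<sigma> * (dt u s0 \<xi>0 - dt u s0 y0) - g' s0 * k0 - 0 - \<epsilon> * lam * 1 < 0" by simp
    have der: "((\<lambda>s. F s \<xi>0 k0) has_real_derivative \<sigma> * (dt u s0 \<xi>0 - dt u s0 y0) - g' s0 * k0 - 0 - \<epsilon> * lam * 1) (at s0)"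
      unfolding F_def y0_def
      by (intro DERIV_diff DERIV_cmult DERIV_cmult_right us(1) g s0 DERIV_const DERIV_ident)
    obtain d where d: "0 < d" "\<And>h. 0 < h \<Longrightarrow> h < d \<Longrightarrow> F s0 \<xi>0 k0 < F (s0 - h) \<xi>0 k0"
      using DERIV_neg_dec_left[OF der n] by blast
    define h where "h = min (d/2) (s0 - a1)"
    have "F s0 \<xi>0 k0 < F (s0 - h) \<xi>0 k0" using d(1) s0a1 by (intro d(2)) (auto simp: h_def min_def)
    moreover have "F (s0 - h) \<xi>0 k0 \<le> F s0 \<xi>0 k0"
      using d(1) s0a1 s0 k0 by (intro gmax) (auto simp: h_def min_def)
    ultimately show False by simp
  qed
  have space: "\<sigma> * (dx u s0 \<xi>0 - dx u s0 y0) = \<epsilon> * psi' \<xi>0"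
  proof -
    have "((\<lambda>\<xi>. F s0 \<xi> k0) has_real_derivative \<sigma> * (dx u s0 \<xi>0 - dx u s0 (\<xi>0 - k0) * (1 - 0)) - 0 - \<epsilon> * psi' \<xi>0 - 0) (at \<xi>0)"
      unfolding F_def
      by (intro DERIV_diff DERIV_cmult us(2) C11D(1)[OF C11_psi] DERIV_const DERIV_chain2[OF us(2)] DERIV_ident)
    then have "\<sigma> * (dx u s0 \<xi>0 - dx u s0 (\<xi>0 - k0) * (1 - 0)) - 0 - \<epsilon> * psi' \<xi>0 - 0 = 0"
      by (rule DERIV_local_max[of _ _ _ 1]) (use gmax s0 k0 in auto)
    then show ?thesis by (simp add: y0_def)
  qed
  have kder: "\<sigma> * dx u s0 y0 = g s0"
  proof -
    have "((\<lambda>k. F s0 \<xi>0 k) has_real_derivative \<sigma> * (0 - dx u s0 (\<xi>0 - k0) * (0 - 1)) - g s0 * 1 - 0 - 0) (at k0)"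
      unfolding F_def
      by (intro DERIV_diff DERIV_cmult us(2) DERIV_const DERIV_chain2[OF us(2)] DERIV_ident)
    then have "\<sigma> * (0 - dx u s0 (\<xi>0 - k0) * (0 - 1)) - g s0 * 1 - 0 - 0 = 0"
      by (rule DERIV_local_max[of _ _ _ k0]) (use gmax s0 k0pos in auto)
    then show ?thesis by (simp add: y0_def)
  qed
  \<comment> \<open>Shifting both points by z keeps their distance and hence the term with g.
    Maximality and the slope condition \<open>space\<close> then compare Taylor remainders, as
    \<open>nonlocal_gain\<close> requires.\<close>
  have trem_le: "\<sigma> * (trem (u s0) (dx u s0) \<xi>0 z - trem (u s0) (dx u s0) (\<xi>0 - k0) z) \<le> \<epsilon> * trem psi psi' \<xi>0 z" for z
  proof -
    have "F s0 (\<xi>0 + z) k0 \<le> F s0 \<xi>0 k0" using s0 k0 by (intro gmax) auto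
    moreover have "\<sigma> * dx u s0 \<xi>0 * z - \<sigma> * dx u s0 y0 * z = \<epsilon> * psi' \<xi>0 * z"
      using space by (metis (no_types, opaque_lifting) left_diff_distrib right_diff_distrib)
    ultimately show ?thesis unfolding F_def trem_def y0_def
      by (simp add: algebra_simps)
  qed
  obtain r where r: "0 < r" "CA * ((2 * M * k0 - 2 * r * D) / r powr (1 + \<alpha>)) - \<sigma> * g s0 * D \<le> g' s0 * k0"
    using barrier[OF s0(3,4) k0pos Dg D2M] by blast
  have gain: "\<sigma> * (Lop (u s0) (dx u s0) \<xi>0 - Lop (u s0) (dx u s0) y0) \<le> 
      (2 * M * k0 - 2 * r * D) / r powr (1 + \<alpha>) + \<epsilon> * (2 * kint)"
    unfolding D_def y0_def
    by (rule nonlocal_gain[OF C0 M(2)[OF s0(5,4)] r(1) _ k0 \<sigma> trem_le]) (use eps in auto)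
  have "\<sigma> * (dt u s0 \<xi>0 - dt u s0 y0) = CA * (\<sigma> * (Lop (u s0) (dx u s0) \<xi>0 - Lop (u s0) (dx u s0) y0))
      - (u s0 \<xi>0 * (\<sigma> * dx u s0 \<xi>0) - u s0 y0 * (\<sigma> * dx u s0 y0))"
    unfolding u_eq[OF s0(5)] by (simp add: algebra_simps)
  \<comment> \<open>As the slopes agree up to the penalty, transport reduces to g (u(\<xi>0) -
    u(y0)), which is \<sigma> g D by \<sigma>^2 = 1. For \<sigma> = 1 its sign is favourable; for
    \<sigma> = -1 the nonlocal gain has to dominate it.\<close>
  also have "u s0 \<xi>0 * (\<sigma> * dx u s0 \<xi>0) - u s0 y0 * (\<sigma> * dx u s0 y0) = \<sigma> * g s0 * D + \<epsilon> * (u s0 \<xi>0 * psi' \<xi>0)"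
  proof -
    have "\<sigma> * dx u s0 \<xi>0 = g s0 + \<epsilon> * psi' \<xi>0" using space kder by (simp add: algebra_simps)
    moreover have "\<sigma> * g s0 * D = g s0 * (u s0 \<xi>0 - u s0 y0)" 
      unfolding D_def using ss by (metis (no_types, opaque_lifting) mult.assoc mult.commute mult_1)
    ultimately show ?thesis unfolding kder by (simp add: algebra_simps)
  qed
  finally have eq: "\<sigma> * (dt u s0 \<xi>0 - dt u s0 y0) = CA * (\<sigma> * (Lop (u s0) (dx u s0) \<xi>0 - Lop (u s0) (dx u s0) y0))
      - (\<sigma> * g s0 * D + \<epsilon> * (u s0 \<xi>0 * psi' \<xi>0))" .
  have "CA * (\<sigma> * (Lop (u s0) (dx u s0) \<xi>0 - Lop (u s0) (dx u s0) y0)) \<le> 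
      CA * ((2 * M * k0 - 2 * r * D) / r powr (1 + \<alpha>)) + \<epsilon> * (2 * CA * kint)"
    using mult_left_mono[OF gain, of CA] CA_pos by (simp add: algebra_simps)
  moreover have "\<epsilon> * (u s0 \<xi>0 * psi' \<xi>0) \<ge> - (\<epsilon> * M)"
  proof -
    have "\<bar>u s0 \<xi>0 * psi' \<xi>0\<bar> \<le> M * 1"
      unfolding abs_mult using M(2)[OF s0(5,4), of \<xi>0] psi'_le[of \<xi>0] by (intro mult_mono) auto
    then have "\<epsilon> * - (u s0 \<xi>0 * psi' \<xi>0) \<le> \<epsilon> * M" using eps by (intro mult_left_mono) auto
    then show ?thesis by simp
  qed
  ultimately have "\<epsilon> * lam \<le> \<epsilon> * (2 * CA * kint) + \<epsilon> * M" using time eq r(2) by linarith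
  also have "\<dots> < \<epsilon> * lam" using eps by (simp add: lam_def distrib_left)
  finally show False by simp
qed

end

section \<open>Oleinik's inequality and the smoothing estimate\<close>

context frac_burgers
begin

text \<open>The gain of the maximum principle for the choice \<open>r = 2 M / G\<close>.\<close>

lemma barrier_gain:
  assumes M: "1 \<le> M" and G: "0 < G" and k: "0 < k" "G * k < D"
  shows "CA * ((2 * M * k - 2 * (2 * M / G) * D) / (2 * M / G) powr (1 + \<alpha>)) \<le> - (CA * (2 * M) powr (- \<alpha>) * G powr \<alpha> * D)"
proof -
  let ?r = "2 * M / G"
  have r: "0 < ?r" using M G by simp
  have D: "0 < D" using G k mult_pos_pos[of G k] by linarith
  \<comment> \<open>The radius is chosen for this identity: 2 M k = r G k \<le> r D, so half of the
    gain 2 r D survives.\<close>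
  have "2 * M * k = ?r * (G * k)" using G by simp
  also have "\<dots> \<le> ?r * D" using r k(2) by (intro mult_left_mono) auto
  finally have "2 * M * k - 2 * ?r * D \<le> ?r * D - 2 * (?r * D)" by (simp only: mult.assoc diff_right_mono)
  also have "\<dots> = - (?r * D)" by (simp only: mult_2) simp
  finally have "2 * M * k - 2 * ?r * D \<le> - (?r * D)" .
  then have "(2 * M * k - 2 * ?r * D) / ?r powr (1 + \<alpha>) \<le> - (?r * D) / ?r powr (1 + \<alpha>)"
    by (intro divide_right_mono) auto
  also have "\<dots> = - (D * ?r powr (- \<alpha>))"
  proof -
    have "- (q * D) / q powr (1 + \<alpha>) = - (D * q powr (- \<alpha>))" if "0 < q" for q
      using that by (simp add: powr_add powr_minus divide_simps)
    then show ?thesis using r .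
  qed
  also have "?r powr (- \<alpha>) = (2 * M) powr (- \<alpha>) * G powr \<alpha>"
    using M G by (simp add: powr_divide powr_minus divide_simps)
  finally have le: "(2 * M * k - 2 * ?r * D) / ?r powr (1 + \<alpha>) \<le> - (D * ((2 * M) powr (- \<alpha>) * G powr \<alpha>))" .
  have "CA * - (D * (p * q)) = - (CA * p * q * D)" for p q by simp
  then show ?thesis using mult_left_mono[OF le, of CA] CA_pos by (simp only: less_imp_le)
qed

text \<open>The barrier 1/(t - a) solves g' = -g^2, which is what transport demands for \<sigma> =
  1; the nonlocal term contributes only its sign. Starting at a > 0 provides the uniform Lipschitz
  bound that the maximum principle uses at its initial time.\<close>

lemma oleinik_shifted:
  assumes a: "0 < a" "a < t" and xy: "y \<le> x"
  shows "u t x - u t y \<le> (x - y) / (t - a)"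
proof -
  define T where "T = t + 1"
  obtain M where M: "1 \<le> M" "\<And>t x. 0 < t \<Longrightarrow> t < T \<Longrightarrow> \<bar>u t x\<bar> \<le> M" using u_bounded by blast
  have "1 * (u t x - u t y) \<le> 1 / (t - a) * (x - y)"
  proof (rule modulus_barrier[where g = "\<lambda>t. 1 / (t - a)" and g' = "\<lambda>t. - 1 / (t - a)\<^sup>2" and gm = "1 / (T - a)"])
    show "((\<lambda>t. 1 / (t - a)) has_real_derivative - 1 / (s - a)\<^sup>2) (at s)" if "a < s" for s
      using that by (auto intro!: derivative_eq_intros simp: power2_eq_square)
    show "filterlim (\<lambda>t. 1 / (t - a)) at_top (at_right a)" by real_asymp
    fix s k D :: real assume s: "a < s" "s < T" and k: "0 < k" "1 / (s - a) * k < D"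
    let ?G = "1 / (s - a)"
    have G: "0 < ?G" using s by simp
    have D: "0 < D" using k G mult_pos_pos[of ?G k] by linarith
    have "0 \<le> CA * (2 * M) powr (- \<alpha>) * ?G powr \<alpha> * D" using CA_pos D by simp
    then have "CA * ((2 * M * k - 2 * (2 * M / ?G) * D) / (2 * M / ?G) powr (1 + \<alpha>)) \<le> 0"
      using barrier_gain[OF M(1) G k] by linarith
    moreover have "?G * (?G * k) \<le> ?G * D" using k(2) G by (intro mult_left_mono) auto
    moreover have "- 1 / (s - a)\<^sup>2 * k = - (?G * (?G * k))" by (simp add: power2_eq_square)
    ultimately have "CA * ((2 * M * k - 2 * (2 * M / ?G) * D) / (2 * M / ?G) powr (1 + \<alpha>)) - 1 * ?G * D \<le> - 1 / (s - a)\<^sup>2 * k"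
      by linarith
    moreover have "0 < 2 * M / ?G" using M G by simp
    ultimately show "\<exists>r>0. CA * ((2 * M * k - 2 * r * D) / r powr (1 + \<alpha>)) - 1 * ?G * D \<le> - 1 / (s - a)\<^sup>2 * k"
      by blast
  qed (use a M xy in \<open>auto simp: T_def intro!: divide_left_mono\<close>)
  then show ?thesis by simp
qed

theorem oleinik:
  assumes t: "0 < t" and xy: "y \<le> x"
  shows "u t x - u t y \<le> (x - y) / t"
proof (rule tendsto_lowerbound)
  show "((\<lambda>a. (x - y) / (t - a)) \<longlongrightarrow> (x - y) / t) (at_right 0)" using t by (auto intro!: tendsto_eq_intros)
  show "\<forall>\<^sub>F a in at_right 0. u t x - u t y \<le> (x - y) / (t - a)"
    unfolding eventually_at_right_field using t oleinik_shifted xy by blast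
qed simp

text \<open>Here the nonlocal gain c0 G^\<alpha> D does the work, for either sign \<sigma>. One half
  pays for g', since G^\<alpha> = B^\<alpha> / (t - a); the other pays for the transport term G D,
  since \<alpha> > 1 and G is bounded below up to time T.\<close>

theorem smoothing:
  obtains B where "0 < B" 
    "\<And>t x y. 0 < t \<Longrightarrow> t < T \<Longrightarrow> \<bar>u t x - u t y\<bar> \<le> B * t powr (- 1 / \<alpha>) * \<bar>x - y\<bar>"
proof -
  obtain M where M: "1 \<le> M" "\<And>t x. 0 < t \<Longrightarrow> t < T \<Longrightarrow> \<bar>u t x\<bar> \<le> M" using u_bounded by blast
  define T' where "T' = max T 1"
  define c0 where "c0 = CA * (2 * M) powr (- \<alpha>)"
  have c0: "0 < c0" using CA_pos M by (simp add: c0_def)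
  \<comment> \<open>The first entry gives B^(-\<alpha>) \<le> c0/2, the second G^(\<alpha>-1) \<ge>
    2/c0 at all times before T; each serves one half of the gain.\<close>
  define B where "B = max ((2 / c0) powr (1 / \<alpha>)) (T' powr (1 / \<alpha>) * (2 / c0) powr (1 / (\<alpha> - 1)))"
  have Bp: "0 < B" using c0 by (simp add: B_def less_max_iff_disj)
  have B1: "B powr (- \<alpha>) \<le> c0 / 2"
  proof -
    have "2 / c0 = ((2 / c0) powr (1 / \<alpha>)) powr \<alpha>" using c0 alpha by (simp add: powr_powr)
    also have "\<dots> \<le> B powr \<alpha>" using alpha by (intro powr_mono2) (auto simp: B_def)
    finally show ?thesis using c0 Bp by (simp add: powr_minus field_simps)
  qed
  have key: "\<sigma> * (u t x - u t y) \<le> B * t powr (- 1 / \<alpha>) * (x - y)"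
    if sg: "\<bar>\<sigma>\<bar> = 1" and t: "0 < t" "t < T" and xy: "y \<le> x" for \<sigma> t x y
  proof (rule tendsto_lowerbound)
    show "((\<lambda>a. B * (t - a) powr (- 1 / \<alpha>) * (x - y)) \<longlongrightarrow> B * t powr (- 1 / \<alpha>) * (x - y)) (at_right 0)"
      using t by (auto intro!: tendsto_eq_intros)
    have "\<sigma> * (u t x - u t y) \<le> B * (t - a) powr (- 1 / \<alpha>) * (x - y)" if a: "0 < a" "a < t" for a
    proof (rule modulus_barrier[where T = T and g = "\<lambda>t. B * (t - a) powr (- 1 / \<alpha>)" 
          and g' = "\<lambda>t. B * ((- 1 / \<alpha>) * (t - a) powr (- 1 / \<alpha> - 1))" and gm = "B * T' powr (- 1 / \<alpha>)"])
      show "((\<lambda>t. B * (t - a) powr (- 1 / \<alpha>)) has_real_derivative B * ((- 1 / \<alpha>) * (s - a) powr (- 1 / \<alpha> - 1))) (at s)" 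
        if "a < s" for s using that alpha by (auto intro!: derivative_eq_intros)
      show "filterlim (\<lambda>t. B * (t - a) powr (- 1 / \<alpha>)) at_top (at_right a)"
        using Bp alpha by real_asymp
      show gl: "B * T' powr (- 1 / \<alpha>) \<le> B * (s - a) powr (- 1 / \<alpha>)" if "a < s" "s < T" for s
        using Bp that a alpha by (intro mult_left_mono powr_mono2') (auto simp: T'_def le_max_iff_disj)
      show "0 < B * T' powr (- 1 / \<alpha>)" using Bp by (auto simp: T'_def)
      fix s k D :: real assume s: "a < s" "s < T" and k: "0 < k" "B * (s - a) powr (- 1 / \<alpha>) * k < D"
      define G where "G = B * (s - a) powr (- 1 / \<alpha>)"
      have G: "0 < G" using s Bp by (simp add: G_def)
      have k: "0 < k" "G * k < D" using k by (auto simp: G_def)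
      have D: "0 < D" using k G mult_pos_pos[of G k] by linarith
      have "(2 / c0) powr (1 / (\<alpha> - 1)) = T' powr (1 / \<alpha>) * (2 / c0) powr (1 / (\<alpha> - 1)) * T' powr (- 1 / \<alpha>)"
        by (simp add: powr_minus T'_def)
      also have "\<dots> \<le> B * T' powr (- 1 / \<alpha>)" by (intro mult_right_mono) (auto simp: B_def)
      also have "\<dots> \<le> G" using gl[OF s] by (simp add: G_def)
      finally have "((2 / c0) powr (1 / (\<alpha> - 1))) powr (\<alpha> - 1) \<le> G powr (\<alpha> - 1)"
        using alpha by (intro powr_mono2) auto
      then have "2 / c0 \<le> G powr (\<alpha> - 1)" using alpha c0 by (simp add: powr_powr)
      then have "2 / c0 * G \<le> G powr (\<alpha> - 1) * G" using G by (intro mult_right_mono) auto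
      also have "\<dots> = G powr \<alpha>" using G by (simp add: powr_diff)
      finally have g1: "G \<le> c0 / 2 * G powr \<alpha>" using c0 by (simp add: field_simps)
      have inv: "1 / (s - a) = B powr (- \<alpha>) * G powr \<alpha>"
      proof -
        have "G powr \<alpha> = B powr \<alpha> * (s - a) powr (-1)"
          using Bp s alpha by (simp add: G_def powr_mult powr_powr)
        then show ?thesis using Bp s by (simp add: powr_minus divide_simps)
      qed
      have "(s - a) powr (- 1 / \<alpha> - 1) = (s - a) powr (- 1 / \<alpha>) / (s - a)"
        using s by (simp add: powr_diff)
      then have "B * ((- 1 / \<alpha>) * (s - a) powr (- 1 / \<alpha> - 1)) * k = - (1 / \<alpha>) * (1 / (s - a)) * (G * k)"
        by (simp add: G_def)
      moreover have "(1 / \<alpha>) * (1 / (s - a)) * (G * k) \<le> 1 * (1 / (s - a)) * D"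
        using alpha s G k D by (intro mult_mono) auto
      moreover have "1 * (1 / (s - a)) * D \<le> c0 / 2 * G powr \<alpha> * D"
        unfolding inv mult_1 using D by (intro mult_right_mono B1) auto
      ultimately have g2: "- (c0 / 2 * G powr \<alpha> * D) \<le> B * ((- 1 / \<alpha>) * (s - a) powr (- 1 / \<alpha> - 1)) * k"
        by linarith
      have "- \<sigma> * (G * D) \<le> \<bar>\<sigma>\<bar> * (G * D)" using G D by (intro mult_right_mono) auto
      also have "\<dots> \<le> c0 / 2 * G powr \<alpha> * D" using g1 D sg by (simp add: mult_right_mono)
      finally have g3: "- \<sigma> * G * D \<le> c0 / 2 * G powr \<alpha> * D" by simp
      have "CA * ((2 * M * k - 2 * (2 * M / G) * D) / (2 * M / G) powr (1 + \<alpha>)) \<le> - (c0 * G powr \<alpha> * D)"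
        using barrier_gain[OF M(1) G k] by (simp add: c0_def)
      then have "CA * ((2 * M * k - 2 * (2 * M / G) * D) / (2 * M / G) powr (1 + \<alpha>)) - \<sigma> * G * D \<le> 
          B * ((- 1 / \<alpha>) * (s - a) powr (- 1 / \<alpha> - 1)) * k"
        using g2 g3 by linarith
      moreover have "0 < 2 * M / G" using M G by simp
      ultimately show "\<exists>r>0. CA * ((2 * M * k - 2 * r * D) / r powr (1 + \<alpha>)) - \<sigma> * (B * (s - a) powr (- 1 / \<alpha>)) * D \<le> 
          B * ((- 1 / \<alpha>) * (s - a) powr (- 1 / \<alpha> - 1)) * k"
        unfolding G_def by blast
    qed (use a t M xy sg in auto)
    then show "\<forall>\<^sub>F a in at_right 0. \<sigma> * (u t x - u t y) \<le> B * (t - a) powr (- 1 / \<alpha>) * (x - y)"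
      unfolding eventually_at_right_field using t by blast
  qed simp
  show thesis
  proof (rule that[OF Bp])
    fix t x y :: real assume t: "0 < t" "t < T"
    have *: "\<bar>u t x - u t y\<bar> \<le> B * t powr (- 1 / \<alpha>) * \<bar>x - y\<bar>" if "y \<le> x" for x y
      using key[of 1, OF _ t that] key[of "-1", OF _ t that] that by auto
    show "\<bar>u t x - u t y\<bar> \<le> B * t powr (- 1 / \<alpha>) * \<bar>x - y\<bar>"
      using *[of x y] *[of y x] by (cases "y \<le> x") (auto simp: abs_minus_commute)
  qed
qed

end

subsection \<open>Kato's inequality\<close>

text \<open>The weight localizes the \<open>L\<^sup>1\<close> estimate. Its algebraic decay makes \<open>\<bar>wt'\<bar> \<le> wt / R\<close>, which absorbs the flux,
  while its fractional Laplacian has \<open>L\<^sup>1\<close> norm \<open>O(R\<^bsup>1 - \<alpha>\<^esup>)\<close>, which vanishes as \<open>R \<rightarrow> \<infinity>\<close>.\<close>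

definition wt :: "real \<Rightarrow> real \<Rightarrow> real" where "wt R x = R\<^sup>2 / (R\<^sup>2 + x\<^sup>2)"
definition wt' :: "real \<Rightarrow> real \<Rightarrow> real" where "wt' R x = - 2 * x * R\<^sup>2 / (R\<^sup>2 + x\<^sup>2)\<^sup>2"
definition wt'' :: "real \<Rightarrow> real \<Rightarrow> real" where "wt'' R x = R\<^sup>2 * (6 * x\<^sup>2 - 2 * R\<^sup>2) / (R\<^sup>2 + x\<^sup>2) ^ 3"

context
  fixes R :: real assumes R: "0 < R"
begin

lemma wt_den: "0 < R\<^sup>2 + x\<^sup>2"
  using R by (simp add: add_pos_nonneg)

lemma wt_pos: "0 < wt R x"
  unfolding wt_def using R by (intro divide_pos_pos wt_den zero_less_power)

lemma wt_le_1: "wt R x \<le> 1"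
  unfolding wt_def by (rule divide_le_eq_1_pos[THEN iffD2, OF wt_den]) simp

lemma wt_DERIV: "(wt R has_real_derivative wt' R x) (at x)" "(wt' R has_real_derivative wt'' R x) (at x)"
proof -
  have n: "R\<^sup>2 + x\<^sup>2 \<noteq> 0" using wt_den[of x] by linarith
  show "(wt R has_real_derivative wt' R x) (at x)"
    unfolding wt_def wt'_def using n
    by (auto intro!: derivative_eq_intros simp: power2_eq_square)
  define q where "q = R\<^sup>2 + x\<^sup>2"
  have q: "q \<noteq> 0" "x\<^sup>2 = q - R\<^sup>2" using n by (auto simp: q_def)
  have "(wt' R has_real_derivative (- 2 * R\<^sup>2 * (R\<^sup>2 + x\<^sup>2)\<^sup>2 - (- 2 * x * R\<^sup>2) * (2 * (R\<^sup>2 + x\<^sup>2) * (2 * x))) / ((R\<^sup>2 + x\<^sup>2)\<^sup>2 * (R\<^sup>2 + x\<^sup>2)\<^sup>2)) (at x)"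
    unfolding wt'_def
  proof (rule DERIV_divide)
    show "((\<lambda>x. - 2 * x * R\<^sup>2) has_real_derivative - 2 * R\<^sup>2) (at x)"
      by (auto intro!: derivative_eq_intros)
    show "((\<lambda>x. (R\<^sup>2 + x\<^sup>2)\<^sup>2) has_real_derivative 2 * (R\<^sup>2 + x\<^sup>2) * (2 * x)) (at x)"
      by (auto intro!: derivative_eq_intros)
    show "(R\<^sup>2 + x\<^sup>2)\<^sup>2 \<noteq> 0" using n by (rule power_not_zero)
  qed
  moreover have "(- 2 * R\<^sup>2 * q\<^sup>2 - (- 2 * x * R\<^sup>2) * (2 * q * (2 * x))) / (q\<^sup>2 * q\<^sup>2) = R\<^sup>2 * (6 * x\<^sup>2 - 2 * R\<^sup>2) / q ^ 3"
  proof -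
    have "- 2 * R\<^sup>2 * q\<^sup>2 - (- 2 * x * R\<^sup>2) * (2 * q * (2 * x)) = q * (R\<^sup>2 * (8 * x\<^sup>2 - 2 * q))"
      by (simp add: power2_eq_square algebra_simps)
    also have "8 * x\<^sup>2 - 2 * q = 6 * x\<^sup>2 - 2 * R\<^sup>2" by (simp add: q_def)
    finally show ?thesis using q(1) by (simp add: power2_eq_square power3_eq_cube)
  qed
  ultimately show "(wt' R has_real_derivative wt'' R x) (at x)" by (simp add: wt''_def q_def)
qed

lemma wt''_isCont: "isCont (wt'' R) x"
  unfolding wt''_def using wt_den[of x] by (intro continuous_intros) auto

lemma wt'_isCont: "isCont (wt' R) x" using wt_DERIV(2) by (rule DERIV_isCont)
lemma wt_isCont: "isCont (wt R) x" using wt_DERIV(1) by (rule DERIV_isCont)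

lemma wt_measurable [measurable]: "wt R \<in> borel_measurable borel" "wt' R \<in> borel_measurable borel" "wt'' R \<in> borel_measurable borel"
  by (auto intro!: borel_measurable_isCont wt_isCont wt'_isCont wt''_isCont)

text \<open>From 2 |x| R \<le> R^2 + x^2. A weight that controls its own derivative is what closes
  the Gronwall argument for the flux.\<close>

lemma wt'_le: "\<bar>wt' R x\<bar> \<le> wt R x / R"
proof -
  have "2 * \<bar>x\<bar> * R \<le> R\<^sup>2 + x\<^sup>2"
    using zero_le_power2[of "\<bar>x\<bar> - R"] by (simp add: power2_diff)
  then have "2 * \<bar>x\<bar> * R * (R\<^sup>2 / (R * (R\<^sup>2 + x\<^sup>2)\<^sup>2)) \<le> (R\<^sup>2 + x\<^sup>2) * (R\<^sup>2 / (R * (R\<^sup>2 + x\<^sup>2)\<^sup>2))"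
    using R by (intro mult_right_mono) auto
  moreover have "2 * \<bar>x\<bar> * R * (R\<^sup>2 / (R * (R\<^sup>2 + x\<^sup>2)\<^sup>2)) = \<bar>wt' R x\<bar>"
    using R wt_den[of x] by (simp add: wt'_def abs_mult abs_divide)
  moreover have "(R\<^sup>2 + x\<^sup>2) * (R\<^sup>2 / (R * (R\<^sup>2 + x\<^sup>2)\<^sup>2)) = wt R x / R"
    using R wt_den[of x] by (simp add: wt_def power2_eq_square)
  ultimately show ?thesis by simp
qed

lemma wt''_le: "\<bar>wt'' R x\<bar> \<le> 6 / R\<^sup>2 * wt R x"
proof -
  define q where "q = R\<^sup>2 + x\<^sup>2"
  have q: "0 < q" "R\<^sup>2 \<le> q" using wt_den[of x] by (auto simp: q_def)
  have "\<bar>6 * x\<^sup>2 - 2 * R\<^sup>2\<bar> \<le> 6 * q" unfolding q_def by (auto simp: abs_le_iff)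
  then have "\<bar>wt'' R x\<bar> \<le> R\<^sup>2 * (6 * q) / q ^ 3"
    using q R unfolding wt''_def q_def[symmetric] by (simp add: abs_mult abs_divide divide_right_mono)
  also have "\<dots> = 6 * (R\<^sup>2 / q) * (1 / q)" using q by (simp add: power3_eq_cube field_simps)
  also have "\<dots> \<le> 6 * (R\<^sup>2 / q) * (1 / R\<^sup>2)"
    using q R by (intro mult_left_mono divide_left_mono) auto
  also have "\<dots> = 6 / R\<^sup>2 * wt R x" by (simp add: wt_def q_def)
  finally show ?thesis .
qed

lemma wt_integrable: "integrable lborel (wt R)" and wt_integral: "(LINT x|lborel. wt R x) \<le> pi * R"
proof -
  have D: "((\<lambda>x. R * arctan (x / R)) has_real_derivative wt R x) (at x)" for x
  proof -
    have "1 + (x / R)\<^sup>2 = (R\<^sup>2 + x\<^sup>2) / R\<^sup>2" using R by (simp add: power_divide add_divide_distrib)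
    then have "R * (inverse (1 + (x / R)\<^sup>2) * (1 / R)) = wt R x"
      using R by (simp add: wt_def)
    moreover have "((\<lambda>x. R * arctan (x / R)) has_real_derivative R * (inverse (1 + (x / R)\<^sup>2) * (1 / R))) (at x)"
      using R by (auto intro!: derivative_eq_intros)
    ultimately show ?thesis by simp
  qed
  have b: "- (R * (pi/2)) \<le> R * arctan (x / R)" "R * arctan (x / R) \<le> R * (pi/2)" for x
    using arctan_bounded[of "x/R"] R mult_left_mono[of "-(pi/2)" "arctan (x/R)" R] mult_left_mono[of "arctan (x/R)" "pi/2" R] 
    by auto
  note * = integrable_deriv_of_bounded_mono[OF D wt_isCont less_imp_le[OF wt_pos] b]
  show "integrable lborel (wt R)" by (rule *(1))
  show "(LINT x|lborel. wt R x) \<le> pi * R" using *(2) by (simp add: algebra_simps)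
qed

lemma nn_wt: "(\<integral>\<^sup>+x. ennreal (wt R x) \<partial>lborel) \<le> ennreal (pi * R)"
  using nn_integral_eq_integral[OF wt_integrable] wt_pos wt_integral
  by (simp add: less_imp_le ennreal_leI)

text \<open>The proof gives \<open>pi\<close>; the larger constant matches the second derivative,
  because the scaling estimate takes one A with masses A and A / R.\<close>

lemma wt'_L1: "L1norm (wt' R) \<le> ennreal (6 * pi)"
proof -
  have "L1norm (wt' R) \<le> (\<integral>\<^sup>+x. ennreal (1 / R) * ennreal (wt R x) \<partial>lborel)"
    using wt'_le R wt_pos by (intro nn_integral_mono) (simp add: ennreal_mult[symmetric] less_imp_le ennreal_leI)
  also have "\<dots> = ennreal (1 / R) * (\<integral>\<^sup>+x. ennreal (wt R x) \<partial>lborel)" by (rule nn_integral_cmult) simp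
  also have "\<dots> \<le> ennreal (1 / R) * ennreal (pi * R)" by (intro mult_left_mono nn_wt) auto
  also have "\<dots> = ennreal pi" using R by (simp add: ennreal_mult[symmetric])
  also have "\<dots> \<le> ennreal (6 * pi)" by (intro ennreal_leI) simp
  finally show ?thesis .
qed

lemma wt''_L1: "L1norm (wt'' R) \<le> ennreal (6 * pi / R)"
proof -
  have "L1norm (wt'' R) \<le> (\<integral>\<^sup>+x. ennreal (6 / R\<^sup>2) * ennreal (wt R x) \<partial>lborel)"
    using wt''_le R wt_pos by (intro nn_integral_mono) (simp add: ennreal_mult[symmetric] less_imp_le ennreal_leI)
  also have "\<dots> = ennreal (6 / R\<^sup>2) * (\<integral>\<^sup>+x. ennreal (wt R x) \<partial>lborel)" by (rule nn_integral_cmult) simp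
  also have "\<dots> \<le> ennreal (6 / R\<^sup>2) * ennreal (pi * R)" by (intro mult_left_mono nn_wt) auto
  also have "\<dots> = ennreal (6 * pi / R)" using R by (simp add: ennreal_mult[symmetric] power2_eq_square)
  finally show ?thesis .
qed

lemma C11_wt: "C11 (wt R) (wt' R) (1 / R + 6 / R\<^sup>2)"
proof (rule C11I[OF wt_DERIV])
  fix x
  have "wt R x / R \<le> 1 / R" using wt_le_1[of x] R by (intro divide_right_mono) auto
  then show "\<bar>wt' R x\<bar> \<le> 1 / R + 6 / R\<^sup>2" using wt'_le[of x] R by (smt (verit) divide_pos_pos zero_less_power)
  have "6 / R\<^sup>2 * wt R x \<le> 6 / R\<^sup>2 * 1" using wt_le_1[of x] R by (intro mult_left_mono) auto
  then show "\<bar>wt'' R x\<bar> \<le> 1 / R + 6 / R\<^sup>2" using wt''_le[of x] R by (smt (verit) divide_pos_pos)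
qed

lemma wt_tendsto: "(wt R \<longlongrightarrow> 0) at_top" "(wt R \<longlongrightarrow> 0) at_bot"
  unfolding wt_def using R by real_asymp+

lemma integrable_wt_mult:
  assumes [measurable]: "f \<in> borel_measurable borel" and b: "\<And>x. \<bar>f x\<bar> \<le> M"
  shows "integrable lborel (\<lambda>x. wt R x * f x)" "integrable lborel (\<lambda>x. wt' R x * f x)"
proof -
  have M: "0 \<le> M" using b[of 0] abs_ge_zero order_trans by blast
  have i: "integrable lborel (\<lambda>x. wt R x * M)" using wt_integrable by simp
  show "integrable lborel (\<lambda>x. wt R x * f x)"
    by (rule Bochner_Integration.integrable_bound[OF i]) 
      (use wt_pos b M in \<open>auto simp: abs_mult less_imp_le intro!: mult_left_mono AE_I2\<close>)
  have i: "integrable lborel (\<lambda>x. (wt R x / R) * M)" using wt_integrable by simp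
  show "integrable lborel (\<lambda>x. wt' R x * f x)"
  proof (rule Bochner_Integration.integrable_bound[OF i])
    show "AE x in lborel. norm (wt' R x * f x) \<le> norm (wt R x / R * M)"
    proof (intro AE_I2)
      fix x
      have "\<bar>wt' R x\<bar> * \<bar>f x\<bar> \<le> (wt R x / R) * M"
        using wt'_le[of x] b[of x] wt_pos[of x] R by (intro mult_mono) (auto simp: less_imp_le)
      then show "norm (wt' R x * f x) \<le> norm (wt R x / R * M)"
        unfolding real_norm_def abs_mult[of "wt' R x"] using abs_ge_self order_trans by blast
    qed
  qed measurable
qed

text \<open>The function is merely bounded; the boundary terms vanish because the weight tends to
  0.\<close>

lemma wt_integral_by_parts:
  assumes D: "\<And>x. (f has_real_derivative f' x) (at x)" and c: "\<And>x. isCont f' x"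
    and b: "\<And>x. \<bar>f x\<bar> \<le> M" "\<And>x. \<bar>f' x\<bar> \<le> M'"
  shows "(LINT x|lborel. wt R x * f' x) = - (LINT x|lborel. wt' R x * f x)"
proof -
  have cf: "isCont f x" for x using D by (rule DERIV_isCont)
  have [measurable]: "f \<in> borel_measurable borel" "f' \<in> borel_measurable borel"
    using c cf by (auto intro: borel_measurable_isCont)
  note i = integrable_wt_mult(1)[of f' M'] integrable_wt_mult(2)[of f M]
  have "(LINT x|lborel. wt' R x * f x + wt R x * f' x) = 0"
  proof (rule integral_deriv_eq_0[where f="\<lambda>x. wt R x * f x"])
    show "((\<lambda>x. wt R x * f x) has_real_derivative wt' R x * f x + wt R x * f' x) (at x)" for x
      using DERIV_mult[OF wt_DERIV(1) D, of x] by (simp add: mult.commute)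
    show "isCont (\<lambda>x. wt' R x * f x + wt R x * f' x) x" for x
      by (intro continuous_intros wt'_isCont wt_isCont c cf)
    show "integrable lborel (\<lambda>x. wt' R x * f x + wt R x * f' x)"
      using i b by (intro Bochner_Integration.integrable_add) auto
    have "((\<lambda>x. wt R x * f x) \<longlongrightarrow> 0) G" if "(wt R \<longlongrightarrow> 0) G" for G
    proof (rule Lim_null_comparison)
      show "\<forall>\<^sub>F x in G. norm (wt R x * f x) \<le> wt R x * M"
        using b(1) wt_pos by (intro always_eventually allI) (auto simp: abs_mult less_imp_le intro!: mult_left_mono)
      show "((\<lambda>x. wt R x * M) \<longlongrightarrow> 0) G" using tendsto_mult_left_zero[OF that] .
    qed
    then show "((\<lambda>x. wt R x * f x) \<longlongrightarrow> 0) at_top" "((\<lambda>x. wt R x * f x) \<longlongrightarrow> 0) at_bot"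
      using wt_tendsto by blast+
  qed
  moreover have "(LINT x|lborel. wt' R x * f x + wt R x * f' x) = (LINT x|lborel. wt' R x * f x) + (LINT x|lborel. wt R x * f' x)"
    using i b by (intro Bochner_Integration.integral_add) auto
  ultimately show ?thesis by simp
qed

end

text \<open>A smooth convex substitute for the absolute value, up to an error \<open>d\<close>.\<close>

definition eta :: "real \<Rightarrow> real \<Rightarrow> real" where "eta d v = d * psi (v / d)"
definition eta' :: "real \<Rightarrow> real \<Rightarrow> real" where "eta' d v = psi' (v / d)"

context
  fixes d :: real assumes d: "0 < d"
begin

lemma eta_DERIV: "(eta d has_real_derivative eta' d v) (at v)"
proof -
  have "((\<lambda>v. d * psi (v / d)) has_real_derivative d * (psi' (v / d) * (1 / d))) (at v)"
    by (intro DERIV_cmult DERIV_chain2[OF C11D(1)[OF C11_psi]] DERIV_cdivide DERIV_ident)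
  then show ?thesis using d by (simp add: eta_def[abs_def] eta'_def)
qed

lemma eta'_le: "\<bar>eta' d v\<bar> \<le> 1"
  unfolding eta'_def by (rule psi'_le)

lemma eta_eq: "eta d v = sqrt (d\<^sup>2 + v\<^sup>2)"
proof -
  have "eta d v = sqrt (d\<^sup>2) * sqrt (1 + (v / d)\<^sup>2)" using d by (simp add: eta_def psi_def)
  also have "\<dots> = sqrt (d\<^sup>2 + v\<^sup>2)" using d by (subst real_sqrt_mult[symmetric]) (simp add: power_divide distrib_left)
  finally show ?thesis .
qed

lemma eta_ge: "\<bar>v\<bar> \<le> eta d v" and eta_le: "eta d v \<le> \<bar>v\<bar> + d"
  using sqrt_sum_squares_le_sum_abs[of d v] d by (auto simp: eta_eq intro!: real_le_rsqrt)

lemma eta_convex: "eta d v + eta' d v * (w - v) \<le> eta d w"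
proof -
  have "v / d + (w - v) / d = w / d" using d by (simp add: field_simps)
  then have "psi (v / d) + psi' (v / d) * ((w - v) / d) \<le> psi (w / d)"
    using trem_psi_nonneg[of "v / d" "(w - v) / d"] by (simp add: trem_def)
  then have "d * (psi (v / d) + psi' (v / d) * ((w - v) / d)) \<le> d * psi (w / d)"
    using d by (intro mult_left_mono) auto
  moreover have "d * (p + q * (c / d)) = d * p + q * c" for p q c using d by (simp add: distrib_left)
  ultimately show ?thesis by (simp add: eta_def eta'_def)
qed

text \<open>For |v| itself the difference is 0 by homogeneity; for sqrt(d^2 + v^2) it equals -d^2 /
  sqrt(d^2 + v^2). It measures how far \<open>eta\<close> of a solution is from satisfying the same
  conservative transport equation.\<close>

lemma eta_defect: "\<bar>v * eta' d v - eta d v\<bar> \<le> d"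
proof -
  define s where "s = sqrt (d\<^sup>2 + v\<^sup>2)"
  have sd: "d \<le> s" unfolding s_def using d by (intro real_le_rsqrt) auto
  have ss: "s * s = d\<^sup>2 + v\<^sup>2" by (simp add: s_def)
  have s1: "sqrt (1 + (v / d)\<^sup>2) = s / d"
    using eta_eq[of v] d by (simp add: eta_def psi_def s_def field_simps)
  have "eta' d v = v / s" unfolding eta'_def psi'_def s1 using d by simp
  then have "v * eta' d v = v\<^sup>2 / s" by (simp add: power2_eq_square)
  then have "v * eta' d v - eta d v = (v\<^sup>2 - s * s) / s" using sd d by (simp add: eta_eq s_def[symmetric] diff_divide_distrib)
  also have "\<dots> = - (d\<^sup>2 / s)" by (simp add: ss)
  finally have "\<bar>v * eta' d v - eta d v\<bar> = d * (d / s)" using sd d by (simp add: power2_eq_square)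
  also have "\<dots> \<le> d * 1" using sd d by (intro mult_left_mono) auto
  finally show ?thesis by simp
qed

lemma C11_eta_comp:
  assumes V: "C11 V V' K"
  shows "C11 (\<lambda>x. eta d (V x)) (\<lambda>x. eta' d (V x) * V' x) (K + K * K / d)"
  unfolding C11_def
proof (intro conjI allI)
  fix x y
  have K: "0 \<le> K" by (rule C11D(4)[OF V])
  have Kd: "0 \<le> K * K / d" using K d by simp
  show "((\<lambda>x. eta d (V x)) has_real_derivative eta' d (V x) * V' x) (at x)"
    by (rule DERIV_chain2[OF eta_DERIV C11D(1)[OF V]])
  have "\<bar>eta' d (V x) * V' x\<bar> \<le> 1 * K"
    unfolding abs_mult by (intro mult_mono eta'_le C11D(2)[OF V]) auto
  then show "\<bar>eta' d (V x) * V' x\<bar> \<le> K + K * K / d" using Kd by simp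
  have VL: "\<bar>V x - V y\<bar> \<le> K * \<bar>x - y\<bar>" using DERIV_bound_imp_lipschitz C11D(1,2)[OF V] by blast
  have "\<bar>eta' d (V x) - eta' d (V y)\<bar> \<le> 1 * \<bar>V x / d - V y / d\<bar>"
    unfolding eta'_def by (rule C11D(3)[OF C11_psi])
  also have "\<dots> = \<bar>V x - V y\<bar> / d" using d by (simp add: diff_divide_distrib[symmetric])
  also have "\<dots> \<le> K * \<bar>x - y\<bar> / d" using VL d by (intro divide_right_mono) auto
  finally have e: "\<bar>eta' d (V x) - eta' d (V y)\<bar> \<le> K * \<bar>x - y\<bar> / d" .
  have "\<bar>eta' d (V x) * V' x - eta' d (V y) * V' y\<bar> = \<bar>eta' d (V x) * (V' x - V' y) + (eta' d (V x) - eta' d (V y)) * V' y\<bar>"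
    by (simp add: algebra_simps)
  also have "\<dots> \<le> 1 * (K * \<bar>x - y\<bar>) + (K * \<bar>x - y\<bar> / d) * K"
    by (rule order_trans[OF abs_triangle_ineq], unfold abs_mult, 
        intro add_mono mult_mono eta'_le e C11D(2)[OF V] C11D(3)[OF V]) (use K d in auto)
  also have "\<dots> = (K + K * K / d) * \<bar>x - y\<bar>" by (simp add: algebra_simps)
  finally show "\<bar>eta' d (V x) * V' x - eta' d (V y) * V' y\<bar> \<le> (K + K * K / d) * \<bar>x - y\<bar>" .
qed

text \<open>Convexity of \<open>eta\<close>, read as an inequality between integrands. Integrated
  against the kernel it is the Cordoba-Cordoba inequality.\<close>

lemma trem_eta_comp: "eta' d (V x) * trem V V' x z \<le> trem (\<lambda>x. eta d (V x)) (\<lambda>x. eta' d (V x) * V' x) x z"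
  using eta_convex[of "V x" "V (x + z)"] by (simp add: trem_def algebra_simps)

lemma eta'_isCont: "isCont (eta' d) v"
  unfolding eta'_def using d by (intro isCont_o2[of v "\<lambda>v. v / d" psi'] C11_continuous(2)[OF C11_psi]) auto

lemma eta_isCont: "isCont (eta d) v"
  using eta_DERIV by (rule DERIV_isCont)

lemma eta_measurable [measurable]: "eta d \<in> borel_measurable borel" "eta' d \<in> borel_measurable borel"
  by (auto intro!: borel_measurable_isCont eta'_isCont eta_isCont)

end

section \<open>Duality with the weight and Kato's inequality at a fixed time\<close>

context frac_order
begin

text \<open>\<open>g\<close> is only bounded, so all decay comes from the weight. For fixed z a
  translation in x moves the increment onto \<open>wt\<close> and turns z into -z, integration by
  parts treats the linear term, and the kernel is even. Two absolute integrability facts, one for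
  each side, justify Fubini.\<close>

lemma wt_Lop_adjoint:
  assumes R: "0 < R" and g: "C11 g g' K" and M: "\<And>x. \<bar>g x\<bar> \<le> M"
  shows "integrable lborel (\<lambda>x. wt R x * Lop g g' x)"
    "(LINT x|lborel. wt R x * Lop g g' x) = (LINT x|lborel. g x * Lop (wt R) (wt' R) x)"
proof -
  let ?p = "\<lambda>z::real. \<bar>z\<bar> powr (1 + \<alpha>)"
  note [measurable] = C11_measurable[OF g] wt_measurable[OF R]
  have K: "0 \<le> K" by (rule C11D(4)[OF g])
  have M0: "0 \<le> M" using M[of 0] abs_ge_zero order_trans by blast
  note wpos = less_imp_le[OF wt_pos[OF R]]
  show "integrable lborel (\<lambda>x. wt R x * Lop g g' x)"
    by (rule integrable_wt_mult[OF R _ Lop_bound[OF g]]) measurable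
  have i1: "integrable (lborel \<Otimes>\<^sub>M lborel) (\<lambda>(x,z). wt R x * (trem g g' x z / ?p z))"
  proof (rule Bochner_Integration.integrable_bound)
    show "integrable (lborel \<Otimes>\<^sub>M lborel) (\<lambda>(x,z). wt R x * (2 * K * kap z))"
    proof (rule lborel_pair.Fubini_integrable)
      have "(\<lambda>x. LINT z|lborel. norm (case (x, z) of (x, z) \<Rightarrow> wt R x * (2 * K * kap z))) = (\<lambda>x. wt R x * (2 * K * kint))"
        using wpos K kap_nonneg by (auto simp: abs_mult kint_def)
      then show "integrable lborel (\<lambda>x. LINT z|lborel. norm (case (x, z) of (x, z) \<Rightarrow> wt R x * (2 * K * kap z)))"
        using wt_integrable[OF R] by simp
      show "AE x in lborel. integrable lborel (\<lambda>z. case (x, z) of (x, z) \<Rightarrow> wt R x * (2 * K * kap z))"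
        using integrable_kap by auto
    qed measurable
    show "AE w in lborel \<Otimes>\<^sub>M lborel. norm (case w of (x,z) \<Rightarrow> wt R x * (trem g g' x z / ?p z)) \<le> 
        norm (case w of (x,z) \<Rightarrow> wt R x * (2 * K * kap z))"
    proof (intro AE_I2)
      fix w :: "real \<times> real"
      obtain x z where w: "w = (x,z)" by (cases w)
      show "norm (case w of (x,z) \<Rightarrow> wt R x * (trem g g' x z / ?p z)) \<le> 
        norm (case w of (x,z) \<Rightarrow> wt R x * (2 * K * kap z))"
        using mult_left_mono[OF trem_kap[OF g, of x z] wpos[of x]] wpos[of x] K kap_nonneg[of z] by (simp add: w abs_mult)
    qed
  qed measurable
  have gen: "ennreal (norm (g x * S)) \<le> ennreal M * ennreal \<bar>S\<bar>" for x S
    using M[of x] M0 by (simp add: abs_mult ennreal_mult[symmetric] ennreal_leI mult_right_mono)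
  have i2: "integrable (lborel \<Otimes>\<^sub>M lborel) (\<lambda>(x,z). g x * (trem (wt R) (wt' R) x z / ?p z))"
  proof (rule integrableI_bounded)
    have "(\<integral>\<^sup>+w. ennreal (norm (case w of (x,z) \<Rightarrow> g x * (trem (wt R) (wt' R) x z / ?p z))) \<partial>(lborel \<Otimes>\<^sub>M lborel)) =
      (\<integral>\<^sup>+z. (\<integral>\<^sup>+x. ennreal (norm (g x * (trem (wt R) (wt' R) x z / ?p z))) \<partial>lborel) \<partial>lborel)"
      by (subst lborel_pair.nn_integral_snd[symmetric]) (simp_all add: case_prod_beta')
    also have "\<dots> \<le> (\<integral>\<^sup>+z. (\<integral>\<^sup>+x. ennreal M * ennreal \<bar>trem (wt R) (wt' R) x z / ?p z\<bar> \<partial>lborel) \<partial>lborel)"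
      by (intro nn_integral_mono gen)
    also have "\<dots> = ennreal M * (\<integral>\<^sup>+z. L1norm (\<lambda>x. trem (wt R) (wt' R) x z / ?p z) \<partial>lborel)"
      by (simp add: nn_integral_cmult)
    also have "\<dots> \<le> ennreal M * ennreal (2 * (6 * pi) * (R powr (1 - \<alpha>) * kint))"
      by (intro mult_left_mono L1_L1_trem[OF wt_DERIV[OF R] wt''_isCont[OF R] R _ wt'_L1[OF R] wt''_L1[OF R]]) auto
    also have "\<dots> < \<infinity>" by (simp add: ennreal_mult_less_top)
    finally show "(\<integral>\<^sup>+w. ennreal (norm (case w of (x,z) \<Rightarrow> g x * (trem (wt R) (wt' R) x z / ?p z))) \<partial>(lborel \<Otimes>\<^sub>M lborel)) < \<infinity>" .
  qed measurable
  have key: "(LINT x|lborel. wt R x * trem g g' x z) = (LINT x|lborel. g x * trem (wt R) (wt' R) x (- z))" for z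
  proof -
    note iw = integrable_wt_mult[OF R]
    have e1: "(LINT x|lborel. wt R x * g (x + z)) = (LINT x|lborel. wt R (x - z) * g x)"
      using integral_shift[of "\<lambda>x. wt R (x - z) * g x" z] by simp
    have i1: "integrable lborel (\<lambda>x. wt R x * g (x + z))" by (rule iw[of _ M]) (use M in auto)
    then have i1': "integrable lborel (\<lambda>x. wt R (x - z) * g x)"
      using integrable_shift[of "\<lambda>x. wt R x * g (x + z)" "-z"] by simp
    have i2: "integrable lborel (\<lambda>x. wt R x * g x)" "integrable lborel (\<lambda>x. wt' R x * g x)" by (rule iw[of _ M]; use M in auto)+
    have i3: "integrable lborel (\<lambda>x. wt R x * g' x)" by (rule iw[of _ K]) (use C11D(2)[OF g] in auto)
    have e2: "(LINT x|lborel. wt R x * g' x) = - (LINT x|lborel. wt' R x * g x)"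
      by (rule wt_integral_by_parts[OF R C11D(1)[OF g] C11_continuous(2)[OF g] M C11D(2)[OF g]])
    have "(LINT x|lborel. wt R x * trem g g' x z) = (LINT x|lborel. wt R x * g (x + z) - wt R x * g x - z * (wt R x * g' x))"
      by (simp add: trem_def algebra_simps)
    also have "\<dots> = (LINT x|lborel. wt R x * g (x + z)) - (LINT x|lborel. wt R x * g x) - z * (LINT x|lborel. wt R x * g' x)"
      using i1 i2 i3 by simp
    also have "\<dots> = (LINT x|lborel. wt R (x - z) * g x) - (LINT x|lborel. wt R x * g x) + z * (LINT x|lborel. wt' R x * g x)"
      unfolding e1 e2 by simp
    also have "\<dots> = (LINT x|lborel. wt R (x - z) * g x - wt R x * g x + z * (wt' R x * g x))"
      using i1' i2 by simp
    also have "\<dots> = (LINT x|lborel. g x * trem (wt R) (wt' R) x (- z))"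
      by (simp add: trem_def algebra_simps)
    finally show ?thesis .
  qed
  have "(LINT x|lborel. wt R x * Lop g g' x) = (LINT x|lborel. (LINT z|lborel. wt R x * (trem g g' x z / ?p z)))"
    by (intro Bochner_Integration.integral_cong refl) (simp only: Lop_def integral_mult_right_zero)
  also have "\<dots> = (LINT z|lborel. (LINT x|lborel. wt R x * (trem g g' x z / ?p z)))"
    using lborel_pair.Fubini_integral[OF i1] by simp
  also have "\<dots> = (LINT z|lborel. (LINT x|lborel. wt R x * trem g g' x z) / ?p z)" by simp
  also have "\<dots> = (LINT z|lborel. (\<lambda>z. (LINT x|lborel. g x * trem (wt R) (wt' R) x z) / ?p z) (- z))"
    unfolding key by simp
  also have "\<dots> = (LINT z|lborel. (LINT x|lborel. g x * trem (wt R) (wt' R) x z) / ?p z)"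
    using lborel_integral_real_affine[of "-1" "\<lambda>z. (LINT x|lborel. g x * trem (wt R) (wt' R) x z) / ?p z" 0] by simp
  also have "\<dots> = (LINT z|lborel. (LINT x|lborel. g x * (trem (wt R) (wt' R) x z / ?p z)))" by simp
  also have "\<dots> = (LINT x|lborel. (LINT z|lborel. g x * (trem (wt R) (wt' R) x z / ?p z)))"
    using lborel_pair.Fubini_integral[OF i2] by simp
  also have "\<dots> = (LINT x|lborel. g x * Lop (wt R) (wt' R) x)"
    by (intro Bochner_Integration.integral_cong refl) (simp only: Lop_def integral_mult_right_zero)
  finally show "(LINT x|lborel. wt R x * Lop g g' x) = (LINT x|lborel. g x * Lop (wt R) (wt' R) x)" .
qed

text \<open>With the operator moved onto the weight, only the supremum of \<open>g\<close> enters,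
  and the factor R^(1-\<alpha>) tends to 0 as R grows. The constant 12 \<open>pi\<close> is twice
  the 6 \<open>pi\<close> that bounds the derivative masses.\<close>

lemma wt_Lop_le:
  assumes R: "0 < R" and g: "C11 g g' K" and M: "\<And>x. \<bar>g x\<bar> \<le> M"
  shows "(LINT x|lborel. wt R x * Lop g g' x) \<le> M * (12 * pi * kint * R powr (1 - \<alpha>))"
proof -
  note [measurable] = C11_measurable[OF g] wt_measurable[OF R]
  have M0: "0 \<le> M" using M[of 0] abs_ge_zero order_trans by blast
  have L: "L1norm (\<lambda>x. Lop (wt R) (wt' R) x) \<le> ennreal (2 * (6 * pi) * (R powr (1 - \<alpha>) * kint))"
    by (rule L1_Lop[OF wt_DERIV[OF R] wt''_isCont[OF R] R _ wt'_L1[OF R] wt''_L1[OF R] C11_wt[OF R]]) auto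
  have nn: "0 \<le> 12 * pi * kint * R powr (1 - \<alpha>)" using kint_nonneg by simp
  have "ennreal (LINT x|lborel. wt R x * Lop g g' x) \<le> ennreal \<bar>LINT x|lborel. g x * Lop (wt R) (wt' R) x\<bar>"
    unfolding wt_Lop_adjoint(2)[OF R g M] by (intro ennreal_leI) simp
  also have "\<dots> \<le> L1norm (\<lambda>x. g x * Lop (wt R) (wt' R) x)"
    using integral_norm_bound_ennreal[of lborel "\<lambda>x. g x * Lop (wt R) (wt' R) x"] 
    by (cases "integrable lborel (\<lambda>x. g x * Lop (wt R) (wt' R) x)") (auto simp: not_integrable_integral_eq)
  also have "\<dots> \<le> (\<integral>\<^sup>+x. ennreal M * ennreal \<bar>Lop (wt R) (wt' R) x\<bar> \<partial>lborel)"
    by (intro nn_integral_mono) (use M M0 in \<open>auto simp: abs_mult ennreal_mult[symmetric] intro!: ennreal_leI mult_right_mono\<close>)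
  also have "\<dots> = ennreal M * L1norm (\<lambda>x. Lop (wt R) (wt' R) x)" by (rule nn_integral_cmult) measurable
  also have "\<dots> \<le> ennreal M * ennreal (2 * (6 * pi) * (R powr (1 - \<alpha>) * kint))" by (intro mult_left_mono L) auto
  also have "\<dots> = ennreal (M * (12 * pi * kint * R powr (1 - \<alpha>)))"
    using M0 nn by (simp add: ennreal_mult[symmetric] algebra_simps)
  finally show ?thesis using M0 nn by (subst (asm) ennreal_le_iff) auto
qed

text \<open>One time slice of V_t = CA Lop V - (b V)_x + e, tested with wt eta'(V). Convexity treats
  the nonlocal term, the product rule turns the flux into (b eta(V))_x up to a defect of size d Mb',
  and integration by parts leaves wt', which is at most wt / R.\<close>

theorem kato_static:
  assumes R: "0 < R" and d: "0 < d"
    and V: "C11 V V' K" and M: "\<And>x. \<bar>V x\<bar> \<le> M"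
    and b: "\<And>x. (b has_real_derivative b' x) (at x)" "\<And>x. isCont b' x" "\<And>x. \<bar>b x\<bar> \<le> Mb" "\<And>x. \<bar>b' x\<bar> \<le> Mb'"
    and e [measurable]: "e \<in> borel_measurable borel" and ebd: "\<And>x. \<bar>e x\<bar> \<le> Me"
    and Vt: "\<And>x. Vt x = CA * Lop V V' x - (b' x * V x + b x * V' x) + e x"
  shows "(LINT x|lborel. wt R x * (eta' d (V x) * Vt x)) \<le> 
    CA * (M + d) * (12 * pi * kint * R powr (1 - \<alpha>)) + Mb / R * (LINT x|lborel. wt R x * eta d (V x))
    + d * Mb' * (LINT x|lborel. wt R x) + (LINT x|lborel. wt R x * \<bar>e x\<bar>)"
proof -
  have cb: "isCont b x" for x using b(1) by (rule DERIV_isCont)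
  note [measurable] = C11_measurable[OF V] wt_measurable[OF R] eta_measurable[OF d]
  have [measurable]: "b \<in> borel_measurable borel" "b' \<in> borel_measurable borel"
    using cb b(2) by (auto intro: borel_measurable_isCont)
  have K: "0 \<le> K" by (rule C11D(4)[OF V])
  have M0: "0 \<le> M" using M[of 0] abs_ge_zero order_trans by blast
  have Mb0: "0 \<le> Mb" using b(3)[of 0] abs_ge_zero order_trans by blast
  have Mb'0: "0 \<le> Mb'" using b(4)[of 0] abs_ge_zero order_trans by blast
  define g where "g x = eta d (V x)" for x
  define g' where "g' x = eta' d (V x) * V' x" for x
  have g: "C11 g g' (K + K * K / d)" unfolding g_def g'_def by (rule C11_eta_comp[OF d V])
  have gb: "\<bar>g x\<bar> \<le> M + d" for x
    using eta_ge[OF d, of "V x"] eta_le[OF d, of "V x"] M[of x] unfolding g_def by linarith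
  have gpos: "0 \<le> g x" for x using eta_ge[OF d, of "V x"] unfolding g_def by linarith
  define c where "c x = b' x * g x + b x * g' x" for x
  have Dc: "((\<lambda>x. b x * g x) has_real_derivative c x) (at x)" for x
    unfolding c_def using DERIV_mult[OF b(1) C11D(1)[OF g], of x] by (simp add: mult.commute)
  have cc: "isCont c x" for x
    unfolding c_def by (intro continuous_intros b(2) cb C11_continuous[OF g])
  have bg: "\<bar>b x * g x\<bar> \<le> Mb * (M + d)" for x
    unfolding abs_mult using b(3) gb by (intro mult_mono) (auto simp: Mb0)
  have bc: "\<bar>c x\<bar> \<le> Mb' * (M + d) + Mb * (K + K * K / d)" for x
    unfolding c_def by (rule order_trans[OF abs_triangle_ineq], unfold abs_mult, intro add_mono mult_mono b gb C11D(2)[OF g]) 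
      (auto simp: Mb0 Mb'0)
  have parts: "(LINT x|lborel. wt R x * c x) = - (LINT x|lborel. wt' R x * (b x * g x))"
    by (rule wt_integral_by_parts[OF R Dc cc bg bc])
  have [measurable]: "c \<in> borel_measurable borel" "g \<in> borel_measurable borel" "g' \<in> borel_measurable borel"
    using cc C11_measurable[OF g] by (auto intro: borel_measurable_isCont)
  have LV: "eta' d (V x) * Lop V V' x \<le> Lop g g' x" for x
  proof -
    have "eta' d (V x) * Lop V V' x = (LINT z|lborel. eta' d (V x) * (trem V V' x z / \<bar>z\<bar> powr (1 + \<alpha>)))"
      unfolding Lop_def by (rule integral_mult_right_zero[symmetric])
    also have "\<dots> \<le> Lop g g' x"
      unfolding Lop_def
    proof (intro integral_mono integrable_mult_right integrable_trem[OF V] integrable_trem[OF g])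
      fix z
      show "eta' d (V x) * (trem V V' x z / \<bar>z\<bar> powr (1 + \<alpha>)) \<le> trem g g' x z / \<bar>z\<bar> powr (1 + \<alpha>)"
        using divide_right_mono[OF trem_eta_comp[OF d, of V x V' z], of "\<bar>z\<bar> powr (1 + \<alpha>)"]
        by (simp add: g_def[abs_def] g'_def[abs_def])
    qed
    finally show ?thesis .
  qed
  have pt: "wt R x * (eta' d (V x) * Vt x) \<le> 
      CA * (wt R x * Lop g g' x) - wt R x * c x + d * Mb' * wt R x + wt R x * \<bar>e x\<bar>" for x
  proof -
    \<comment> \<open>The tested flux eta'(V) (b' V + b V') splits into c, the derivative of b
      eta(V), and b' times the defect of \<open>eta\<close>.\<close>
    have "eta' d (V x) * Vt x = CA * (eta' d (V x) * Lop V V' x) - c x - b' x * (V x * eta' d (V x) - g x) + eta' d (V x) * e x"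
      unfolding Vt c_def g'_def by (simp add: algebra_simps)
    moreover have "CA * (eta' d (V x) * Lop V V' x) \<le> CA * Lop g g' x"
      using LV CA_pos by (intro mult_left_mono) auto
    moreover have "\<bar>b' x * (V x * eta' d (V x) - g x)\<bar> \<le> Mb' * d"
      unfolding abs_mult g_def by (intro mult_mono b eta_defect[OF d]) (auto simp: Mb'0)
    moreover have "\<bar>eta' d (V x) * e x\<bar> \<le> 1 * \<bar>e x\<bar>"
      unfolding abs_mult by (intro mult_right_mono eta'_le[OF d]) auto
    ultimately have "eta' d (V x) * Vt x \<le> CA * Lop g g' x - c x + d * Mb' + \<bar>e x\<bar>"
      by (simp add: mult.commute abs_le_iff)
    from mult_left_mono[OF this less_imp_le[OF wt_pos[OF R, of x]]] show ?thesis by (simp add: algebra_simps)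
  qed
  note iw = integrable_wt_mult[OF R]
  have [measurable]: "Vt \<in> borel_measurable borel" unfolding Vt[abs_def] by measurable
  have i1: "integrable lborel (\<lambda>x. CA * (wt R x * Lop g g' x))"
    using wt_Lop_adjoint(1)[OF R g gb] by simp
  have i2: "integrable lborel (\<lambda>x. wt R x * c x)" by (rule iw(1)[OF _ bc]) measurable
  have i3: "integrable lborel (\<lambda>x. d * Mb' * wt R x)" using wt_integrable[OF R] by simp
  have i4: "integrable lborel (\<lambda>x. wt R x * \<bar>e x\<bar>)" by (rule iw(1)[of _ Me]) (use ebd in auto)
  have i5: "integrable lborel (\<lambda>x. wt R x * g x)" by (rule iw(1)[OF _ gb]) measurable
  have i6: "integrable lborel (\<lambda>x. wt' R x * (b x * g x))" by (rule iw(2)[OF _ bg]) measurable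
  have i0: "integrable lborel (\<lambda>x. wt R x * (eta' d (V x) * Vt x))"
  proof (rule iw(1))
    fix x
    have "\<bar>Vt x\<bar> \<le> CA * (2 * K * kint) + (Mb' * M + Mb * K) + Me"
    proof -
      have "\<bar>CA * Lop V V' x\<bar> \<le> CA * (2 * K * kint)"
        unfolding abs_mult using CA_pos by (intro mult_mono Lop_bound[OF V]) auto
      moreover have "\<bar>b' x * V x\<bar> \<le> Mb' * M" unfolding abs_mult by (intro mult_mono b M) (auto simp: Mb'0)
      moreover have "\<bar>b x * V' x\<bar> \<le> Mb * K" unfolding abs_mult by (intro mult_mono b C11D(2)[OF V]) (auto simp: Mb0)
      ultimately show ?thesis unfolding Vt using ebd[of x] by linarith
    qed
    then have "\<bar>eta' d (V x)\<bar> * \<bar>Vt x\<bar> \<le> 1 * (CA * (2 * K * kint) + (Mb' * M + Mb * K) + Me)"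
      by (intro mult_mono eta'_le[OF d]) auto
    then show "\<bar>eta' d (V x) * Vt x\<bar> \<le> CA * (2 * K * kint) + (Mb' * M + Mb * K) + Me" by (simp add: abs_mult)
  qed measurable
  have "(LINT x|lborel. wt R x * (eta' d (V x) * Vt x)) \<le> 
      (LINT x|lborel. CA * (wt R x * Lop g g' x) - wt R x * c x + d * Mb' * wt R x + wt R x * \<bar>e x\<bar>)"
    by (intro integral_mono i0 Bochner_Integration.integrable_add Bochner_Integration.integrable_diff i1 i2 i3 i4 pt)
  also have "\<dots> = CA * (LINT x|lborel. wt R x * Lop g g' x) - (LINT x|lborel. wt R x * c x) + d * Mb' * (LINT x|lborel. wt R x)
      + (LINT x|lborel. wt R x * \<bar>e x\<bar>)"
    using i1 i2 i3 i4 by simp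
  finally have main: "(LINT x|lborel. wt R x * (eta' d (V x) * Vt x)) \<le> CA * (LINT x|lborel. wt R x * Lop g g' x) - (LINT x|lborel. wt R x * c x) 
      + d * Mb' * (LINT x|lborel. wt R x) + (LINT x|lborel. wt R x * \<bar>e x\<bar>)" .
  have t1: "CA * (LINT x|lborel. wt R x * Lop g g' x) \<le> CA * ((M + d) * (12 * pi * kint * R powr (1 - \<alpha>)))"
    using CA_pos by (intro mult_left_mono wt_Lop_le[OF R g gb]) auto
  have "- (LINT x|lborel. wt R x * c x) = (LINT x|lborel. wt' R x * (b x * g x))" using parts by simp
  also have "\<dots> \<le> (LINT x|lborel. Mb / R * (wt R x * g x))"
  proof (intro integral_mono i6 integrable_mult_right i5)
    fix x
    have "wt' R x * (b x * g x) \<le> \<bar>wt' R x\<bar> * (\<bar>b x\<bar> * \<bar>g x\<bar>)" by (metis abs_ge_self abs_mult)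
    also have "\<dots> \<le> (wt R x / R) * (Mb * g x)"
      using wt_pos[OF R, of x] R gpos[of x] by (intro mult_mono wt'_le[OF R] b(3)) (auto simp: Mb0)
    finally show "wt' R x * (b x * g x) \<le> Mb / R * (wt R x * g x)" by (simp add: algebra_simps)
  qed
  finally have t2: "- (LINT x|lborel. wt R x * c x) \<le> Mb / R * (LINT x|lborel. wt R x * g x)" by simp
  show ?thesis using main t1 t2 by (simp add: g_def[abs_def] mult.assoc)
qed

end

subsection \<open>A smooth approximate rarefaction wave\<close>

text \<open>Softplus, whose derivative is the logistic function \<open>sg\<close>: smooth versions
  of the positive part and of the Heaviside step, each within exp(-|x|) of its model.\<close>

definition sp :: "real \<Rightarrow> real" where "sp x = ln (1 + exp x)"
definition sg :: "real \<Rightarrow> real" where "sg x = 1 / (1 + exp (- x))"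
definition sg' :: "real \<Rightarrow> real" where "sg' x = sg x * (1 - sg x)"

lemma sg_bounds: "0 < sg x" "sg x < 1"
  by (auto simp: sg_def divide_simps add_pos_pos)

lemma sg'_bounds: "0 < sg' x" "sg' x \<le> 1"
  using sg_bounds[of x] mult_mono[of "sg x" 1 "1 - sg x" 1] by (auto simp: sg'_def)

lemma one_plus_exp_pos: "0 < 1 + exp (x::real)" by (simp add: add_pos_pos)

lemma sp_DERIV: "(sp has_real_derivative sg x) (at x)"
proof -
  have "exp x / (1 + exp x) = sg x"
    using one_plus_exp_pos[of x] one_plus_exp_pos[of "-x"] by (simp add: sg_def exp_minus field_simps)
  moreover have "(sp has_real_derivative exp x / (1 + exp x)) (at x)"
    unfolding sp_def using one_plus_exp_pos[of x] by (auto intro!: derivative_eq_intros)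
  ultimately show ?thesis by simp
qed

lemma sg_DERIV: "(sg has_real_derivative sg' x) (at x)"
proof -
  have p: "1 + exp (- x) \<noteq> 0" using one_plus_exp_pos[of "-x"] by linarith
  have "(sg has_real_derivative (0 * (1 + exp (- x)) - 1 * - exp (- x)) / ((1 + exp (- x)) * (1 + exp (- x)))) (at x)"
    unfolding sg_def by (rule DERIV_divide) (use p in \<open>auto intro!: derivative_eq_intros\<close>)
  moreover have "(0 * q - 1 * - (q - 1)) / (q * q) = 1 / q * (1 - 1 / q)" if "q \<noteq> 0" for q :: real
    using that by (simp add: field_simps)
  from this[OF p] have "(0 * (1 + exp (- x)) - 1 * - exp (- x)) / ((1 + exp (- x)) * (1 + exp (- x))) = sg' x"
    by (simp add: sg'_def sg_def)
  ultimately show ?thesis by simp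
qed

lemma sp_isCont: "isCont sp x" and sg_isCont: "isCont sg x"
  using sp_DERIV sg_DERIV by (blast intro: DERIV_isCont)+

lemma sg'_isCont: "isCont sg' x"
  unfolding sg'_def by (intro continuous_intros sg_isCont)

lemma sp_measurable [measurable]: "sp \<in> borel_measurable borel" "sg \<in> borel_measurable borel" "sg' \<in> borel_measurable borel"
  by (auto intro!: borel_measurable_isCont sp_isCont sg_isCont sg'_isCont)

lemma sp_diff_bounds:
  assumes "y \<le> x"
  shows "0 \<le> sp x - sp y" "sp x - sp y \<le> x - y"
proof -
  have "\<bar>sp x - sp y\<bar> \<le> 1 * \<bar>x - y\<bar>"
    using DERIV_bound_imp_lipschitz[OF sp_DERIV, of 1 x y] sg_bounds by (auto simp: less_imp_le)
  then show "sp x - sp y \<le> x - y" using assms by simp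
  have "sp y \<le> sp x"
    by (rule DERIV_nonneg_imp_nondecreasing[OF assms]) (use sp_DERIV sg_bounds(1) less_imp_le in blast)
  then show "0 \<le> sp x - sp y" by simp
qed

text \<open>For either sign of x the gap is ln(1 + exp(-|x|)).\<close>

lemma sp_approx: "0 \<le> sp x - max 0 x" "sp x - max 0 x \<le> exp (- \<bar>x\<bar>)"
proof -
  have "sp x - max 0 x = ln (1 + exp (- \<bar>x\<bar>))"
  proof (cases "0 \<le> x")
    case True
    have "1 + exp x = exp x * (1 + exp (- x))" by (simp add: distrib_left exp_minus)
    then have "sp x = ln (exp x) + ln (1 + exp (- x))"
      unfolding sp_def using one_plus_exp_pos[of "-x"] by (simp add: ln_mult)
    then show ?thesis using True by simp
  qed (simp add: sp_def)
  then show "0 \<le> sp x - max 0 x" "sp x - max 0 x \<le> exp (- \<bar>x\<bar>)"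
    by (auto intro: ln_add_one_self_le_self)
qed

lemma sg_approx: "\<bar>sg x - (if 0 < x then 1 else 0)\<bar> \<le> exp (- \<bar>x\<bar>)"
proof (cases "0 < x")
  case True
  have "sg x - 1 = - (exp (- x) / (1 + exp (- x)))" using one_plus_exp_pos[of "-x"] by (simp add: sg_def field_simps)
  moreover have "exp (- x) / (1 + exp (- x)) \<le> exp (- x) / 1" by (intro divide_left_mono) (auto simp: one_plus_exp_pos)
  moreover have "0 < exp (- x) / (1 + exp (- x))" using one_plus_exp_pos[of "-x"] by simp
  ultimately show ?thesis using True by simp
next
  case False
  have "sg x \<le> 1 / exp (- x)" unfolding sg_def by (intro divide_left_mono) (auto simp: one_plus_exp_pos)
  then show ?thesis using False sg_bounds(1)[of x] by (simp add: exp_minus field_simps)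
qed

text \<open>With e = exp(-|x|) \<le> 1 one has sg' = e / (1 + e)^2. The bound transfers the mass of
  \<open>sg'\<close>, known from its antiderivative, to the two-sided exponential; hence the
  constant 4 in \<open>nn_exp_abs\<close>.\<close>

lemma exp_le_sg': "exp (- \<bar>x\<bar>) \<le> 4 * sg' x"
proof -
  define e where "e = exp (- \<bar>x\<bar>)"
  have e: "0 < e" "e \<le> 1" by (auto simp: e_def)
  have c: "1 - 1 / (1 + e) = e / (1 + e)" "1 - e / (1 + e) = 1 / (1 + e)" using e by (simp_all add: divide_simps)
  have "sg' x = e / ((1 + e) * (1 + e))"
  proof (cases "0 \<le> x")
    case True
    then have "sg x = 1 / (1 + e)" by (simp add: sg_def e_def)
    then show ?thesis unfolding sg'_def by (simp only: c times_divide_times_eq mult_1)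
  next
    case False
    then have "sg x = 1 / (1 + 1 / e)" by (simp add: sg_def e_def exp_minus inverse_eq_divide)
    then have "sg x = e / (1 + e)" using e by (simp add: field_simps)
    then show ?thesis unfolding sg'_def by (simp only: c times_divide_times_eq mult_1_right)
  qed
  moreover have "(1 + e) * (1 + e) \<le> 2 * 2" using e by (intro mult_mono) auto
  then have "e / 4 \<le> e / ((1 + e) * (1 + e))" using e by (intro divide_left_mono) auto
  ultimately have "e \<le> 4 * sg' x" by linarith
  then show ?thesis by (simp only: e_def)
qed

lemma nn_sg': "(\<integral>\<^sup>+x. ennreal (sg' x) \<partial>lborel) \<le> 1"
proof -
  note i = integrable_deriv_of_bounded_mono[OF sg_DERIV sg'_isCont less_imp_le[OF sg'_bounds(1)] 
      less_imp_le[OF sg_bounds(1)] less_imp_le[OF sg_bounds(2)]]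
  show ?thesis using nn_integral_eq_integral[OF i(1)] i(2) sg'_bounds(1) by (simp add: less_imp_le)
qed

lemma nn_exp_abs: "(\<integral>\<^sup>+x. ennreal (exp (- \<bar>x - a\<bar>)) \<partial>lborel) \<le> 4"
proof -
  have "(\<integral>\<^sup>+x. ennreal (exp (- \<bar>x - a\<bar>)) \<partial>lborel) = (\<integral>\<^sup>+x. ennreal (exp (- \<bar>x\<bar>)) \<partial>lborel)"
    using nn_integral_shift[of "\<lambda>x. ennreal (exp (- \<bar>x\<bar>))" "-a"] by simp
  also have "\<dots> \<le> (\<integral>\<^sup>+x. 4 * ennreal (sg' x) \<partial>lborel)"
  proof (intro nn_integral_mono)
    fix x
    show "ennreal (exp (- \<bar>x\<bar>)) \<le> 4 * ennreal (sg' x)"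
      using ennreal_leI[OF exp_le_sg'[of x]] sg'_bounds(1)[of x] by (simp add: ennreal_mult)
  qed
  also have "\<dots> = 4 * (\<integral>\<^sup>+x. ennreal (sg' x) \<partial>lborel)" by (rule nn_integral_cmult) measurable
  also have "\<dots> \<le> 4 * 1" by (intro mult_left_mono nn_sg') auto
  finally show ?thesis by simp
qed

lemma ennreal_affine:
  "0 \<le> a \<Longrightarrow> 0 \<le> b \<Longrightarrow> 0 \<le> c \<Longrightarrow> ennreal a + ennreal b * ennreal c = ennreal (a + b * c)"
  by (simp add: ennreal_mult ennreal_plus)

locale profile = frac_order +
  fixes um up :: real
  assumes um_up: "um < up"
begin

text \<open>The rarefaction wave with its two corners smoothed at unit scale; it is used at \<open>\<tau> = 1 + t\<close>, so that it is
  smooth down to \<open>t = 0\<close>.\<close>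

definition prof :: "real \<Rightarrow> real \<Rightarrow> real" where
  "prof \<tau> x = um + (sp (x - um * \<tau>) - sp (x - up * \<tau>)) / \<tau>"
definition prof_x :: "real \<Rightarrow> real \<Rightarrow> real" where
  "prof_x \<tau> x = (sg (x - um * \<tau>) - sg (x - up * \<tau>)) / \<tau>"
definition prof_xx :: "real \<Rightarrow> real \<Rightarrow> real" where
  "prof_xx \<tau> x = (sg' (x - um * \<tau>) - sg' (x - up * \<tau>)) / \<tau>"
definition prof_t :: "real \<Rightarrow> real \<Rightarrow> real" where
  "prof_t \<tau> x = (up * sg (x - up * \<tau>) - um * sg (x - um * \<tau>)) / \<tau> - (sp (x - um * \<tau>) - sp (x - up * \<tau>)) / \<tau>\<^sup>2"
definition tails :: "real \<Rightarrow> real \<Rightarrow> real" where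
  "tails \<tau> x = exp (- \<bar>x - um * \<tau>\<bar>) + exp (- \<bar>x - up * \<tau>\<bar>)"

definition prof_err :: "real \<Rightarrow> real \<Rightarrow> real" where
  "prof_err \<tau> x = prof_t \<tau> x + prof \<tau> x * prof_x \<tau> x - CA * Lop (prof \<tau>) (prof_x \<tau>) x"

text \<open>The first two summands are 8 (2 (up - um) + 2): the mass of \<open>tails\<close> times
  the coefficient in \<open>prof_burgers\<close>. The last one is the nonlocal part, with
  \<open>max (up - um) 2\<close> dominating both derivative masses.\<close>

definition Cw :: real where
  "Cw = 16 * (up - um) + 16 + CA * (2 * (max (up - um) 2) * kint)"

lemma prof_measurable [measurable]: "prof \<tau> \<in> borel_measurable borel" "prof_x \<tau> \<in> borel_measurable borel"
  "prof_xx \<tau> \<in> borel_measurable borel" "prof_t \<tau> \<in> borel_measurable borel" "tails \<tau> \<in> borel_measurable borel"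
  unfolding prof_def prof_x_def prof_xx_def prof_t_def tails_def by measurable

lemma prof_DERIV:
  assumes "0 < \<tau>"
  shows "(prof \<tau> has_real_derivative prof_x \<tau> x) (at x)" "(prof_x \<tau> has_real_derivative prof_xx \<tau> x) (at x)"
    "((\<lambda>\<tau>. prof \<tau> x) has_real_derivative prof_t \<tau> x) (at \<tau>)"
proof -
  show "(prof \<tau> has_real_derivative prof_x \<tau> x) (at x)" unfolding prof_def prof_x_def using assms
    by (auto intro!: derivative_eq_intros DERIV_chain2[OF sp_DERIV])
  show "(prof_x \<tau> has_real_derivative prof_xx \<tau> x) (at x)" unfolding prof_x_def prof_xx_def using assms
    by (auto intro!: derivative_eq_intros DERIV_chain2[OF sg_DERIV])
  have "((\<lambda>\<tau>. um + (sp (x - um * \<tau>) - sp (x - up * \<tau>)) / \<tau>) has_real_derivative 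
    0 + ((sg (x - um * \<tau>) * - um - sg (x - up * \<tau>) * - up) * \<tau> - (sp (x - um * \<tau>) - sp (x - up * \<tau>)) * 1) / (\<tau> * \<tau>)) (at \<tau>)"
    by (intro DERIV_add DERIV_const DERIV_divide DERIV_diff DERIV_chain2[OF sp_DERIV] DERIV_ident)
      (use assms in \<open>auto intro!: derivative_eq_intros\<close>)
  moreover have "0 + (A * \<tau> - P * 1) / (\<tau> * \<tau>) = A / \<tau> - P / \<tau>\<^sup>2" for A P
    using assms by (simp add: diff_divide_distrib power2_eq_square)
  then have "0 + ((sg (x - um * \<tau>) * - um - sg (x - up * \<tau>) * - up) * \<tau> - (sp (x - um * \<tau>) - sp (x - up * \<tau>)) * 1) / (\<tau> * \<tau>) = prof_t \<tau> x"
    unfolding prof_t_def by (simp only:) (simp add: mult.commute)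
  ultimately show "((\<lambda>\<tau>. prof \<tau> x) has_real_derivative prof_t \<tau> x) (at \<tau>)" unfolding prof_def by simp
qed

lemma prof_xx_isCont: "isCont (prof_xx \<tau>) x"
  unfolding prof_xx_def divide_inverse
  by (intro continuous_intros isCont_o2[of x "\<lambda>x. x - c" sg' for c] sg'_isCont)

context
  fixes \<tau> :: real assumes \<tau>: "1 \<le> \<tau>"
begin

lemma shift_le: "x - up * \<tau> \<le> x - um * \<tau>"
  using um_up \<tau> by (simp add: mult_right_mono)

lemma sp_gap: "0 \<le> sp (x - um * \<tau>) - sp (x - up * \<tau>)" "sp (x - um * \<tau>) - sp (x - up * \<tau>) \<le> (up - um) * \<tau>"
  using sp_diff_bounds[OF shift_le, of x] by (auto simp: algebra_simps)

lemma prof_bounds: "um \<le> prof \<tau> x" "prof \<tau> x \<le> up"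
proof -
  show "um \<le> prof \<tau> x" using sp_gap(1)[of x] \<tau> by (simp add: prof_def)
  have "(sp (x - um * \<tau>) - sp (x - up * \<tau>)) / \<tau> \<le> (up - um) * \<tau> / \<tau>"
    using sp_gap(2)[of x] \<tau> by (intro divide_right_mono) auto
  then show "prof \<tau> x \<le> up" using \<tau> by (simp add: prof_def)
qed

lemma sg_mono: "sg (x - up * \<tau>) \<le> sg (x - um * \<tau>)"
  by (rule DERIV_nonneg_imp_nondecreasing[OF shift_le]) (use sg_DERIV sg'_bounds(1) less_imp_le in blast)

lemma prof_x_bounds: "0 \<le> prof_x \<tau> x" "prof_x \<tau> x \<le> 1 / \<tau>"
  using sg_mono[of x] sg_bounds[of "x - um * \<tau>"] sg_bounds[of "x - up * \<tau>"] \<tau>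
  by (auto simp: prof_x_def intro!: divide_right_mono)

lemma C11_prof: "C11 (prof \<tau>) (prof_x \<tau>) 1"
proof (rule C11I)
  have t0: "0 < \<tau>" using \<tau> by simp
  fix x
  show "(prof \<tau> has_real_derivative prof_x \<tau> x) (at x)" "(prof_x \<tau> has_real_derivative prof_xx \<tau> x) (at x)"
    by (rule prof_DERIV[OF t0])+
  have "1 / \<tau> \<le> 1" using \<tau> by simp
  then show "\<bar>prof_x \<tau> x\<bar> \<le> 1" using prof_x_bounds[of x] by linarith
  have "\<bar>sg' (x - um * \<tau>) - sg' (x - up * \<tau>)\<bar> / \<tau> \<le> 1 / 1"
    using sg'_bounds[of "x - um * \<tau>"] sg'_bounds[of "x - up * \<tau>"] \<tau> by (intro frac_le) auto
  then show "\<bar>prof_xx \<tau> x\<bar> \<le> 1" using \<tau> by (simp add: prof_xx_def abs_divide)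
qed

lemma prof_t_bound: "\<bar>prof_t \<tau> x\<bar> \<le> \<bar>um\<bar> + \<bar>up\<bar> + (up - um)"
proof -
  have a: "\<bar>up * sg (x - up * \<tau>)\<bar> \<le> \<bar>up\<bar>" "\<bar>um * sg (x - um * \<tau>)\<bar> \<le> \<bar>um\<bar>"
    using sg_bounds[of "x - um * \<tau>"] sg_bounds[of "x - up * \<tau>"] by (auto simp: abs_mult mult_left_le)
  have "\<bar>(up * sg (x - up * \<tau>) - um * sg (x - um * \<tau>)) / \<tau>\<bar> \<le> (\<bar>um\<bar> + \<bar>up\<bar>) / 1"
    unfolding abs_divide using a \<tau> by (intro frac_le) auto
  moreover have "\<bar>(sp (x - um * \<tau>) - sp (x - up * \<tau>)) / \<tau>\<^sup>2\<bar> \<le> (up - um) * \<tau> / \<tau>\<^sup>2"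
    using sp_gap[of x] \<tau> by (simp add: abs_divide divide_right_mono)
  moreover have "(up - um) * \<tau> / \<tau>\<^sup>2 = (up - um) / \<tau>" using \<tau> by (simp add: power2_eq_square)
  moreover have "(up - um) / \<tau> \<le> (up - um) / 1" using \<tau> um_up by (intro divide_left_mono) auto
  ultimately have "\<bar>(up * sg (x - up * \<tau>) - um * sg (x - um * \<tau>)) / \<tau>\<bar> \<le> \<bar>um\<bar> + \<bar>up\<bar>"
    "\<bar>(sp (x - um * \<tau>) - sp (x - up * \<tau>)) / \<tau>\<^sup>2\<bar> \<le> up - um" by simp_all
  then show ?thesis unfolding prof_t_def by (intro order_trans[OF abs_triangle_ineq4] add_mono)
qed

lemma nn_tails: "(\<integral>\<^sup>+x. ennreal (tails \<tau> x) \<partial>lborel) \<le> 8"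
proof -
  have "(\<integral>\<^sup>+x. ennreal (tails \<tau> x) \<partial>lborel) = (\<integral>\<^sup>+x. ennreal (exp (- \<bar>x - um * \<tau>\<bar>)) \<partial>lborel) + (\<integral>\<^sup>+x. ennreal (exp (- \<bar>x - up * \<tau>\<bar>)) \<partial>lborel)"
    unfolding tails_def by (simp add: nn_integral_add)
  also have "\<dots> \<le> 4 + 4" by (intro add_mono nn_exp_abs)
  finally show ?thesis by simp
qed

lemma nn_cmult_tails:
  assumes f: "\<And>x. \<bar>f x\<bar> \<le> c * tails \<tau> x" and c: "0 \<le> c"
  shows "L1norm f \<le> ennreal (8 * c)"
proof -
  have "L1norm f \<le> (\<integral>\<^sup>+x. ennreal c * ennreal (tails \<tau> x) \<partial>lborel)"
  proof (intro nn_integral_mono)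
    fix x
    have "0 \<le> tails \<tau> x" by (simp add: tails_def)
    then show "ennreal \<bar>f x\<bar> \<le> ennreal c * ennreal (tails \<tau> x)"
      using ennreal_leI[OF f[of x]] c by (simp add: ennreal_mult)
  qed
  also have "\<dots> = ennreal c * (\<integral>\<^sup>+x. ennreal (tails \<tau> x) \<partial>lborel)" by (rule nn_integral_cmult) measurable
  also have "\<dots> \<le> ennreal c * 8" by (intro mult_left_mono nn_tails) auto
  also have "\<dots> = ennreal (8 * c)" using c by (simp add: ennreal_mult mult.commute)
  finally show ?thesis .
qed

lemma prof_x_L1: "L1norm (prof_x \<tau>) \<le> ennreal (up - um)"
proof -
  have t0: "0 < \<tau>" using \<tau> by simp
  note * = integrable_deriv_of_bounded_mono[OF prof_DERIV(1)[OF t0] C11_continuous(2)[OF C11_prof] prof_x_bounds(1) prof_bounds]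
  show ?thesis using nn_integral_eq_integral[OF *(1)] *(2) prof_x_bounds(1) by (simp add: ennreal_leI)
qed

lemma prof_xx_L1: "L1norm (prof_xx \<tau>) \<le> ennreal (2 / \<tau>)"
proof -
  have "L1norm (prof_xx \<tau>) \<le> (\<integral>\<^sup>+x. ennreal (1 / \<tau>) * (ennreal (sg' (x - um * \<tau>)) + ennreal (sg' (x - up * \<tau>))) \<partial>lborel)"
  proof (intro nn_integral_mono)
    fix x
    have "\<bar>prof_xx \<tau> x\<bar> \<le> 1 / \<tau> * (sg' (x - um * \<tau>) + sg' (x - up * \<tau>))"
      using sg'_bounds[of "x - um * \<tau>"] sg'_bounds[of "x - up * \<tau>"] \<tau>
      by (auto simp: prof_xx_def abs_divide intro!: divide_right_mono)
    then show "ennreal \<bar>prof_xx \<tau> x\<bar> \<le> ennreal (1 / \<tau>) * (ennreal (sg' (x - um * \<tau>)) + ennreal (sg' (x - up * \<tau>)))"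
      using sg'_bounds[of "x - um * \<tau>"] sg'_bounds[of "x - up * \<tau>"] \<tau>
      by (simp add: ennreal_plus[symmetric] ennreal_mult[symmetric] ennreal_leI less_imp_le del: ennreal_plus)
  qed
  also have "\<dots> = ennreal (1 / \<tau>) * ((\<integral>\<^sup>+x. ennreal (sg' (x - um * \<tau>)) \<partial>lborel) + (\<integral>\<^sup>+x. ennreal (sg' (x - up * \<tau>)) \<partial>lborel))"
    by (simp add: nn_integral_cmult nn_integral_add)
  also have "\<dots> \<le> ennreal (1 / \<tau>) * (1 + 1)"
    using nn_integral_shift[of "\<lambda>x. ennreal (sg' x)" "- (um * \<tau>)"] nn_integral_shift[of "\<lambda>x. ennreal (sg' x)" "- (up * \<tau>)"] nn_sg'
    by (intro mult_left_mono add_mono) simp_all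
  also have "\<dots> = ennreal (1 / \<tau>) * ennreal 2" by (simp add: one_add_one)
  also have "\<dots> = ennreal (2 / \<tau>)" using \<tau> by (subst ennreal_mult[symmetric]) auto
  finally show ?thesis .
qed

text \<open>The mass of the first derivative is bounded by the jump, that of the second decays like
  2/\<tau>; \<open>max\<close> provides the common constant. For large \<tau> this bound dominates
  that of the Burgers part, which is O(1/\<tau>).\<close>

lemma prof_Lop_L1:
  "L1norm (\<lambda>x. Lop (prof \<tau>) (prof_x \<tau>) x) \<le> ennreal (2 * (max (up - um) 2) * (\<tau> powr (1 - \<alpha>) * kint))"
proof (rule L1_Lop[OF prof_DERIV(1,2) prof_xx_isCont _ _ _ _ C11_prof])
  show "0 < \<tau>" "0 < \<tau>" "0 < \<tau>" "0 \<le> max (up - um) 2" using \<tau> by auto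
  show "L1norm (prof_x \<tau>) \<le> ennreal (max (up - um) 2)"
    by (rule order_trans[OF prof_x_L1]) (simp add: ennreal_leI)
  show "L1norm (prof_xx \<tau>) \<le> ennreal (max (up - um) 2 / \<tau>)"
    by (rule order_trans[OF prof_xx_L1]) (use \<tau> in \<open>auto intro!: ennreal_leI divide_right_mono\<close>)
qed

text \<open>With sharp corners the wave solves Burgers' equation away from the corners, which is the
  identity \<open>ideal\<close>. Replacing positive parts by \<open>sp\<close> and steps by
  \<open>sg\<close> perturbs it by exponentials centred at the corners, and an overall factor
  1/\<tau> remains.\<close>

lemma prof_burgers: "\<bar>prof_t \<tau> x + prof \<tau> x * prof_x \<tau> x\<bar> \<le> (2 * (up - um) + 2) / \<tau> * tails \<tau> x"
proof -
  define y z where "y = x - um * \<tau>" and "z = x - up * \<tau>"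
  define D where "D = up - um"
  define P where "P = max 0 y - max 0 z"
  define Hy Hz :: real where "Hy = (if 0 < y then 1 else 0)" and "Hz = (if 0 < z then 1 else 0)"
  define ey ez where "ey = sp y - max 0 y" and "ez = sp z - max 0 z"
  define dy dz where "dy = sg y - Hy" and "dz = sg z - Hz"
  define Ey Ez where "Ey = exp (- \<bar>y\<bar>)" and "Ez = exp (- \<bar>z\<bar>)"
  have D: "0 < D" using um_up by (simp add: D_def)
  have yz: "y = z + D * \<tau>" by (simp add: y_def z_def D_def algebra_simps)
  have Dt: "0 < D * \<tau>" using D \<tau> by simp
  have P: "0 \<le> P" "P \<le> D * \<tau>" unfolding P_def using Dt by (auto simp: yz max_def)
  have e: "0 \<le> ey" "ey \<le> Ey" "0 \<le> ez" "ez \<le> Ez" unfolding ey_def ez_def Ey_def Ez_def by (rule sp_approx)+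
  have d: "\<bar>dy\<bar> \<le> Ey" "\<bar>dz\<bar> \<le> Ez" unfolding dy_def dz_def Hy_def Hz_def Ey_def Ez_def by (rule sg_approx)+
  have E: "0 < Ey" "0 < Ez" by (auto simp: Ey_def Ez_def)
  \<comment> \<open>Left of the fan P and Hz vanish; inside it 1 - Hy + Hz vanishes; right of it P =
    D \<tau> and the two terms cancel.\<close>
  have ideal: "D * Hz - P * (1 - Hy + Hz) / \<tau> = 0"
    unfolding P_def Hy_def Hz_def using Dt \<tau> by (auto simp: yz max_def)
  have "prof_t \<tau> x + prof \<tau> x * prof_x \<tau> x = (D * sg z - (sp y - sp z) * (1 - sg y + sg z) / \<tau>) / \<tau>"
    unfolding prof_t_def prof_def prof_x_def y_def[symmetric] z_def[symmetric] D_def using \<tau>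
    by (simp add: field_simps power2_eq_square)
  also have "D * sg z - (sp y - sp z) * (1 - sg y + sg z) / \<tau> = 
      (D * Hz - P * (1 - Hy + Hz) / \<tau>) + (D * dz - (ey - ez) * (1 - sg y + sg z) / \<tau> - P * (dz - dy) / \<tau>)"
    unfolding P_def ey_def ez_def dy_def dz_def using \<tau> by (simp add: field_simps)
  also have "\<dots> = D * dz - (ey - ez) * (1 - sg y + sg z) / \<tau> - P * (dz - dy) / \<tau>" unfolding ideal by simp
  finally have eq: "prof_t \<tau> x + prof \<tau> x * prof_x \<tau> x = (D * dz - (ey - ez) * (1 - sg y + sg z) / \<tau> - P * (dz - dy) / \<tau>) / \<tau>" .
  have b1: "\<bar>D * dz\<bar> \<le> D * Ez" using D d by (simp add: abs_mult)
  have b2: "\<bar>(ey - ez) * (1 - sg y + sg z) / \<tau>\<bar> \<le> (Ey + Ez) * 2 / 1"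
    unfolding abs_divide abs_mult using e sg_bounds[of y] sg_bounds[of z] \<tau> E
    by (intro frac_le mult_mono) auto
  have "\<bar>P\<bar> * \<bar>dz - dy\<bar> \<le> (D * \<tau>) * (Ey + Ez)"
    using P d E Dt by (intro mult_mono) auto
  then have "\<bar>P * (dz - dy) / \<tau>\<bar> \<le> (D * \<tau>) * (Ey + Ez) / \<tau>"
    unfolding abs_divide abs_mult using \<tau> by (simp only: divide_right_mono abs_of_nonneg order_trans[OF zero_le_one])
  then have b3: "\<bar>P * (dz - dy) / \<tau>\<bar> \<le> D * (Ey + Ez)" using \<tau> by simp
  have "\<bar>D * dz - (ey - ez) * (1 - sg y + sg z) / \<tau> - P * (dz - dy) / \<tau>\<bar> \<le> D * Ez + (Ey + Ez) * 2 / 1 + D * (Ey + Ez)"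
    using b1 b2 b3 by linarith
  also have "\<dots> \<le> (2 * D + 2) * (Ey + Ez)" using D E by (simp add: algebra_simps)
  finally have "\<bar>prof_t \<tau> x + prof \<tau> x * prof_x \<tau> x\<bar> \<le> (2 * D + 2) * (Ey + Ez) / \<tau>"
    unfolding eq abs_divide using \<tau> by (simp add: divide_right_mono)
  then show ?thesis by (simp add: tails_def Ey_def Ez_def y_def z_def D_def)
qed

lemma prof_err_L1: "L1norm (prof_err \<tau>) \<le> ennreal (Cw * \<tau> powr (1 - \<alpha>))"
proof -
  let ?L = "Lop (prof \<tau>) (prof_x \<tau>)"
  let ?c = "(2 * (up - um) + 2) / \<tau>"
  have "1 / \<tau> = \<tau> powr (-1)" using \<tau> by (simp add: powr_minus divide_inverse)
  also have "\<dots> \<le> \<tau> powr (1 - \<alpha>)" using \<tau> alpha by (intro powr_mono) auto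
  finally have t: "1 / \<tau> \<le> \<tau> powr (1 - \<alpha>)" .
  have nn: "0 \<le> 2 * (max (up - um) 2) * (\<tau> powr (1 - \<alpha>) * kint)" using kint_nonneg by simp
  have "L1norm (prof_err \<tau>) \<le> (\<integral>\<^sup>+x. ennreal \<bar>prof_t \<tau> x + prof \<tau> x * prof_x \<tau> x\<bar> + ennreal CA * ennreal \<bar>?L x\<bar> \<partial>lborel)"
  proof (intro nn_integral_mono)
    fix x
    have "\<bar>prof_err \<tau> x\<bar> \<le> \<bar>prof_t \<tau> x + prof \<tau> x * prof_x \<tau> x\<bar> + CA * \<bar>?L x\<bar>"
      unfolding prof_err_def using CA_pos abs_triangle_ineq4[of "prof_t \<tau> x + prof \<tau> x * prof_x \<tau> x" "CA * ?L x"] by (simp add: abs_mult)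
    then show "ennreal \<bar>prof_err \<tau> x\<bar> \<le> ennreal \<bar>prof_t \<tau> x + prof \<tau> x * prof_x \<tau> x\<bar> + ennreal CA * ennreal \<bar>?L x\<bar>"
      using CA_pos by (simp add: ennreal_plus[symmetric] ennreal_mult[symmetric] ennreal_leI less_imp_le del: ennreal_plus)
  qed
  also have "\<dots> = L1norm (\<lambda>x. prof_t \<tau> x + prof \<tau> x * prof_x \<tau> x) + ennreal CA * L1norm (\<lambda>x. ?L x)"
    by (simp add: nn_integral_add nn_integral_cmult)
  also have "\<dots> \<le> ennreal (8 * ?c) + ennreal CA * ennreal (2 * (max (up - um) 2) * (\<tau> powr (1 - \<alpha>) * kint))"
    using um_up \<tau> by (intro add_mono mult_left_mono nn_cmult_tails prof_burgers prof_Lop_L1) auto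
  also have "\<dots> = ennreal (8 * ?c + CA * (2 * (max (up - um) 2) * (\<tau> powr (1 - \<alpha>) * kint)))"
    using um_up \<tau> CA_pos nn by (simp add: ennreal_plus[symmetric] ennreal_mult[symmetric] less_imp_le del: ennreal_plus)
  also have "\<dots> \<le> ennreal (Cw * \<tau> powr (1 - \<alpha>))"
  proof (intro ennreal_leI)
    have "8 * ?c = (16 * (up - um) + 16) * (1 / \<tau>)" by (simp add: field_simps)
    also have "\<dots> \<le> (16 * (up - um) + 16) * \<tau> powr (1 - \<alpha>)" using um_up by (intro mult_left_mono t) auto
    finally show "8 * ?c + CA * (2 * (max (up - um) 2) * (\<tau> powr (1 - \<alpha>) * kint)) \<le> Cw * \<tau> powr (1 - \<alpha>)"
      by (simp add: Cw_def algebra_simps)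
  qed
  finally show ?thesis .
qed

end

lemma Cw_pos: "0 < Cw"
  unfolding Cw_def using um_up CA_pos kint_nonneg by (intro add_pos_nonneg mult_nonneg_nonneg) (auto simp: less_imp_le)

lemma rarefaction_clamp: "rarefaction um up \<tau> x = max um (min up (x / \<tau>))"
  using um_up by (auto simp: rarefaction_def max_def min_def)

lemma prof_rarefaction:
  assumes \<tau>: "1 \<le> \<tau>"
  shows "\<bar>prof \<tau> x - rarefaction um up \<tau> x\<bar> \<le> 1 * tails \<tau> x"
proof -
  define y z where "y = x - um * \<tau>" and "z = x - up * \<tau>"
  have t0: "0 < \<tau>" using \<tau> by simp
  have Dt: "um * \<tau> < up * \<tau>" using um_up t0 by simp
  have "rarefaction um up \<tau> x = um + (max 0 y - max 0 z) / \<tau>"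
  proof -
    have "\<tau> * max um (min up (x / \<tau>)) = max (um * \<tau>) (min (up * \<tau>) x)"
      using t0 by (simp add: max_mult_distrib_left min_mult_distrib_left mult.commute)
    also have "\<dots> = um * \<tau> + (max 0 y - max 0 z)" using Dt by (auto simp: y_def z_def max_def min_def)
    finally show ?thesis unfolding rarefaction_clamp using t0 by (simp add: field_simps)
  qed
  then have "prof \<tau> x - rarefaction um up \<tau> x = ((sp y - max 0 y) - (sp z - max 0 z)) / \<tau>"
    unfolding prof_def y_def[symmetric] z_def[symmetric] by (simp add: diff_divide_distrib)
  also have "\<bar>\<dots>\<bar> \<le> (exp (- \<bar>y\<bar>) + exp (- \<bar>z\<bar>)) / 1"
  proof -
    have "\<bar>(sp y - max 0 y) - (sp z - max 0 z)\<bar> \<le> exp (- \<bar>y\<bar>) + exp (- \<bar>z\<bar>)"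
      using sp_approx[of y] sp_approx[of z] by linarith
    then show ?thesis unfolding abs_divide using \<tau> by (intro frac_le) auto
  qed
  finally show ?thesis by (simp add: tails_def y_def z_def)
qed

definition vmax :: real where "vmax = max \<bar>um\<bar> \<bar>up\<bar>"

text \<open>The profile runs at time 1 + t, the wave at time t. For |x| \<le> vmax (1 + t) the
  clamped arguments differ by |x| / (t (1 + t)); beyond, both are saturated at the same end. The
  minimum keeps the bound finite as t tends to 0.\<close>

lemma rarefaction_time_shift:
  assumes t: "0 < t"
  shows "\<bar>rarefaction um up t x - rarefaction um up (1 + t) x\<bar> \<le> 
    min (up - um) (vmax / t) * indicator {- (vmax * (1 + t))..vmax * (1 + t)} x"
proof (cases "\<bar>x\<bar> \<le> vmax * (1 + t)")
  case True
  have cl: "\<bar>max um (min up a) - max um (min up b)\<bar> \<le> min (up - um) \<bar>a - b\<bar>" for a b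
    using um_up by (auto simp: max_def min_def)
  have "x / t - x / (1 + t) = x / (t * (1 + t))" using t by (simp add: field_simps)
  then have "\<bar>x / t - x / (1 + t)\<bar> = \<bar>x\<bar> / (t * (1 + t))" using t by (simp add: abs_divide abs_mult)
  also have "\<dots> \<le> vmax * (1 + t) / (t * (1 + t))" using True t by (intro divide_right_mono) auto
  also have "\<dots> = vmax / t" using t by simp
  finally have "\<bar>x / t - x / (1 + t)\<bar> \<le> vmax / t" .
  then show ?thesis using cl[of "x / t" "x / (1 + t)"] True unfolding rarefaction_clamp by (auto simp: indicator_def)
next
  case False
  have v: "\<bar>um\<bar> \<le> vmax" "\<bar>up\<bar> \<le> vmax" by (auto simp: vmax_def)
  have "vmax * (1 + t) < \<bar>x\<bar>" using False by simp
  then have b1: "vmax < \<bar>x\<bar> / (1 + t)" using t by (simp add: less_divide_eq)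
  moreover have "\<bar>x\<bar> / (1 + t) \<le> \<bar>x\<bar> / t" using t by (intro divide_left_mono) auto
  ultimately have b2: "vmax < \<bar>x\<bar> / t" by simp
  have "rarefaction um up t x = rarefaction um up (1 + t) x"
    using b1 b2 v um_up unfolding rarefaction_clamp by (cases "0 \<le> x") (auto simp: max_def min_def)
  then show ?thesis using um_up t by (auto simp: indicator_def vmax_def)
qed

text \<open>The bound is uniform in t: for large t a height O(1/t) meets a length O(t), and for t
  \<le> 1 the height \<open>up - um\<close> meets a bounded length.\<close>

lemma prof_rarefaction_L1:
  assumes t: "0 < t"
  shows "L1norm (\<lambda>x. prof (1 + t) x - rarefaction um up t x) \<le> ennreal (8 + 4 * vmax * (up - um) + 4 * vmax * vmax)"
proof -
  let ?h = "min (up - um) (vmax / t)" and ?r = "vmax * (1 + t)"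
  have v: "0 \<le> vmax" by (auto simp: vmax_def)
  have h: "0 \<le> ?h" using um_up v t by simp
  have r: "0 \<le> ?r" using v t by simp
  have t1: "1 \<le> 1 + t" using t by simp
  have "L1norm (\<lambda>x. prof (1 + t) x - rarefaction um up t x) \<le> 
    (\<integral>\<^sup>+x. ennreal (tails (1 + t) x) + ennreal ?h * indicator {- ?r..?r} x \<partial>lborel)"
  proof (intro nn_integral_mono)
    fix x
    have "\<bar>prof (1 + t) x - rarefaction um up t x\<bar> \<le> tails (1 + t) x + ?h * indicator {- ?r..?r} x"
      using prof_rarefaction[OF t1, of x] rarefaction_time_shift[OF t, of x] by linarith
    moreover have "0 \<le> tails (1 + t) x" by (simp add: tails_def)
    ultimately show "ennreal \<bar>prof (1 + t) x - rarefaction um up t x\<bar> \<le> ennreal (tails (1 + t) x) + ennreal ?h * indicator {- ?r..?r} x"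
      using h by (auto simp: indicator_def ennreal_plus[symmetric] ennreal_leI simp del: ennreal_plus split: if_splits)
  qed
  also have "\<dots> = (\<integral>\<^sup>+x. ennreal (tails (1 + t) x) \<partial>lborel) + ennreal ?h * emeasure lborel {- ?r..?r}"
    by (subst nn_integral_add) (auto simp: nn_integral_cmult_indicator)
  also have "\<dots> \<le> ennreal 8 + ennreal ?h * ennreal (2 * ?r)"
    using nn_tails[OF t1] r by (intro add_mono mult_left_mono) auto
  also have "\<dots> = ennreal (8 + ?h * (2 * ?r))"
    using h r by (intro ennreal_affine) auto
  also have "\<dots> \<le> ennreal (8 + 4 * vmax * (up - um) + 4 * vmax * vmax)"
  proof (intro ennreal_leI)
    have "?h * (2 * ?r) \<le> 4 * vmax * (up - um) + 4 * vmax * vmax"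
    proof (cases "t \<le> 1")
      case True
      have "?h * (2 * ?r) \<le> (up - um) * (2 * (vmax * 2))"
        using True h r v um_up t by (intro mult_mono) auto
      moreover have "0 \<le> 4 * vmax * vmax" using v by simp
      moreover have "(up - um) * (2 * (vmax * 2)) = 4 * vmax * (up - um)" by simp
      ultimately show ?thesis by linarith
    next
      case False
      have "?h * (2 * ?r) \<le> (vmax / t) * (2 * (vmax * (t + t)))"
        using False h r v t by (intro mult_mono) auto
      also have "\<dots> = 4 * vmax * vmax" using t by (simp add: field_simps)
      finally show ?thesis using v um_up mult_nonneg_nonneg[of vmax "up - um"] by (simp add: algebra_simps)
    qed
    then show "8 + ?h * (2 * ?r) \<le> 8 + 4 * vmax * (up - um) + 4 * vmax * vmax" by simp
  qed
  finally show ?thesis .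
qed

text \<open>At time 1 the wave differs from the step only inside [-vmax, vmax]; the rest is
  \<open>tails\<close>.\<close>

lemma prof_step_L1:
  "L1norm (\<lambda>x. prof 1 x - (if x < 0 then um else up)) \<le> ennreal (8 + 2 * vmax * (up - um))"
proof -
  have v: "0 \<le> vmax" "\<bar>um\<bar> \<le> vmax" "\<bar>up\<bar> \<le> vmax" by (auto simp: vmax_def)
  have "L1norm (\<lambda>x. prof 1 x - (if x < 0 then um else up)) \<le> 
    (\<integral>\<^sup>+x. ennreal (tails 1 x) + ennreal (up - um) * indicator {- vmax..vmax} x \<partial>lborel)"
  proof (intro nn_integral_mono)
    fix x
    have "\<bar>rarefaction um up 1 x - (if x < 0 then um else up)\<bar> \<le> (up - um) * indicator {- vmax..vmax} x"
      unfolding rarefaction_clamp using v um_up by (auto simp: indicator_def max_def min_def)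
    then have "\<bar>prof 1 x - (if x < 0 then um else up)\<bar> \<le> tails 1 x + (up - um) * indicator {- vmax..vmax} x"
      using prof_rarefaction[of 1 x] by linarith
    moreover have "0 \<le> tails 1 x" by (simp add: tails_def)
    ultimately show "ennreal \<bar>prof 1 x - (if x < 0 then um else up)\<bar> \<le> ennreal (tails 1 x) + ennreal (up - um) * indicator {- vmax..vmax} x"
      using um_up by (auto simp: indicator_def ennreal_plus[symmetric] ennreal_leI simp del: ennreal_plus split: if_splits)
  qed
  also have "\<dots> = (\<integral>\<^sup>+x. ennreal (tails 1 x) \<partial>lborel) + ennreal (up - um) * emeasure lborel {- vmax..vmax}"
    by (subst nn_integral_add) (auto simp: nn_integral_cmult_indicator)
  also have "\<dots> \<le> ennreal 8 + ennreal (up - um) * ennreal (2 * vmax)"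
    using nn_tails[of 1] v by (intro add_mono mult_left_mono) auto
  also have "\<dots> = ennreal (8 + (up - um) * (2 * vmax))"
    using um_up v by (intro ennreal_affine) auto
  also have "8 + (up - um) * (2 * vmax) = 8 + 2 * vmax * (up - um)" by simp
  finally show ?thesis .
qed

end

subsection \<open>Box averages\<close>

text \<open>The window lies to the right of x, in accordance with the right continuity of
  \<open>u0\<close>; the derivative of the average is a difference quotient.\<close>

definition bavg :: "real \<Rightarrow> (real \<Rightarrow> real) \<Rightarrow> real \<Rightarrow> real" where
  "bavg h f x = (1 / h) * (LINT y|lborel. indicator {0..h} y * f (x + y))"

lemma bavg_measurable [measurable (raw)]:
  assumes [measurable]: "f \<in> borel_measurable borel" "X \<in> borel_measurable N"
  shows "(\<lambda>w. bavg h f (X w)) \<in> borel_measurable N"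
  unfolding bavg_def by measurable

lemma integrable_indicator_Icc [simp]: "integrable lborel (indicator {a..b} :: real \<Rightarrow> real)"
  by (rule integrable_real_indicator) (auto simp: emeasure_lborel_Icc_eq)

lemma integrable_indicator_bounded:
  fixes f :: "real \<Rightarrow> real"
  assumes [measurable]: "f \<in> borel_measurable borel" and M: "\<And>y. \<bar>f y\<bar> \<le> M"
  shows "integrable lborel (\<lambda>y. indicator {a..b} y * f y)"
proof (rule Bochner_Integration.integrable_bound)
  show "integrable lborel (\<lambda>y. M * indicator {a..b} y :: real)" by simp
  show "AE y in lborel. norm (indicator {a..b} y * f y) \<le> norm (M * indicator {a..b} y)"
    using M order_trans[OF M abs_ge_self] by (auto simp: indicator_def intro!: AE_I2)
qed measurable

context
  fixes h :: real assumes h: "0 < h"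
begin

lemma integrable_bavg:
  fixes f :: "real \<Rightarrow> real"
  assumes [measurable]: "f \<in> borel_measurable borel" and M: "\<And>y. \<bar>f y\<bar> \<le> M"
  shows "integrable lborel (\<lambda>y. indicator {0..h} y * f (x + y))"
  by (rule integrable_indicator_bounded) (use M in auto)

lemma bavg_diff_le:
  fixes f :: "real \<Rightarrow> real"
  assumes [measurable]: "f \<in> borel_measurable borel" and M: "\<And>y. \<bar>f y\<bar> \<le> M"
    and L: "\<And>y. 0 \<le> y \<Longrightarrow> y \<le> h \<Longrightarrow> \<bar>f (x + y) - c\<bar> \<le> L"
  shows "\<bar>bavg h f x - c\<bar> \<le> L"
proof -
  note i = integrable_bavg[OF assms(1) M, where x = x]
  have one: "(LINT y|lborel. indicator {0..h} y * k) = h * k" for k :: real using h by simp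
  have "(LINT y|lborel. indicator {0..h} y * (f (x + y) - c)) = (LINT y|lborel. indicator {0..h} y * f (x + y) - indicator {0..h} y * c)"
    by (simp add: right_diff_distrib)
  also have "\<dots> = (LINT y|lborel. indicator {0..h} y * f (x + y)) - h * c"
    using i h by (subst Bochner_Integration.integral_diff) (auto simp: one)
  finally have e: "h * (bavg h f x - c) = (LINT y|lborel. indicator {0..h} y * (f (x + y) - c))"
    using h by (simp add: bavg_def right_diff_distrib)
  have ic: "integrable lborel (\<lambda>y. indicator {0..h} y * (f (x + y) - c))"
    using i h by (simp add: right_diff_distrib)
  have "\<bar>LINT y|lborel. indicator {0..h} y * (f (x + y) - c)\<bar> \<le> (LINT y|lborel. \<bar>indicator {0..h} y * (f (x + y) - c)\<bar>)"
    using integral_norm_bound[of lborel "\<lambda>y. indicator {0..h} y * (f (x + y) - c)"] by simp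
  also have "\<dots> \<le> (LINT y|lborel. indicator {0..h} y * L)"
    by (intro integral_mono integrable_abs ic integrable_mult_left integrable_indicator_Icc) (use L h in \<open>auto simp: indicator_def\<close>)
  finally have "h * \<bar>bavg h f x - c\<bar> \<le> h * L" unfolding e[symmetric] one using h by (simp add: abs_mult)
  then show ?thesis using h by simp
qed

lemma bavg_bound:
  fixes f :: "real \<Rightarrow> real"
  assumes "f \<in> borel_measurable borel" "\<And>y. \<bar>f y\<bar> \<le> M"
  shows "\<bar>bavg h f x\<bar> \<le> M"
  using bavg_diff_le[OF assms, of x 0 M] assms by simp

lemma bavg_deriv:
  assumes D: "\<And>x. (f has_real_derivative f' x) (at x)" and c: "\<And>x. isCont f' x"
  shows "bavg h f' x = (f (x + h) - f x) / h"
proof -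
  have "(LINT y|lborel. indicator {0..h} y *\<^sub>R f' (x + y)) = f (x + h) - f (x + 0)"
  proof (rule integral_FTC_atLeastAtMost)
    show "((\<lambda>y. f (x + y)) has_vector_derivative f' (x + y)) (at y within {0..h})" for y
    proof -
      have "((\<lambda>y. f (x + y)) has_real_derivative f' (x + y) * (0 + 1)) (at y)"
        by (intro DERIV_chain2[OF D] DERIV_add DERIV_const DERIV_ident)
      then show ?thesis
        by (simp add: has_real_derivative_iff_has_vector_derivative has_vector_derivative_at_within)
    qed
    have "continuous_on UNIV f'" using c by (simp add: continuous_at_imp_continuous_on)
    then show "continuous_on {0..h} (\<lambda>y. f' (x + y))"
      by (auto intro!: continuous_intros intro: continuous_on_compose2)
  qed (use h in simp)
  then show ?thesis by (simp add: bavg_def)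
qed

lemma bavg_DERIV:
  assumes c: "\<And>x. isCont f x"
  shows "(bavg h f has_real_derivative (f (x + h) - f x) / h) (at x)"
proof -
  obtain P where P: "\<And>x. (P has_real_derivative f x) (at x)" using exists_antiderivative[of f] c by auto
  have "bavg h f = (\<lambda>x. (P (x + h) - P x) / h)" using bavg_deriv[OF P c] by auto
  moreover have "((\<lambda>x. (P (x + h) - P x) / h) has_real_derivative (f (x + h) * 1 - f x) / h) (at x)"
    by (intro DERIV_cdivide DERIV_diff DERIV_chain2[OF P] P) (auto intro!: derivative_eq_intros)
  ultimately show ?thesis by simp
qed

text \<open>The constant worsens as h tends to 0, which is harmless: Kato's inequality uses that
  some constant exists, and its bound does not contain it.\<close>

lemma C11_bavg:
  assumes f: "C11 f f' K"
  shows "C11 (bavg h f) (\<lambda>x. (f (x + h) - f x) / h) (K + 2 * K / h)"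
  unfolding C11_def
proof (intro conjI allI)
  fix x y
  have K: "0 \<le> K" "0 \<le> 2 * K / h" using C11D(4)[OF f] h by auto
  have lip: "\<bar>f a - f b\<bar> \<le> K * \<bar>a - b\<bar>" for a b
    using DERIV_bound_imp_lipschitz C11D(1,2)[OF f] by blast
  show "(bavg h f has_real_derivative (f (x + h) - f x) / h) (at x)"
    by (rule bavg_DERIV[OF C11_continuous(1)[OF f]])
  have "\<bar>(f (x + h) - f x) / h\<bar> \<le> K" using lip[of "x+h" x] h by (simp add: abs_divide divide_le_eq)
  then show "\<bar>(f (x + h) - f x) / h\<bar> \<le> K + 2 * K / h" using K by linarith
  have "\<bar>(f (x + h) - f x) - (f (y + h) - f y)\<bar> \<le> 2 * K * \<bar>x - y\<bar>"
    using lip[of "x+h" "y+h"] lip[of x y] by simp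
  then have "\<bar>(f (x + h) - f x) - (f (y + h) - f y)\<bar> / h \<le> 2 * K * \<bar>x - y\<bar> / h"
    using h by (intro divide_right_mono) auto
  moreover have "(f (x + h) - f x) / h - (f (y + h) - f y) / h = ((f (x + h) - f x) - (f (y + h) - f y)) / h"
    by (simp add: diff_divide_distrib)
  then have "\<bar>(f (x + h) - f x) / h - (f (y + h) - f y) / h\<bar> = \<bar>(f (x + h) - f x) - (f (y + h) - f y)\<bar> / h"
    using h by (simp only: abs_divide abs_of_pos)
  moreover have "2 * K * \<bar>x - y\<bar> / h \<le> (K + 2 * K / h) * \<bar>x - y\<bar>" using K by (simp add: distrib_right)
  ultimately show "\<bar>(f (x + h) - f x) / h - (f (y + h) - f y) / h\<bar> \<le> (K + 2 * K / h) * \<bar>x - y\<bar>" by linarith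
qed

end

context frac_order
begin

text \<open>An average is a superposition of translates and so commutes with the operator; only the
  quadratic flux will leave a commutator.\<close>

lemma Lop_bavg:
  assumes h: "0 < h" and f: "C11 f f' K" and M: "\<And>x. \<bar>f x\<bar> \<le> M"
  shows "Lop (bavg h f) (\<lambda>x. (f (x + h) - f x) / h) x = bavg h (Lop f f') x"
proof -
  let ?p = "\<lambda>z::real. \<bar>z\<bar> powr (1 + \<alpha>)"
  note [measurable] = C11_measurable[OF f]
  have K: "0 \<le> K" by (rule C11D(4)[OF f])
  note i = integrable_bavg[OF h]
  have fb: "(f (x + h) - f x) / h = bavg h f' x"
    using bavg_deriv[OF h C11D(1)[OF f] C11_continuous(2)[OF f]] by simp
  have e: "trem (bavg h f) (\<lambda>x. (f (x + h) - f x) / h) x z = (1 / h) * (LINT y|lborel. indicator {0..h} y * trem f f' (x + y) z)" for z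
  proof -
    have ia: "integrable lborel (\<lambda>y. indicator {0..h} y * f (x + z + y))" "integrable lborel (\<lambda>y. indicator {0..h} y * f (x + y))"
      by (rule i[OF _ M]; measurable)+
    have ib: "integrable lborel (\<lambda>y. z * (indicator {0..h} y * f' (x + y)))"
      by (rule integrable_mult_right, rule i[OF _ C11D(2)[OF f]]) measurable
    have "(LINT y|lborel. indicator {0..h} y * trem f f' (x + y) z) = 
      (LINT y|lborel. indicator {0..h} y * f (x + z + y) - indicator {0..h} y * f (x + y) - z * (indicator {0..h} y * f' (x + y)))"
      by (simp add: trem_def algebra_simps)
    also have "\<dots> = (LINT y|lborel. indicator {0..h} y * f (x + z + y)) - (LINT y|lborel. indicator {0..h} y * f (x + y)) 
        - z * (LINT y|lborel. indicator {0..h} y * f' (x + y))"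
      using ia ib by (simp del: integral_mult_right_zero add: integral_mult_right_zero[symmetric])
    finally have eq: "(LINT y|lborel. indicator {0..h} y * trem f f' (x + y) z) = (LINT y|lborel. indicator {0..h} y * f (x + z + y)) 
        - (LINT y|lborel. indicator {0..h} y * f (x + y)) - z * (LINT y|lborel. indicator {0..h} y * f' (x + y))" .
    have "trem (bavg h f) (\<lambda>x. (f (x + h) - f x) / h) x z = bavg h f (x + z) - bavg h f x - bavg h f' x * z"
      unfolding trem_def fb ..
    moreover have "1 / h * A - 1 / h * B - 1 / h * C * z = 1 / h * (A - B - z * C)" for A B C
      by (simp add: algebra_simps diff_divide_distrib)
    ultimately show ?thesis unfolding eq bavg_def by (simp only:)
  qed
  have int: "integrable (lborel \<Otimes>\<^sub>M lborel) (\<lambda>(y,z). indicator {0..h} y * (trem f f' (x + y) z / ?p z))"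
  proof (rule Bochner_Integration.integrable_bound)
    show "integrable (lborel \<Otimes>\<^sub>M lborel) (\<lambda>(y::real,z). indicator {0..h} y * (2 * K * kap z))"
    proof (rule lborel_pair.Fubini_integrable)
      have "(\<lambda>y. LINT z|lborel. norm (case (y, z) of (y, z) \<Rightarrow> indicator {0..h} y * (2 * K * kap z))) = (\<lambda>y. indicator {0..h} y * (2 * K * kint))"
        using K kap_nonneg by (auto simp: abs_mult kint_def)
      then show "integrable lborel (\<lambda>y. LINT z|lborel. norm (case (y, z) of (y, z) \<Rightarrow> indicator {0..h} y * (2 * K * kap z)))"
        by simp
      show "AE y in lborel. integrable lborel (\<lambda>z. case (y::real, z) of (y, z) \<Rightarrow> indicator {0..h} y * (2 * K * kap z))"
        using integrable_kap by auto
    qed measurable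
    show "AE w in lborel \<Otimes>\<^sub>M lborel. norm (case w of (y,z) \<Rightarrow> indicator {0..h} y * (trem f f' (x + y) z / ?p z)) \<le> 
        norm (case w of (y,z) \<Rightarrow> indicator {0..h} y * (2 * K * kap z))"
    proof (intro AE_I2)
      fix w :: "real \<times> real"
      obtain y z where w: "w = (y,z)" by (cases w)
      show "norm (case w of (y,z) \<Rightarrow> indicator {0..h} y * (trem f f' (x + y) z / ?p z)) \<le> 
        norm (case w of (y,z) \<Rightarrow> indicator {0..h} y * (2 * K * kap z))"
        using trem_kap[OF f, of "x + y" z] K kap_nonneg[of z] by (simp add: w abs_mult indicator_def)
    qed
  qed measurable
  have "Lop (bavg h f) (\<lambda>x. (f (x + h) - f x) / h) x = 
      (LINT z|lborel. (1 / h) * (LINT y|lborel. indicator {0..h} y * (trem f f' (x + y) z / ?p z)))"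
    unfolding Lop_def e by simp
  also have "\<dots> = (1 / h) * (LINT z|lborel. (LINT y|lborel. indicator {0..h} y * (trem f f' (x + y) z / ?p z)))"
    by (rule integral_mult_right_zero)
  also have "\<dots> = (1 / h) * (LINT y|lborel. (LINT z|lborel. indicator {0..h} y * (trem f f' (x + y) z / ?p z)))"
    using lborel_pair.Fubini_integral[OF int] by simp
  also have "\<dots> = (1 / h) * (LINT y|lborel. indicator {0..h} y * Lop f f' (x + y))"
    by (intro arg_cong2[where f="(*)"] Bochner_Integration.integral_cong refl) (simp only: Lop_def integral_mult_right_zero)
  finally show ?thesis unfolding bavg_def .
qed

end

section \<open>The averaged equation and its initial value\<close>

context frac_burgers
begin

lemma dt_measurable [measurable]: "0 < t \<Longrightarrow> dt u t \<in> borel_measurable borel"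
  using u_DERIV(4) by (intro borel_measurable_isCont)

lemma u_isCont: "0 < t \<Longrightarrow> isCont (u t) x"
  using u_DERIV(2) by (rule DERIV_isCont)

lemma u_measurable [measurable]: "0 < t \<Longrightarrow> u t \<in> borel_measurable borel"
  using u_isCont by (intro borel_measurable_isCont)

lemma bavg_time_DERIV:
  assumes h: "0 < h" and t: "0 < t"
  shows "((\<lambda>s. bavg h (u s) x) has_real_derivative bavg h (dt u t) x) (at t)"
proof -
  obtain M where M: "\<And>s x. 0 < s \<Longrightarrow> s < t + 1 \<Longrightarrow> \<bar>u s x\<bar> \<le> M" using u_bounded by blast
  obtain K where K: "\<And>s x. t/2 < s \<Longrightarrow> s < t + 1 \<Longrightarrow> \<bar>dt u s x\<bar> \<le> K"
    by (rule u_C11[of "t/2" "t+1"]) (use t in auto)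
  have "((\<lambda>s. LINT y|lborel. indicator {0..h} y * u s (x + y)) has_real_derivative 
      (LINT y|lborel. indicator {0..h} y * dt u t (x + y))) (at t)"
  proof (rule DERIV_integral_dominated[where a="t/2" and b="t+1" and B="\<lambda>y. indicator {0..h} y * K"])
    fix s y assume s: "t / 2 < s" "s < t + 1"
    then have s0: "0 < s" using t by simp
    show "((\<lambda>s. indicator {0..h} y * u s (x + y)) has_real_derivative indicator {0..h} y * dt u s (x + y)) (at s)"
      by (intro DERIV_cmult u_DERIV s0)
    show "\<bar>indicator {0..h} y * dt u s (x + y)\<bar> \<le> indicator {0..h} y * K"
      using K[OF s] by (auto simp: indicator_def)
  next
    fix s assume s: "t / 2 < s" "s < t + 1"
    then have s0: "0 < s" using t by simp
    show "integrable lborel (\<lambda>y. indicator {0..h} y * u s (x + y))"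
      by (rule integrable_bavg[OF h u_measurable[OF s0] M[OF s0 s(2)]])
  qed (use t in auto)
  from DERIV_cmult[OF this, of "1/h"] show ?thesis unfolding bavg_def by simp
qed

text \<open>The averaged flux integrates exactly to a difference quotient of u^2/2, so that u_x no
  longer occurs on the right.\<close>

lemma bavg_dt:
  assumes h: "0 < h" and t: "0 < t"
  shows "bavg h (dt u t) x = CA * Lop (bavg h (u t)) (\<lambda>x. (u t (x + h) - u t x) / h) x
    - ((u t (x + h))\<^sup>2 - (u t x)\<^sup>2) / (2 * h)"
proof -
  obtain M where M: "\<And>s x. 0 < s \<Longrightarrow> s < t + 1 \<Longrightarrow> \<bar>u s x\<bar> \<le> M" using u_bounded by blast
  have M: "\<bar>u t x\<bar> \<le> M" for x using M[of t] t by simp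
  obtain K where K: "C11 (u t) (dx u t) K" using u_C11_at[OF t] .
  note [measurable] = C11_measurable[OF K]
  have M0: "0 \<le> M" using M[of 0] abs_ge_zero order_trans by blast
  have uu: "\<bar>u t x * dx u t x\<bar> \<le> M * K" for x
    unfolding abs_mult by (intro mult_mono M C11D(2)[OF K]) (auto simp: M0)
  note i = integrable_bavg[OF h]
  have i1: "integrable lborel (\<lambda>y. indicator {0..h} y * Lop (u t) (dx u t) (x + y))"
    by (rule i[OF _ Lop_bound[OF K]]) measurable
  have i2: "integrable lborel (\<lambda>y. indicator {0..h} y * (u t (x + y) * dx u t (x + y)))"
    by (rule i[of "\<lambda>x. u t x * dx u t x", OF _ uu]) measurable
  have "bavg h (dt u t) x = (1 / h) * (LINT y|lborel. CA * (indicator {0..h} y * Lop (u t) (dx u t) (x + y)) 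
      - indicator {0..h} y * (u t (x + y) * dx u t (x + y)))"
    unfolding bavg_def u_eq[OF t] by (simp add: algebra_simps)
  also have "\<dots> = CA * bavg h (Lop (u t) (dx u t)) x - bavg h (\<lambda>x. u t x * dx u t x) x"
    using i1 i2 unfolding bavg_def by (simp add: algebra_simps diff_divide_distrib)
  also have "bavg h (\<lambda>x. u t x * dx u t x) x = ((u t (x + h))\<^sup>2 / 2 - (u t x)\<^sup>2 / 2) / h"
  proof (rule bavg_deriv[OF h, where f="\<lambda>x. (u t x)\<^sup>2 / 2"])
    show "((\<lambda>x. (u t x)\<^sup>2 / 2) has_real_derivative u t x * dx u t x) (at x)" for x
      using u_DERIV(2)[OF t, of x] by (auto intro!: derivative_eq_intros)
    show "isCont (\<lambda>x. u t x * dx u t x) x" for x by (intro continuous_intros C11_continuous[OF K])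
  qed
  also have "\<dots> = ((u t (x + h))\<^sup>2 - (u t x)\<^sup>2) / (2 * h)" by (simp add: diff_divide_distrib)
  finally show ?thesis unfolding Lop_bavg[OF h K M] .
qed

text \<open>Weak-* convergence tested with the indicator of [x, x + h]; this is how a weak initial
  condition yields pointwise convergence.\<close>

lemma bavg_initial:
  assumes h: "0 < h"
  shows "((\<lambda>t. bavg h (u t) x) \<longlongrightarrow> bavg h u0 x) (at_right 0)"
proof -
  have eq: "bavg h f x = (1 / h) * (LINT y|lborel. f y * indicator {x..x+h} y)" for f :: "real \<Rightarrow> real"
  proof -
    have "(LINT y|lborel. f y * indicator {x..x+h} y) = (LINT y|lborel. f (y + x) * indicator {x..x+h} (y + x))"
      by (rule integral_shift[symmetric])
    also have "\<dots> = (LINT y|lborel. indicator {0..h} y * f (x + y))"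
      by (intro Bochner_Integration.integral_cong refl) (auto simp: indicator_def add.commute)
    finally show ?thesis by (simp add: bavg_def)
  qed
  have "integrable lborel (indicator {x..x+h} :: real \<Rightarrow> real)" by simp
  then have "((\<lambda>t. LINT y|lborel. u t y * indicator {x..x+h} y) \<longlongrightarrow> (LINT y|lborel. u0 y * indicator {x..x+h} y)) (at_right 0)"
    using sol unfolding is_solution_def by blast
  then show ?thesis unfolding eq by (intro tendsto_mult tendsto_const)
qed

end

text \<open>The integrating factor is at most 1 after time s, and \<beta>' \<ge> 0 allows it to be
  dropped from the forcing. This leaves \<open>\<beta> t - \<beta> s\<close> in closed form instead
  of a weighted integral.\<close>

lemma gronwall_integrated:
  fixes Y Y' \<beta> \<beta>' :: "real \<Rightarrow> real"
  assumes st: "s \<le> t" and l: "0 \<le> l"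
    and Y: "\<And>r. s \<le> r \<Longrightarrow> r \<le> t \<Longrightarrow> (Y has_real_derivative Y' r) (at r)"
    and B: "\<And>r. s \<le> r \<Longrightarrow> r \<le> t \<Longrightarrow> (\<beta> has_real_derivative \<beta>' r) (at r)"
    and le: "\<And>r. s \<le> r \<Longrightarrow> r \<le> t \<Longrightarrow> Y' r \<le> l * Y r + \<beta>' r" and nn: "\<And>r. s \<le> r \<Longrightarrow> r \<le> t \<Longrightarrow> 0 \<le> \<beta>' r"
  shows "Y t \<le> exp (l * (t - s)) * (Y s + \<beta> t - \<beta> s)"
proof -
  define Z where "Z r = exp (- (l * (r - s))) * Y r - \<beta> r" for r
  have "Z t \<le> Z s"
  proof (rule DERIV_nonpos_imp_nonincreasing[OF st])
    fix r assume r: "s \<le> r" "r \<le> t"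
    define E where "E = exp (- (l * (r - s)))"
    have "(Z has_real_derivative E * - (l * (1 - 0)) * Y r + Y' r * E - \<beta>' r) (at r)"
      unfolding Z_def E_def
      by (intro DERIV_diff DERIV_mult Y[OF r] B[OF r] DERIV_chain2[OF DERIV_exp] DERIV_minus DERIV_cmult DERIV_ident DERIV_const)
    moreover have "E * - (l * (1 - 0)) * Y r + Y' r * E - \<beta>' r \<le> 0"
    proof -
      have E: "0 < E" "E \<le> 1" using l r by (auto simp: E_def)
      have "E * (Y' r - l * Y r) \<le> E * \<beta>' r" using le[OF r] E by (intro mult_left_mono) auto
      also have "\<dots> \<le> 1 * \<beta>' r" using E nn[OF r] by (intro mult_right_mono) auto
      finally show ?thesis by (simp add: algebra_simps)
    qed
    ultimately show "\<exists>y. (Z has_real_derivative y) (at r) \<and> y \<le> 0" by blast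
  qed
  then have "exp (- (l * (t - s))) * Y t \<le> Y s + \<beta> t - \<beta> s" by (simp add: Z_def)
  then have "exp (l * (t - s)) * (exp (- (l * (t - s))) * Y t) \<le> exp (l * (t - s)) * (Y s + \<beta> t - \<beta> s)"
    by (intro mult_left_mono) auto
  moreover have "exp (l * (t - s)) * (exp (- (l * (t - s))) * Y t) = Y t"
    by (simp add: mult.assoc[symmetric] exp_add[symmetric])
  ultimately show ?thesis by simp
qed

subsection \<open>Convergence in mean\<close>

lemma le_of_le_add_small:
  fixes A X Z :: real
  assumes "\<And>d. 0 < d \<Longrightarrow> d \<le> 1 \<Longrightarrow> A \<le> X + d * Z"
  shows "A \<le> X"
proof (rule tendsto_lowerbound)
  show "((\<lambda>d. X + d * Z) \<longlongrightarrow> X) (at_right 0)" by (auto intro!: tendsto_eq_intros)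
  show "\<forall>\<^sub>F d in at_right 0. A \<le> X + d * Z"
    unfolding eventually_at_right_field using assms by (intro exI[of _ 1]) auto
qed simp

lemma abs_half_sum_le: "\<bar>(a + b) / 2\<bar> \<le> M" if "\<bar>a\<bar> \<le> M" "\<bar>b\<bar> \<le> M" for a b M :: real
proof -
  have "\<bar>a + b\<bar> \<le> M + M" using that by linarith
  then show ?thesis by simp
qed

text \<open>The initial datum enters through a bound, right continuity at every point and the L^1
  distance to the step between the end states; it is thereby detached from the measure that defines
  it.\<close>

locale rarefaction_approach = frac_burgers \<alpha> u0 u + profile \<alpha> um up
  for \<alpha> :: real and u0 :: "real \<Rightarrow> real" and u :: "real \<Rightarrow> real \<Rightarrow> real" and um up :: real +
  fixes M0 A0 :: real
  assumes u0_measurable [measurable]: "u0 \<in> borel_measurable borel"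
    and u0_bound: "\<And>x. \<bar>u0 x\<bar> \<le> M0"
    and u0_right: "\<And>x. (u0 \<longlongrightarrow> u0 x) (at_right x)"
    and u0_L1: "L1norm (\<lambda>x. u0 x - (if x < 0 then um else up)) \<le> ennreal A0"
    and A0: "0 \<le> A0"
begin

text \<open>The commutator error is bounded both by \<open>r\<^bsup>-1/\<alpha>\<^esup>\<close> and by \<open>h r\<^bsup>-2/\<alpha>\<^esup>\<close>; the geometric mean with exponent
  \<open>\<theta>\<close> gains a power of \<open>h\<close> and remains integrable in time, since \<open>\<omega> < 1\<close>.\<close>

definition \<theta> :: real where "\<theta> = (\<alpha> - 1) / 2"
definition \<omega> :: real where "\<omega> = (1 + \<theta>) / \<alpha>"

lemma \<theta>\<omega>: "0 < \<theta>" "\<theta> < 1" "0 < \<omega>" "\<omega> < 1"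
  using alpha by (auto simp: \<theta>_def \<omega>_def divide_simps)

definition V :: "real \<Rightarrow> real \<Rightarrow> real \<Rightarrow> real" where
  "V h r x = bavg h (u r) x - prof (1 + r) x"
definition V' :: "real \<Rightarrow> real \<Rightarrow> real \<Rightarrow> real" where
  "V' h r x = (u r (x + h) - u r x) / h - prof_x (1 + r) x"
definition Vt :: "real \<Rightarrow> real \<Rightarrow> real \<Rightarrow> real" where
  "Vt h r x = bavg h (dt u r) x - prof_t (1 + r) x"
text \<open>The difference quotient of u^2/2 is the mean of the two end values times the slope of
  the average, whereas transport of the average by itself would have \<open>bavg\<close> in place of
  that mean.\<close>

definition avg_err :: "real \<Rightarrow> real \<Rightarrow> real \<Rightarrow> real" where
  "avg_err h r x = (bavg h (u r) x - (u r (x + h) + u r x) / 2) * ((u r (x + h) - u r x) / h)"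

section \<open>The weighted L^1 estimate for the averaged difference\<close>

context
  fixes T M B :: real
  assumes M: "1 \<le> M" "vmax \<le> M" "\<And>t x. 0 < t \<Longrightarrow> t < T \<Longrightarrow> \<bar>u t x\<bar> \<le> M"
    and B: "0 < B" "\<And>t x y. 0 < t \<Longrightarrow> t < T \<Longrightarrow> \<bar>u t x - u t y\<bar> \<le> B * t powr (- 1 / \<alpha>) * \<bar>x - y\<bar>"
begin

lemma bavg_le_M: "0 < h \<Longrightarrow> 0 < r \<Longrightarrow> r < T \<Longrightarrow> \<bar>bavg h (u r) x\<bar> \<le> M"
  using bavg_bound[OF _ u_measurable M(3)] by blast

lemma prof_le_M: "0 < r \<Longrightarrow> \<bar>prof (1 + r) x\<bar> \<le> M"
  using prof_bounds[of "1 + r" x] M(2) by (auto simp: vmax_def)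

lemma V_bound: "0 < h \<Longrightarrow> 0 < r \<Longrightarrow> r < T \<Longrightarrow> \<bar>V h r x\<bar> \<le> 2 * M"
  using bavg_le_M[of h r x] prof_le_M[of r x] unfolding V_def by linarith

lemma bavg_lip: 
  assumes "0 < h" "0 < r" "r < T"
  shows "\<bar>bavg h (u r) x - u r x\<bar> \<le> B * r powr (- 1 / \<alpha>) * h"
proof (rule bavg_diff_le[OF assms(1) u_measurable[OF assms(2)] M(3)[OF assms(2,3)]])
  fix y assume y: "0 \<le> y" "y \<le> h"
  have "\<bar>u r (x + y) - u r x\<bar> \<le> B * r powr (- 1 / \<alpha>) * \<bar>y\<bar>" using B(2)[OF assms(2,3), of "x+y" x] by simp
  also have "\<dots> \<le> B * r powr (- 1 / \<alpha>) * h" using y B(1) by (intro mult_left_mono) auto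
  finally show "\<bar>u r (x + y) - u r x\<bar> \<le> B * r powr (- 1 / \<alpha>) * h" .
qed

definition cr :: real where "cr = (2 * M) powr (1 - \<theta>) * (2 powr \<theta> * B powr (1 + \<theta>))"

lemma cr_pos: "0 < cr" using M B by (simp add: cr_def)

lemma avg_err_bound:
  assumes h: "0 < h" and r: "0 < r" "r < T"
  shows "\<bar>avg_err h r x\<bar> \<le> cr * h powr \<theta> * r powr (- \<omega>)"
proof -
  define L where "L = B * r powr (- 1 / \<alpha>)"
  have L: "0 < L" using B r by (simp add: L_def)
  define q where "q = bavg h (u r) x - (u r (x + h) + u r x) / 2"
  have d: "\<bar>u r (x + h) - u r x\<bar> \<le> L * h" using B(2)[OF r, of "x+h" x] h by (simp add: L_def)
  have q1: "\<bar>q\<bar> \<le> 2 * M" 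
    using bavg_le_M[OF h r, of x] abs_half_sum_le[OF M(3)[OF r, of "x+h"] M(3)[OF r, of x]] 
      abs_triangle_ineq4[of "bavg h (u r) x" "(u r (x + h) + u r x) / 2"] unfolding q_def by simp
  have qe: "q = (bavg h (u r) x - u r x) - (u r (x + h) - u r x) / 2" by (simp add: q_def field_simps)
  have q2: "\<bar>q\<bar> \<le> 2 * L * h"
  proof -
    have gen: "q \<le> 2 * l" if "q \<le> a + p / 2" "a \<le> l" "p \<le> l" "0 < l" for q a p l :: real using that by linarith
    have "\<bar>q\<bar> \<le> \<bar>bavg h (u r) x - u r x\<bar> + \<bar>(u r (x + h) - u r x) / 2\<bar>"
      unfolding qe by (rule abs_triangle_ineq4)
    also have "\<bar>(u r (x + h) - u r x) / 2\<bar> = \<bar>u r (x + h) - u r x\<bar> / 2" by simp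
    finally show ?thesis using gen[OF _ bavg_lip[OF h r, folded L_def] d mult_pos_pos[OF L h]] by (simp only: mult.assoc)
  qed
  \<comment> \<open>Geometric mean of the two bounds on q with weights 1 - \<theta> and \<theta>.
    The slope adds one more factor L, so L^(1+\<theta>) produces r^(-\<omega>).\<close>
  have q3: "\<bar>q\<bar> \<le> (2 * M) powr (1 - \<theta>) * (2 * L * h) powr \<theta>"
  proof (cases "q = 0")
    case False
    then have "\<bar>q\<bar> = \<bar>q\<bar> powr (1 - \<theta>) * \<bar>q\<bar> powr \<theta>" by (simp add: powr_add[symmetric])
    also have "\<dots> \<le> (2 * M) powr (1 - \<theta>) * (2 * L * h) powr \<theta>"
      using \<theta>\<omega> q1 q2 by (intro mult_mono powr_mono2) auto
    finally show ?thesis .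
  qed auto
  have "\<bar>(u r (x + h) - u r x) / h\<bar> \<le> L" using d h by (simp add: abs_divide divide_le_eq)
  then have "\<bar>avg_err h r x\<bar> \<le> ((2 * M) powr (1 - \<theta>) * (2 * L * h) powr \<theta>) * L"
    unfolding avg_err_def q_def[symmetric] abs_mult using q3 by (intro mult_mono) auto
  also have "(2 * L * h) powr \<theta> = 2 powr \<theta> * L powr \<theta> * h powr \<theta>" using L h by (simp add: powr_mult)
  also have "((2 * M) powr (1 - \<theta>) * (2 powr \<theta> * L powr \<theta> * h powr \<theta>)) * L = 
      (2 * M) powr (1 - \<theta>) * 2 powr \<theta> * h powr \<theta> * L powr (1 + \<theta>)"
    using L by (simp add: powr_add)
  also have "L powr (1 + \<theta>) = B powr (1 + \<theta>) * r powr (- \<omega>)"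
    using B r by (simp add: L_def powr_mult powr_powr \<omega>_def algebra_simps add_divide_distrib)
  finally show ?thesis by (simp add: cr_def algebra_simps)
qed

lemma V_C11:
  assumes h: "0 < h" and r: "0 < r"
  obtains K where "C11 (V h r) (V' h r) K"
proof -
  obtain K where "C11 (u r) (dx u r) K" using u_C11_at[OF r] .
  from C11_diff[OF C11_bavg[OF h this] C11_prof[of "1 + r"]] r
  have "C11 (V h r) (V' h r) (K + 2 * K / h + 1)" unfolding V_def[abs_def] V'_def[abs_def] by simp
  then show thesis by (rule that)
qed

text \<open>As p^2/2 - w^2/2 = b (p - w) with b the mean of p and w, the difference of the average
  and the profile obeys a linear conservative equation with a source, the form treated by
  \<open>kato_static\<close>.\<close>

lemma Vt_eq:
  assumes h: "0 < h" and r: "0 < r" "r < T"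
  defines "b \<equiv> \<lambda>x. (bavg h (u r) x + prof (1 + r) x) / 2"
    and "b' \<equiv> \<lambda>x. ((u r (x + h) - u r x) / h + prof_x (1 + r) x) / 2"
  shows "Vt h r x = CA * Lop (V h r) (V' h r) x - (b' x * V h r x + b x * V' h r x) + (avg_err h r x - prof_err (1 + r) x)"
proof -
  obtain K where K: "C11 (u r) (dx u r) K" using u_C11_at[OF r(1)] .
  have "Lop (V h r) (V' h r) x = Lop (bavg h (u r)) (\<lambda>x. (u r (x + h) - u r x) / h) x - Lop (prof (1 + r)) (prof_x (1 + r)) x"
    unfolding V_def[abs_def] V'_def[abs_def] using r by (intro Lop_diff[OF C11_bavg[OF h K] C11_prof]) auto
  then have "CA * Lop (V h r) (V' h r) x = CA * Lop (bavg h (u r)) (\<lambda>x. (u r (x + h) - u r x) / h) x - CA * Lop (prof (1 + r)) (prof_x (1 + r)) x"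
    by (simp add: right_diff_distrib)
  moreover have "b' x * V h r x + b x * V' h r x = bavg h (u r) x * ((u r (x + h) - u r x) / h) - prof (1 + r) x * prof_x (1 + r) x"
  proof -
    have "(s + q) / 2 * (p - w) + (p + w) / 2 * (s - q) = p * s - w * q" for p w s q :: real by (simp add: field_simps)
    then show ?thesis unfolding b_def b'_def V_def V'_def .
  qed
  moreover have "avg_err h r x = bavg h (u r) x * ((u r (x + h) - u r x) / h) - ((u r (x + h))\<^sup>2 - (u r x)\<^sup>2) / (2 * h)"
    unfolding avg_err_def using h by (simp add: field_simps power2_eq_square)
  ultimately show ?thesis unfolding Vt_def bavg_dt[OF h r(1)] prof_err_def by linarith
qed

definition Yint :: "real \<Rightarrow> real \<Rightarrow> real \<Rightarrow> real \<Rightarrow> real" where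
  "Yint h R d r = (LINT x|lborel. wt R x * eta d (V h r x))"

lemma V_measurable: "0 < r \<Longrightarrow> V h r \<in> borel_measurable borel" "0 < r \<Longrightarrow> V' h r \<in> borel_measurable borel"
  "0 < r \<Longrightarrow> Vt h r \<in> borel_measurable borel" "0 < r \<Longrightarrow> avg_err h r \<in> borel_measurable borel"
proof -
  assume r: "0 < r"
  note [measurable] = u_measurable[OF r] dt_measurable[OF r]
  show "V h r \<in> borel_measurable borel" "V' h r \<in> borel_measurable borel" "Vt h r \<in> borel_measurable borel"
    "avg_err h r \<in> borel_measurable borel"
    unfolding V_def[abs_def] V'_def[abs_def] Vt_def[abs_def] avg_err_def[abs_def] by measurable
qed

lemma eta_V_bound:
  assumes "0 < h" "0 < r" "r < T" "0 < d"
  shows "\<bar>eta d (V h r x)\<bar> \<le> 2 * M + d"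
  using V_bound[OF assms(1-3), of x] eta_ge[OF assms(4), of "V h r x"] eta_le[OF assms(4), of "V h r x"] by linarith

text \<open>Differentiation under the integral: on (r/2, T) the time derivative is bounded, and the
  weight times this bound is an integrable majorant.\<close>

lemma Yint_DERIV:
  assumes h: "0 < h" and r: "0 < r" "r < T" and R: "0 < R" and d: "0 < d"
  shows "(Yint h R d has_real_derivative (LINT x|lborel. wt R x * (eta' d (V h r x) * Vt h r x))) (at r)"
  unfolding Yint_def[abs_def]
proof -
  obtain K where K: "\<And>s x. r/2 < s \<Longrightarrow> s < T \<Longrightarrow> \<bar>dt u s x\<bar> \<le> K"
    by (rule u_C11[of "r/2" T]) (use r in auto)
  define c where "c = \<bar>um\<bar> + \<bar>up\<bar> + (up - um)"
  note [measurable] = wt_measurable[OF R] eta_measurable[OF d] V_measurable[OF r(1)]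
  show "((\<lambda>s. LINT x|lborel. wt R x * eta d (V h s x)) has_real_derivative (LINT x|lborel. wt R x * (eta' d (V h r x) * Vt h r x))) (at r)"
  proof (rule DERIV_integral_dominated[where a="r/2" and b=T and B="\<lambda>x. wt R x * (K + c)"])
    fix s x assume s: "r / 2 < s" "s < T"
    then have s0: "0 < s" using r by simp
    have "((\<lambda>s. bavg h (u s) x - prof (1 + s) x) has_real_derivative bavg h (dt u s) x - prof_t (1 + s) x * (0 + 1)) (at s)"
      by (intro DERIV_diff bavg_time_DERIV[OF h s0] DERIV_chain2[OF prof_DERIV(3)] DERIV_add DERIV_const DERIV_ident) (use s0 in auto)
    then have DV: "((\<lambda>s. V h s x) has_real_derivative Vt h s x) (at s)" by (simp add: V_def Vt_def)
    show "((\<lambda>s. wt R x * eta d (V h s x)) has_real_derivative wt R x * (eta' d (V h s x) * Vt h s x)) (at s)"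
      by (intro DERIV_cmult DERIV_chain2[OF eta_DERIV[OF d] DV])
    have "\<bar>bavg h (dt u s) x\<bar> \<le> K" by (rule bavg_bound[OF h dt_measurable[OF s0] K[OF s]])
    moreover have "\<bar>prof_t (1 + s) x\<bar> \<le> c" unfolding c_def using s0 by (intro prof_t_bound) simp
    ultimately have "\<bar>Vt h s x\<bar> \<le> K + c" unfolding Vt_def by linarith
    then have "\<bar>eta' d (V h s x)\<bar> * \<bar>Vt h s x\<bar> \<le> 1 * (K + c)" by (intro mult_mono eta'_le[OF d]) auto
    then show "\<bar>wt R x * (eta' d (V h s x) * Vt h s x)\<bar> \<le> wt R x * (K + c)"
      using wt_pos[OF R, of x] by (simp add: abs_mult)
  next
    fix s assume s: "r / 2 < s" "s < T"
    then have s0: "0 < s" using r by simp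
    note [measurable] = V_measurable[OF s0]
    show "integrable lborel (\<lambda>x. wt R x * eta d (V h s x))"
      by (rule integrable_wt_mult(1)[OF R _ eta_V_bound[OF h s0 s(2) d]]) measurable
  qed (use r wt_integrable[OF R] in auto)
qed

lemma wt_prof_err:
  assumes r: "0 < r" and R: "0 < R"
  shows "integrable lborel (\<lambda>x. wt R x * \<bar>prof_err (1 + r) x\<bar>)"
    "(LINT x|lborel. wt R x * \<bar>prof_err (1 + r) x\<bar>) \<le> Cw * (1 + r) powr (1 - \<alpha>)"
    "\<bar>prof_err (1 + r) x\<bar> \<le> (\<bar>um\<bar> + \<bar>up\<bar> + (up - um)) + vmax + CA * (2 * 1 * kint)"
proof -
  have r1: "1 \<le> 1 + r" using r by simp
  note C = C11_prof[OF r1]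
  note [measurable] = C11_measurable[OF C] wt_measurable[OF R]
  have [measurable]: "prof_err (1 + r) \<in> borel_measurable borel" unfolding prof_err_def[abs_def] by measurable
  show bd: "\<bar>prof_err (1 + r) x\<bar> \<le> (\<bar>um\<bar> + \<bar>up\<bar> + (up - um)) + vmax + CA * (2 * 1 * kint)" for x
  proof -
    have "\<bar>prof (1 + r) x\<bar> \<le> vmax" using prof_bounds[OF r1, of x] by (auto simp: vmax_def)
    then have "\<bar>prof (1 + r) x * prof_x (1 + r) x\<bar> \<le> vmax * 1"
      unfolding abs_mult using C11D(2)[OF C, of x] by (intro mult_mono) auto
    moreover have "\<bar>CA * Lop (prof (1 + r)) (prof_x (1 + r)) x\<bar> \<le> CA * (2 * 1 * kint)"
      unfolding abs_mult using CA_pos by (intro mult_mono Lop_bound[OF C]) auto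
    ultimately show ?thesis unfolding prof_err_def using prof_t_bound[OF r1, of x] by linarith
  qed
  show i: "integrable lborel (\<lambda>x. wt R x * \<bar>prof_err (1 + r) x\<bar>)"
    by (rule integrable_wt_mult(1)[OF R, of _ "(\<bar>um\<bar> + \<bar>up\<bar> + (up - um)) + vmax + CA * (2 * 1 * kint)"]) (use bd in auto)
  have "ennreal (LINT x|lborel. wt R x * \<bar>prof_err (1 + r) x\<bar>) = (\<integral>\<^sup>+x. ennreal (wt R x * \<bar>prof_err (1 + r) x\<bar>) \<partial>lborel)"
    using wt_pos[OF R] by (intro nn_integral_eq_integral[symmetric] i AE_I2) (simp add: less_imp_le)
  also have "\<dots> \<le> L1norm (\<lambda>x. prof_err (1 + r) x)"
    using wt_le_1[OF R] wt_pos[OF R] by (intro nn_integral_mono ennreal_leI mult_left_le_one_le) (auto simp: less_imp_le)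
  also have "\<dots> \<le> ennreal (Cw * (1 + r) powr (1 - \<alpha>))" by (rule prof_err_L1[OF r1])
  finally show "(LINT x|lborel. wt R x * \<bar>prof_err (1 + r) x\<bar>) \<le> Cw * (1 + r) powr (1 - \<alpha>)"
    using Cw_pos by (subst (asm) ennreal_le_iff) (auto simp: less_imp_le)
qed

text \<open>The bound \<open>M / h + 1\<close> on the slope of the mean velocity blows up as h tends
  to 0. It occurs only with the factor d, which is why d is removed while h is still fixed.\<close>

lemma Yint_ineq:
  assumes h: "0 < h" and r: "0 < r" "r < T" and R: "0 < R" and d: "0 < d"
  defines "W \<equiv> (LINT x|lborel. wt R x)"
  shows "(LINT x|lborel. wt R x * (eta' d (V h r x) * Vt h r x)) \<le> M / R * Yint h R d r +
    (CA * (2 * M + d) * (12 * pi * kint * R powr (1 - \<alpha>)) + d * (M / h + 1) * W + cr * h powr \<theta> * W * r powr (- \<omega>)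
     + Cw * (1 + r) powr (1 - \<alpha>))"
proof -
  define b where "b x = (bavg h (u r) x + prof (1 + r) x) / 2" for x
  define b' where "b' x = ((u r (x + h) - u r x) / h + prof_x (1 + r) x) / 2" for x
  define e where "e x = avg_err h r x - prof_err (1 + r) x" for x
  have r1: "1 \<le> 1 + r" "0 < 1 + r" using r by auto
  note [measurable] = V_measurable[OF r(1)] wt_measurable[OF R]
  have [measurable]: "prof_err (1 + r) \<in> borel_measurable borel" unfolding prof_err_def[abs_def] by measurable
  obtain K where K: "C11 (V h r) (V' h r) K" using V_C11[OF h r(1)] .
  define cc where "cc = cr * h powr \<theta> * r powr (- \<omega>)"
  define ge where "ge = (\<bar>um\<bar> + \<bar>up\<bar> + (up - um)) + vmax + CA * (2 * 1 * kint)"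
  have eb: "\<bar>e x\<bar> \<le> cc + \<bar>prof_err (1 + r) x\<bar>" for x
    using avg_err_bound[OF h r, of x] unfolding e_def cc_def by linarith
  have eb2: "\<bar>e x\<bar> \<le> cc + ge" for x using eb[of x] wt_prof_err(3)[OF r(1) R, of x] unfolding ge_def by linarith
  have emeas: "e \<in> borel_measurable borel" unfolding e_def[abs_def] by measurable
  have "(LINT x|lborel. wt R x * (eta' d (V h r x) * Vt h r x)) \<le> 
    CA * (2 * M + d) * (12 * pi * kint * R powr (1 - \<alpha>)) + M / R * (LINT x|lborel. wt R x * eta d (V h r x))
    + d * (M / h + 1) * (LINT x|lborel. wt R x) + (LINT x|lborel. wt R x * \<bar>e x\<bar>)"
  proof (rule kato_static[OF R d K V_bound[OF h r], where b=b and b'=b' and e=e])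
    show "(b has_real_derivative b' x) (at x)" for x
      unfolding b_def b'_def
      by (intro DERIV_cdivide DERIV_add bavg_DERIV[OF h u_isCont[OF r(1)]] prof_DERIV(1)[OF r1(2)])
    show "isCont b' x" for x
    proof -
      have "isCont (\<lambda>x. u r (x + h)) x" by (intro isCont_o2[of x "\<lambda>x. x + h" "u r"] u_isCont r) auto
      then show ?thesis unfolding b'_def using h by (intro continuous_intros u_isCont r C11_continuous(2)[OF C11_prof[OF r1(1)]]) auto
    qed
    show "\<bar>b x\<bar> \<le> M" for x using abs_half_sum_le[OF bavg_le_M[OF h r, of x] prof_le_M[OF r(1), of x]] unfolding b_def .
    show "\<bar>b' x\<bar> \<le> M / h + 1" for x
    proof -
      have m2: "2 * M / h = 2 * (M / h)" by simp
      have "\<bar>u r (x + h) - u r x\<bar> \<le> 2 * M" using M(3)[OF r, of x] M(3)[OF r, of "x+h"] by linarith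
      then have "\<bar>(u r (x + h) - u r x) / h\<bar> \<le> 2 * M / h" using h by (simp add: abs_divide divide_right_mono)
      moreover have "\<bar>prof_x (1 + r) x\<bar> \<le> 1" by (rule C11D(2)[OF C11_prof[OF r1(1)]])
      moreover have "c \<le> 2 * (m + 1)" if "a \<le> 2 * m" "b \<le> 1" "c \<le> a + b" for a b c m :: real using that by (simp add: distrib_left)
      ultimately have "\<bar>(u r (x + h) - u r x) / h + prof_x (1 + r) x\<bar> \<le> 2 * (M / h + 1)"
        using abs_triangle_ineq[of "(u r (x + h) - u r x) / h" "prof_x (1 + r) x"] unfolding m2 by blast
      moreover have "\<bar>p / 2\<bar> \<le> y" if "\<bar>p\<bar> \<le> 2 * y" for p y :: real using that by simp
      ultimately show ?thesis unfolding b'_def by blast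
    qed
    show "Vt h r x = CA * Lop (V h r) (V' h r) x - (b' x * V h r x + b x * V' h r x) + e x" for x
      unfolding e_def b_def b'_def by (rule Vt_eq[OF h r])
  qed (rule emeas eb2)+
  moreover have "(LINT x|lborel. wt R x * \<bar>e x\<bar>) \<le> (LINT x|lborel. cc * wt R x + wt R x * \<bar>prof_err (1 + r) x\<bar>)"
  proof (intro integral_mono)
    show "integrable lborel (\<lambda>x. wt R x * \<bar>e x\<bar>)"
      by (rule integrable_wt_mult(1)[OF R, of _ "cc + ge"]) (use emeas eb2 in auto)
    show "integrable lborel (\<lambda>x. cc * wt R x + wt R x * \<bar>prof_err (1 + r) x\<bar>)"
      by (intro Bochner_Integration.integrable_add integrable_mult_right wt_integrable[OF R] wt_prof_err(1)[OF r(1) R])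
    show "wt R x * \<bar>e x\<bar> \<le> cc * wt R x + wt R x * \<bar>prof_err (1 + r) x\<bar>" for x
      using mult_left_mono[OF eb[of x] less_imp_le[OF wt_pos[OF R, of x]]] by (simp add: algebra_simps)
  qed
  moreover have "(LINT x|lborel. cc * wt R x + wt R x * \<bar>prof_err (1 + r) x\<bar>) = cc * W + (LINT x|lborel. wt R x * \<bar>prof_err (1 + r) x\<bar>)"
    unfolding W_def using wt_integrable[OF R] wt_prof_err(1)[OF r(1) R] by simp
  moreover have "cc * W = cr * h powr \<theta> * W * r powr (- \<omega>)" by (simp add: cc_def)
  ultimately show ?thesis using wt_prof_err(2)[OF r(1) R] unfolding W_def Yint_def by linarith
qed

text \<open>An antiderivative of the forcing for d = 0. The first term vanishes as R grows, the
  second as h tends to 0; the third, the integrated residual of the profile, survives and sets the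
  growth t^(2-\<alpha>).\<close>

definition rest :: "real \<Rightarrow> real \<Rightarrow> real \<Rightarrow> real" where
  "rest h R t = CA * (2 * M) * (12 * pi * kint * R powr (1 - \<alpha>)) * t 
     + cr * h powr \<theta> * (LINT x|lborel. wt R x) * (t powr (1 - \<omega>) / (1 - \<omega>)) + Cw * ((1 + t) powr (2 - \<alpha>) / (2 - \<alpha>))"

text \<open>Gronwall from a positive time s, where the solution is smooth, with d sent to 0 at the
  end. The time span t - s in the exponent is enlarged to t, so that the factor does not depend on
  s.\<close>

lemma kato_h:
  assumes h: "0 < h" and st: "0 < s" "s \<le> t" "t < T" and R: "0 < R"
  shows "(LINT x|lborel. wt R x * \<bar>V h t x\<bar>) \<le> exp (M / R * t) * ((LINT x|lborel. wt R x * \<bar>V h s x\<bar>) + rest h R t)"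
proof -
  define W where "W = (LINT x|lborel. wt R x)"
  have W: "0 \<le> W" unfolding W_def using wt_pos[OF R] by (intro Bochner_Integration.integral_nonneg) (simp add: less_imp_le)
  have t0: "0 < t" and sT: "s < T" using st by auto
  define k1 where "k1 = 12 * pi * kint * R powr (1 - \<alpha>)"
  have k1: "0 \<le> k1" using kint_nonneg by (simp add: k1_def)
  have lam: "0 \<le> M / R" using M R by simp
  define E where "E = exp (M / R * t)"
  have E: "0 < E" by (simp add: E_def)
  \<comment> \<open>Collects all contributions of first order in d: W from replacing
    \<open>eta\<close> by the absolute value at time s, the rest from the forcing.\<close>
  define Z where "Z = W + (CA * k1 + (M / h + 1) * W) * t"
  have iV: "integrable lborel (\<lambda>x. wt R x * \<bar>V h r x\<bar>)" if "0 < r" "r < T" for r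
    by (rule integrable_wt_mult(1)[OF R, of _ "2 * M"]) (use V_measurable(1)[OF that(1)] V_bound[OF h that] in auto)
  have ieta: "integrable lborel (\<lambda>x. wt R x * eta d (V h r x))" if "0 < r" "r < T" "0 < d" for r d
  proof -
    note [measurable] = V_measurable(1)[OF that(1)] eta_measurable[OF that(3)]
    show ?thesis by (rule integrable_wt_mult(1)[OF R _ eta_V_bound[OF h that]]) measurable
  qed
  have "(LINT x|lborel. wt R x * \<bar>V h t x\<bar>) \<le> E * ((LINT x|lborel. wt R x * \<bar>V h s x\<bar>) + rest h R t) + d * (E * Z)"
    if d: "0 < d" "d \<le> 1" for d
  proof -
    define \<beta> where "\<beta> r = (CA * (2 * M + d) * k1 + d * (M / h + 1) * W) * r 
       + cr * h powr \<theta> * W * (r powr (1 - \<omega>) / (1 - \<omega>)) + Cw * ((1 + r) powr (2 - \<alpha>) / (2 - \<alpha>))" for r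
    define \<beta>' where "\<beta>' r = CA * (2 * M + d) * k1 + d * (M / h + 1) * W + cr * h powr \<theta> * W * r powr (- \<omega>)
     + Cw * (1 + r) powr (1 - \<alpha>)" for r
    have "Yint h R d t \<le> exp (M / R * (t - s)) * (Yint h R d s + \<beta> t - \<beta> s)"
    proof (rule gronwall_integrated[OF st(2) lam])
      fix r assume rs: "s \<le> r" "r \<le> t"
      have r: "0 < r" "r < T" using rs st by auto
      show "(Yint h R d has_real_derivative (LINT x|lborel. wt R x * (eta' d (V h r x) * Vt h r x))) (at r)"
        by (rule Yint_DERIV[OF h r R d(1)])
      show "(LINT x|lborel. wt R x * (eta' d (V h r x) * Vt h r x)) \<le> M / R * Yint h R d r + \<beta>' r"
        using Yint_ineq[OF h r R d(1)] by (simp only: \<beta>'_def W_def k1_def)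
      have "((\<lambda>r. (CA * (2 * M + d) * k1 + d * (M / h + 1) * W) * r 
         + cr * h powr \<theta> * W * (r powr (1 - \<omega>) / (1 - \<omega>)) + Cw * ((1 + r) powr (2 - \<alpha>) / (2 - \<alpha>))) has_real_derivative
        (CA * (2 * M + d) * k1 + d * (M / h + 1) * W) * 1 + cr * h powr \<theta> * W * ((1 - \<omega>) * r powr (1 - \<omega> - 1) / (1 - \<omega>)) 
         + Cw * ((2 - \<alpha>) * (1 + r) powr (2 - \<alpha> - 1) * (0 + 1) / (2 - \<alpha>))) (at r)"
        by (intro DERIV_add DERIV_cmult DERIV_cdivide DERIV_ident has_real_derivative_powr DERIV_chain2[OF has_real_derivative_powr] DERIV_const)
          (use r in auto)
      then show "(\<beta> has_real_derivative \<beta>' r) (at r)"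
        using \<theta>\<omega> alpha by (simp add: \<beta>_def[abs_def] \<beta>'_def)
      show "0 \<le> \<beta>' r"
        unfolding \<beta>'_def using CA_pos M d k1 W h cr_pos Cw_pos
        by (intro add_nonneg_nonneg mult_nonneg_nonneg) (auto simp: less_imp_le)
    qed
    also have "\<dots> \<le> exp (M / R * (t - s)) * (Yint h R d s + \<beta> t)"
    proof -
      have "0 \<le> \<beta> s" unfolding \<beta>_def using CA_pos M d k1 W h cr_pos Cw_pos \<theta>\<omega> alpha st
        by (intro add_nonneg_nonneg mult_nonneg_nonneg) (auto simp: less_imp_le)
      then show ?thesis by (intro mult_left_mono) auto
    qed
    also have "\<dots> \<le> E * (Yint h R d s + \<beta> t)"
    proof (intro mult_right_mono)
      have "M / R * (t - s) \<le> M / R * t" using lam st by (intro mult_left_mono) auto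
      then show "exp (M / R * (t - s)) \<le> E" unfolding E_def by simp
      have "0 \<le> \<beta> t" unfolding \<beta>_def using CA_pos M d k1 W h cr_pos Cw_pos \<theta>\<omega> alpha t0
        by (intro add_nonneg_nonneg mult_nonneg_nonneg) (auto simp: less_imp_le)
      moreover have "0 \<le> Yint h R d s"
        unfolding Yint_def using wt_pos[OF R] eta_ge[OF d(1)] 
        by (intro Bochner_Integration.integral_nonneg mult_nonneg_nonneg) (auto simp: less_imp_le intro: order_trans[OF abs_ge_zero])
      ultimately show "0 \<le> Yint h R d s + \<beta> t" by simp
    qed
    also have "\<dots> \<le> E * (((LINT x|lborel. wt R x * \<bar>V h s x\<bar>) + d * W) + (rest h R t + d * ((CA * k1 + (M / h + 1) * W) * t)))"
    proof (intro mult_left_mono add_mono)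
      have "Yint h R d s \<le> (LINT x|lborel. wt R x * \<bar>V h s x\<bar> + d * wt R x)"
        unfolding Yint_def
      proof (intro integral_mono ieta[OF st(1) sT d(1)])
        show "integrable lborel (\<lambda>x. wt R x * \<bar>V h s x\<bar> + d * wt R x)"
          by (intro Bochner_Integration.integrable_add iV[OF st(1) sT] integrable_mult_right wt_integrable[OF R])
        show "wt R x * eta d (V h s x) \<le> wt R x * \<bar>V h s x\<bar> + d * wt R x" for x
          using mult_left_mono[OF eta_le[OF d(1), of "V h s x"] less_imp_le[OF wt_pos[OF R, of x]]] by (simp add: algebra_simps)
      qed
      also have "\<dots> = (LINT x|lborel. wt R x * \<bar>V h s x\<bar>) + d * W"
        unfolding W_def using iV[OF st(1) sT] wt_integrable[OF R] by simp
      finally show "Yint h R d s \<le> (LINT x|lborel. wt R x * \<bar>V h s x\<bar>) + d * W" .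
      have "\<beta> t = rest h R t + d * ((CA * k1 + (M / h + 1) * W) * t)"
        unfolding \<beta>_def rest_def W_def[symmetric] k1_def[symmetric] by (simp add: algebra_simps)
      then show "\<beta> t \<le> rest h R t + d * ((CA * k1 + (M / h + 1) * W) * t)" by simp
    qed (use E in simp)
    also have "\<dots> = E * ((LINT x|lborel. wt R x * \<bar>V h s x\<bar>) + rest h R t) + d * (E * Z)"
      unfolding Z_def by (simp add: algebra_simps)
    finally have "Yint h R d t \<le> E * ((LINT x|lborel. wt R x * \<bar>V h s x\<bar>) + rest h R t) + d * (E * Z)" .
    moreover have "(LINT x|lborel. wt R x * \<bar>V h t x\<bar>) \<le> Yint h R d t"
      unfolding Yint_def
      by (intro integral_mono ieta[OF t0 st(3) d(1)] iV[OF t0 st(3)] mult_left_mono eta_ge[OF d(1)]) 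
        (use wt_pos[OF R] in \<open>auto simp: less_imp_le\<close>)
    ultimately show ?thesis by simp
  qed
  then show ?thesis unfolding E_def by (rule le_of_le_add_small)
qed

end
end

section \<open>Removal of the initial time, the averaging width and the weight\<close>

context rarefaction_approach
begin

lemma bavg_u0_tendsto: "(\<lambda>n. bavg (1 / real (Suc n)) u0 x) \<longlonglongrightarrow> u0 x"
proof (rule LIMSEQ_I)
  fix e :: real assume e: "0 < e"
  have "\<forall>\<^sub>F y in at_right x. dist (u0 y) (u0 x) < e / 2"
    using tendstoD[OF u0_right[of x], of "e / 2"] e by simp
  then obtain b where b: "x < b" "\<And>y. x < y \<Longrightarrow> y < b \<Longrightarrow> dist (u0 y) (u0 x) < e / 2"
    unfolding eventually_at_right_field by blast
  obtain N where N: "1 / real (Suc N) < b - x" using b(1) nat_approx_posE[of "b - x"] by auto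
  show "\<exists>no. \<forall>n\<ge>no. norm (bavg (1 / real (Suc n)) u0 x - u0 x) < e"
  proof (intro exI[of _ N] allI impI)
    fix n assume n: "N \<le> n"
    have h: "0 < 1 / real (Suc n)" by simp
    have hb: "1 / real (Suc n) < b - x"
      by (rule le_less_trans[OF _ N]) (use n in \<open>simp add: frac_le\<close>)
    have "\<bar>bavg (1 / real (Suc n)) u0 x - u0 x\<bar> \<le> e / 2"
    proof (rule bavg_diff_le[OF h u0_measurable u0_bound])
      fix y assume "0 \<le> y" "y \<le> 1 / real (Suc n)"
      then show "\<bar>u0 (x + y) - u0 x\<bar> \<le> e / 2"
        using b(2)[of "x + y"] hb e by (cases "y = 0") (auto simp: dist_real_def less_imp_le)
    qed
    then show "norm (bavg (1 / real (Suc n)) u0 x - u0 x) < e" using e by simp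
  qed
qed

lemma prof_time_tendsto: "(\<lambda>n. prof (1 + s n) x) \<longlonglongrightarrow> prof 1 x" if "s \<longlonglongrightarrow> 0"
proof -
  have "isCont (\<lambda>\<tau>. prof \<tau> x) 1" using prof_DERIV(3)[of 1 x] by (intro DERIV_isCont) auto
  moreover have "(\<lambda>n. 1 + s n) \<longlonglongrightarrow> 1" using tendsto_add[OF tendsto_const that, of 1] by simp
  ultimately show ?thesis by (rule isCont_tendsto_compose)
qed

lemma wt_dominated_limit:
  assumes R: "0 < R" and m: "\<And>n. f n \<in> borel_measurable borel" "g \<in> borel_measurable borel"
    and lim: "\<And>x. (\<lambda>n. f n x) \<longlonglongrightarrow> g x" and K: "\<And>n x. \<bar>f n x\<bar> \<le> K"
  shows "(\<lambda>n. LINT x|lborel. wt R x * \<bar>f n x\<bar>) \<longlonglongrightarrow> (LINT x|lborel. wt R x * \<bar>g x\<bar>)"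
proof (rule integral_dominated_convergence[where w="\<lambda>x. wt R x * K"])
  note [measurable] = wt_measurable[OF R] m
  show "(\<lambda>x. wt R x * \<bar>g x\<bar>) \<in> borel_measurable lborel" by measurable
  show "(\<lambda>x. wt R x * \<bar>f n x\<bar>) \<in> borel_measurable lborel" for n by measurable
  show "integrable lborel (\<lambda>x. wt R x * K)" using wt_integrable[OF R] by simp
  show "AE x in lborel. (\<lambda>n. wt R x * \<bar>f n x\<bar>) \<longlonglongrightarrow> wt R x * \<bar>g x\<bar>"
    by (intro AE_I2 tendsto_mult tendsto_const tendsto_rabs lim)
  show "AE x in lborel. norm (wt R x * \<bar>f n x\<bar>) \<le> wt R x * K" for n
    using wt_pos[OF R] K by (auto simp: abs_mult less_imp_le intro!: mult_left_mono AE_I2)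
qed

definition A1 :: real where "A1 = A0 + (8 + 2 * vmax * (up - um))"

lemma A1_nonneg: "0 \<le> A1"
  using A0 um_up unfolding A1_def by (auto simp: vmax_def intro!: add_nonneg_nonneg mult_nonneg_nonneg)

lemma initial_L1: "L1norm (\<lambda>x. u0 x - prof 1 x) \<le> ennreal A1"
proof -
  let ?s = "\<lambda>x::real. if x < 0 then um else up"
  have v: "0 \<le> vmax" by (auto simp: vmax_def)
  have "L1norm (\<lambda>x. u0 x - prof 1 x) \<le> (\<integral>\<^sup>+x. ennreal \<bar>u0 x - ?s x\<bar> + ennreal \<bar>prof 1 x - ?s x\<bar> \<partial>lborel)"
  proof (intro nn_integral_mono)
    fix x
    have "\<bar>u0 x - prof 1 x\<bar> \<le> \<bar>u0 x - ?s x\<bar> + \<bar>prof 1 x - ?s x\<bar>" by linarith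
    then show "ennreal \<bar>u0 x - prof 1 x\<bar> \<le> ennreal \<bar>u0 x - ?s x\<bar> + ennreal \<bar>prof 1 x - ?s x\<bar>"
      by (simp add: ennreal_plus[symmetric] ennreal_leI del: ennreal_plus)
  qed
  also have "\<dots> = L1norm (\<lambda>x. u0 x - ?s x) + L1norm (\<lambda>x. prof 1 x - ?s x)"
    by (rule nn_integral_add) measurable
  also have "\<dots> \<le> ennreal A0 + ennreal (8 + 2 * vmax * (up - um))"
    by (intro add_mono u0_L1 prof_step_L1)
  also have "\<dots> = ennreal A1"
    unfolding A1_def using A0 v um_up by (intro ennreal_plus[symmetric]) auto
  finally show ?thesis .
qed

text \<open>The limit s to 0. The averages converge pointwise and the weight times 2 M dominates, so
  the weighted norms converge to that of the averaged initial difference.\<close>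

lemma kato_initial:
  assumes M: "1 \<le> M" "vmax \<le> M" "\<And>t x. 0 < t \<Longrightarrow> t < T \<Longrightarrow> \<bar>u t x\<bar> \<le> M"
    and B: "0 < B" "\<And>t x y. 0 < t \<Longrightarrow> t < T \<Longrightarrow> \<bar>u t x - u t y\<bar> \<le> B * t powr (- 1 / \<alpha>) * \<bar>x - y\<bar>"
    and h: "0 < h" and t: "0 < t" "t < T" and R: "0 < R"
  shows "(LINT x|lborel. wt R x * \<bar>V h t x\<bar>) \<le> 
    exp (M / R * t) * ((LINT x|lborel. wt R x * \<bar>bavg h u0 x - prof 1 x\<bar>) + rest M B h R t)"
proof -
  define s where "s n = t / real (Suc n)" for n
  have s: "0 < s n" "s n \<le> t" for n using t by (auto simp: s_def divide_le_eq)
  have s0: "s \<longlonglongrightarrow> 0" unfolding s_def by real_asymp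
  have sr: "filterlim s (at_right 0) sequentially"
    unfolding filterlim_at using s0 s(1) by (auto simp: less_imp_neq[OF s(1), symmetric])
  have "(\<lambda>n. LINT x|lborel. wt R x * \<bar>V h (s n) x\<bar>) \<longlonglongrightarrow> (LINT x|lborel. wt R x * \<bar>bavg h u0 x - prof 1 x\<bar>)"
  proof (rule wt_dominated_limit[OF R])
    show "V h (s n) \<in> borel_measurable borel" for n by (rule V_measurable(1)[OF M B s(1)])
    show "(\<lambda>x. bavg h u0 x - prof 1 x) \<in> borel_measurable borel" by measurable
    show "\<bar>V h (s n) x\<bar> \<le> 2 * M" for n x
      by (rule V_bound[OF M B h s(1)]) (use s(2)[of n] t in auto)
    show "(\<lambda>n. V h (s n) x) \<longlonglongrightarrow> bavg h u0 x - prof 1 x" for x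
      unfolding V_def
      by (intro tendsto_diff prof_time_tendsto s0 filterlim_compose[OF bavg_initial[OF h] sr])
  qed
  then have "(\<lambda>n. exp (M / R * t) * ((LINT x|lborel. wt R x * \<bar>V h (s n) x\<bar>) + rest M B h R t)) \<longlonglongrightarrow>
     exp (M / R * t) * ((LINT x|lborel. wt R x * \<bar>bavg h u0 x - prof 1 x\<bar>) + rest M B h R t)"
    by (intro tendsto_intros)
  then show ?thesis
    by (rule LIMSEQ_le_const) (use kato_h[OF M B h s(1) s(2) t(2) R] in blast)
qed

text \<open>The limit h to 0 for fixed R: at time t through the Lipschitz bound, at time 0 through
  right continuity, while the commutator vanishes with h^\<theta>.\<close>

lemma kato_weighted:
  assumes M: "1 \<le> M" "vmax \<le> M" "\<And>t x. 0 < t \<Longrightarrow> t < T \<Longrightarrow> \<bar>u t x\<bar> \<le> M"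
    and B: "0 < B" "\<And>t x y. 0 < t \<Longrightarrow> t < T \<Longrightarrow> \<bar>u t x - u t y\<bar> \<le> B * t powr (- 1 / \<alpha>) * \<bar>x - y\<bar>"
    and t: "0 < t" "t < T" and R: "0 < R"
  shows "(LINT x|lborel. wt R x * \<bar>u t x - prof (1 + t) x\<bar>) \<le> 
    exp (M / R * t) * (A1 + (CA * (2 * M) * (12 * pi * kint * R powr (1 - \<alpha>)) * t + Cw * ((1 + t) powr (2 - \<alpha>) / (2 - \<alpha>))))"
proof -
  define h where "h n = 1 / real (Suc n)" for n
  have h: "0 < h n" for n by (simp add: h_def)
  have h0: "h \<longlonglongrightarrow> 0" unfolding h_def by real_asymp
  define I0 where "I0 = (LINT x|lborel. wt R x * \<bar>u0 x - prof 1 x\<bar>)"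
  define q where "q = CA * (2 * M) * (12 * pi * kint * R powr (1 - \<alpha>)) * t + Cw * ((1 + t) powr (2 - \<alpha>) / (2 - \<alpha>))"
  note [measurable] = u_measurable[OF t(1)]
  have l1: "(\<lambda>n. LINT x|lborel. wt R x * \<bar>V (h n) t x\<bar>) \<longlonglongrightarrow> (LINT x|lborel. wt R x * \<bar>u t x - prof (1 + t) x\<bar>)"
  proof (rule wt_dominated_limit[OF R])
    show "V (h n) t \<in> borel_measurable borel" for n by (rule V_measurable(1)[OF M B t(1)])
    show "(\<lambda>x. u t x - prof (1 + t) x) \<in> borel_measurable borel" by measurable
    show "\<bar>V (h n) t x\<bar> \<le> 2 * M" for n x by (rule V_bound[OF M B h t])
    show "(\<lambda>n. V (h n) t x) \<longlonglongrightarrow> u t x - prof (1 + t) x" for x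
      unfolding V_def
    proof (intro tendsto_diff tendsto_const)
      show "(\<lambda>n. bavg (h n) (u t) x) \<longlonglongrightarrow> u t x"
      proof (rule LIM_zero_cancel, rule Lim_null_comparison)
        show "\<forall>\<^sub>F n in sequentially. norm (bavg (h n) (u t) x - u t x) \<le> B * t powr (- 1 / \<alpha>) * h n"
          using bavg_lip[OF M B h t] by simp
        show "(\<lambda>n. B * t powr (- 1 / \<alpha>) * h n) \<longlonglongrightarrow> 0" using tendsto_mult_right_zero[OF h0] .
      qed
    qed
  qed
  have l2: "(\<lambda>n. LINT x|lborel. wt R x * \<bar>bavg (h n) u0 x - prof 1 x\<bar>) \<longlonglongrightarrow> I0"
    unfolding I0_def
  proof (rule wt_dominated_limit[OF R])
    show "(\<lambda>x. bavg (h n) u0 x - prof 1 x) \<in> borel_measurable borel" for n by measurable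
    show "(\<lambda>x. u0 x - prof 1 x) \<in> borel_measurable borel" by measurable
    show "\<bar>bavg (h n) u0 x - prof 1 x\<bar> \<le> M0 + vmax" for n x
      using bavg_bound[OF h u0_measurable u0_bound, of n x] prof_bounds[of 1 x] by (auto simp: vmax_def)
    show "(\<lambda>n. bavg (h n) u0 x - prof 1 x) \<longlonglongrightarrow> u0 x - prof 1 x" for x
      unfolding h_def by (intro tendsto_diff tendsto_const bavg_u0_tendsto)
  qed
  have l3: "(\<lambda>n. rest M B (h n) R t) \<longlonglongrightarrow> q"
  proof -
    have "(\<lambda>n. h n powr \<theta>) \<longlonglongrightarrow> 0"
      using tendsto_powr'[OF h0 tendsto_const, of \<theta>] \<theta>\<omega> h by (simp add: less_imp_le)
    then have "(\<lambda>n. CA * (2 * M) * (12 * pi * kint * R powr (1 - \<alpha>)) * t 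
       + cr M B * h n powr \<theta> * (LINT x|lborel. wt R x) * (t powr (1 - \<omega>) / (1 - \<omega>)) + Cw * ((1 + t) powr (2 - \<alpha>) / (2 - \<alpha>))) \<longlonglongrightarrow>
       CA * (2 * M) * (12 * pi * kint * R powr (1 - \<alpha>)) * t 
       + cr M B * 0 * (LINT x|lborel. wt R x) * (t powr (1 - \<omega>) / (1 - \<omega>)) + Cw * ((1 + t) powr (2 - \<alpha>) / (2 - \<alpha>))"
      by (intro tendsto_intros)
    moreover have "rest M B (h n) R t = CA * (2 * M) * (12 * pi * kint * R powr (1 - \<alpha>)) * t 
       + cr M B * h n powr \<theta> * (LINT x|lborel. wt R x) * (t powr (1 - \<omega>) / (1 - \<omega>)) + Cw * ((1 + t) powr (2 - \<alpha>) / (2 - \<alpha>))" for n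
      by (rule rest_def[OF M B])
    ultimately show ?thesis unfolding q_def by simp
  qed
  have "(LINT x|lborel. wt R x * \<bar>u t x - prof (1 + t) x\<bar>) \<le> exp (M / R * t) * (I0 + q)"
  proof (rule LIMSEQ_le[OF l1])
    show "(\<lambda>n. exp (M / R * t) * ((LINT x|lborel. wt R x * \<bar>bavg (h n) u0 x - prof 1 x\<bar>) + rest M B (h n) R t)) \<longlonglongrightarrow>
       exp (M / R * t) * (I0 + q)" by (intro tendsto_intros l2 l3)
    show "\<exists>N. \<forall>n\<ge>N. (LINT x|lborel. wt R x * \<bar>V (h n) t x\<bar>) \<le> 
       exp (M / R * t) * ((LINT x|lborel. wt R x * \<bar>bavg (h n) u0 x - prof 1 x\<bar>) + rest M B (h n) R t)"
      using kato_initial[OF M B h t R] by blast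
  qed
  also have "\<dots> \<le> exp (M / R * t) * (A1 + q)"
  proof (intro mult_left_mono add_right_mono)
    note [measurable] = wt_measurable[OF R]
    have i: "integrable lborel (\<lambda>x. wt R x * \<bar>u0 x - prof 1 x\<bar>)"
    proof (rule integrable_wt_mult(1)[OF R])
      show "\<bar>\<bar>u0 x - prof 1 x\<bar>\<bar> \<le> M0 + vmax" for x
        using u0_bound[of x] prof_bounds[of 1 x] by (auto simp: vmax_def)
    qed measurable
    have "ennreal I0 = (\<integral>\<^sup>+x. ennreal (wt R x * \<bar>u0 x - prof 1 x\<bar>) \<partial>lborel)"
      unfolding I0_def using wt_pos[OF R] by (intro nn_integral_eq_integral[symmetric] i AE_I2) (simp add: less_imp_le)
    also have "\<dots> \<le> L1norm (\<lambda>x. u0 x - prof 1 x)"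
      using wt_le_1[OF R] wt_pos[OF R] by (intro nn_integral_mono ennreal_leI mult_left_le_one_le) (auto simp: less_imp_le)
    also have "\<dots> \<le> ennreal A1" by (rule initial_L1)
    finally show "I0 \<le> A1" using A1_nonneg by (subst (asm) ennreal_le_iff) auto
  qed simp
  finally show ?thesis unfolding q_def .
qed

lemma wt_mono: "0 < R \<Longrightarrow> R \<le> S \<Longrightarrow> wt R x \<le> wt S x"
proof -
  assume R: "0 < R" "R \<le> S"
  have "R\<^sup>2 * x\<^sup>2 \<le> S\<^sup>2 * x\<^sup>2" using R by (intro mult_right_mono power_mono) auto
  then have "R\<^sup>2 * (S\<^sup>2 + x\<^sup>2) \<le> S\<^sup>2 * (R\<^sup>2 + x\<^sup>2)" by (simp add: algebra_simps)
  then show ?thesis unfolding wt_def using wt_den[of R x] wt_den[of S x] R by (intro frac_le_eq[THEN iffD2] | simp add: divide_le_eq le_divide_eq mult.commute)+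
qed

text \<open>The limit of large R: exp(M t / R) tends to 1 and R^(1-\<alpha>) to 0. As the weights
  increase to 1, monotone convergence yields finiteness of the norm together with its bound.\<close>

theorem L1_profile:
  assumes t: "0 < t"
  shows "L1norm (\<lambda>x. u t x - prof (1 + t) x) \<le> ennreal (A1 + Cw * ((1 + t) powr (2 - \<alpha>) / (2 - \<alpha>)))"
proof -
  define T where "T = t + 1"
  obtain M' where M': "1 \<le> M'" "\<And>t x. 0 < t \<Longrightarrow> t < T \<Longrightarrow> \<bar>u t x\<bar> \<le> M'" using u_bounded by blast
  define M where "M = max M' vmax"
  have M: "1 \<le> M" "vmax \<le> M" "\<And>t x. 0 < t \<Longrightarrow> t < T \<Longrightarrow> \<bar>u t x\<bar> \<le> M"
    using M' by (auto simp: M_def le_max_iff_disj)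
  obtain B where B: "0 < B" "\<And>t x y. 0 < t \<Longrightarrow> t < T \<Longrightarrow> \<bar>u t x - u t y\<bar> \<le> B * t powr (- 1 / \<alpha>) * \<bar>x - y\<bar>"
    using smoothing by blast
  have tT: "t < T" by (simp add: T_def)
  define R where "R n = real (Suc n)" for n
  have R: "0 < R n" for n by (simp add: R_def)
  note [measurable] = u_measurable[OF t] wt_measurable[OF R]
  define Q where "Q n = exp (M / R n * t) * (A1 + (CA * (2 * M) * (12 * pi * kint * R n powr (1 - \<alpha>)) * t + Cw * ((1 + t) powr (2 - \<alpha>) / (2 - \<alpha>))))" for n
  have Q: "Q \<longlonglongrightarrow> exp 0 * (A1 + (CA * (2 * M) * (12 * pi * kint * 0) * t + Cw * ((1 + t) powr (2 - \<alpha>) / (2 - \<alpha>))))"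
  proof -
    have "(\<lambda>n. M / R n * t) \<longlonglongrightarrow> 0" unfolding R_def by real_asymp
    moreover have "(\<lambda>n. R n powr (1 - \<alpha>)) \<longlonglongrightarrow> 0" unfolding R_def using alpha by real_asymp
    ultimately show ?thesis unfolding Q_def by (intro tendsto_intros)
  qed
  have le: "(\<integral>\<^sup>+x. ennreal (wt (R n) x * \<bar>u t x - prof (1 + t) x\<bar>) \<partial>lborel) \<le> ennreal (Q n)" for n
  proof -
    have pb: "\<bar>prof (1 + t) x\<bar> \<le> M" for x by (rule prof_le_M[OF M B t])
    have i: "integrable lborel (\<lambda>x. wt (R n) x * \<bar>u t x - prof (1 + t) x\<bar>)"
    proof (rule integrable_wt_mult(1)[OF R])
      show "\<bar>\<bar>u t x - prof (1 + t) x\<bar>\<bar> \<le> 2 * M" for x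
        using M(3)[OF t tT, of x] pb[of x] by linarith
    qed measurable
    have "(\<integral>\<^sup>+x. ennreal (wt (R n) x * \<bar>u t x - prof (1 + t) x\<bar>) \<partial>lborel) = ennreal (LINT x|lborel. wt (R n) x * \<bar>u t x - prof (1 + t) x\<bar>)"
      using wt_pos[OF R] by (intro nn_integral_eq_integral i AE_I2) (simp add: less_imp_le)
    also have "\<dots> \<le> ennreal (Q n)"
      unfolding Q_def by (intro ennreal_leI kato_weighted[OF M B t tT R])
    finally show ?thesis .
  qed
  have "(\<lambda>n. \<integral>\<^sup>+x. ennreal (wt (R n) x * \<bar>u t x - prof (1 + t) x\<bar>) \<partial>lborel) \<longlonglongrightarrow> L1norm (\<lambda>x. u t x - prof (1 + t) x)"
  proof (rule nn_integral_LIMSEQ)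
    show "incseq (\<lambda>n x. ennreal (wt (R n) x * \<bar>u t x - prof (1 + t) x\<bar>))"
      by (intro incseq_SucI le_funI ennreal_leI mult_right_mono wt_mono R) (auto simp: R_def)
    show "(\<lambda>x. ennreal (wt (R n) x * \<bar>u t x - prof (1 + t) x\<bar>)) \<in> borel_measurable lborel" for n by measurable
    show "(\<lambda>n. ennreal (wt (R n) x * \<bar>u t x - prof (1 + t) x\<bar>)) \<longlonglongrightarrow> ennreal \<bar>u t x - prof (1 + t) x\<bar>" for x
    proof (intro tendsto_ennrealI)
      have "(\<lambda>n. wt (R n) x) \<longlonglongrightarrow> 1" unfolding wt_def R_def by real_asymp
      from tendsto_mult[OF this tendsto_const, of "\<bar>u t x - prof (1 + t) x\<bar>"]
      show "(\<lambda>n. wt (R n) x * \<bar>u t x - prof (1 + t) x\<bar>) \<longlonglongrightarrow> \<bar>u t x - prof (1 + t) x\<bar>" by simp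
    qed
  qed
  then have "L1norm (\<lambda>x. u t x - prof (1 + t) x) \<le> 
     ennreal (exp 0 * (A1 + (CA * (2 * M) * (12 * pi * kint * 0) * t + Cw * ((1 + t) powr (2 - \<alpha>) / (2 - \<alpha>)))))"
    by (rule LIMSEQ_le) (use le tendsto_ennrealI[OF Q] in blast)+
  then show ?thesis by simp
qed

definition A2 :: real where "A2 = A1 + (8 + 4 * vmax * (up - um) + 4 * vmax * vmax)"

lemma A2_nonneg: "0 \<le> A2"
  using A1_nonneg um_up unfolding A2_def by (auto simp: vmax_def intro!: add_nonneg_nonneg mult_nonneg_nonneg)

theorem L1_rarefaction:
  assumes t: "0 < t"
  shows "L1norm (\<lambda>x. u t x - rarefaction um up t x) \<le> ennreal (A2 + Cw * ((1 + t) powr (2 - \<alpha>) / (2 - \<alpha>)))"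
proof -
  note [measurable] = u_measurable[OF t]
  have [measurable]: "rarefaction um up t \<in> borel_measurable borel" unfolding rarefaction_def[abs_def] by measurable
  have v: "0 \<le> vmax" by (auto simp: vmax_def)
  have "L1norm (\<lambda>x. u t x - rarefaction um up t x) \<le> 
     (\<integral>\<^sup>+x. ennreal \<bar>u t x - prof (1 + t) x\<bar> + ennreal \<bar>prof (1 + t) x - rarefaction um up t x\<bar> \<partial>lborel)"
  proof (intro nn_integral_mono)
    fix x
    have "\<bar>u t x - rarefaction um up t x\<bar> \<le> \<bar>u t x - prof (1 + t) x\<bar> + \<bar>prof (1 + t) x - rarefaction um up t x\<bar>" by linarith
    then show "ennreal \<bar>u t x - rarefaction um up t x\<bar> \<le> ennreal \<bar>u t x - prof (1 + t) x\<bar> + ennreal \<bar>prof (1 + t) x - rarefaction um up t x\<bar>"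
      by (simp add: ennreal_plus[symmetric] ennreal_leI del: ennreal_plus)
  qed
  also have "\<dots> = L1norm (\<lambda>x. u t x - prof (1 + t) x) + L1norm (\<lambda>x. prof (1 + t) x - rarefaction um up t x)"
    by (rule nn_integral_add) measurable
  also have "\<dots> \<le> ennreal (A1 + Cw * ((1 + t) powr (2 - \<alpha>) / (2 - \<alpha>))) + ennreal (8 + 4 * vmax * (up - um) + 4 * vmax * vmax)"
    by (intro add_mono L1_profile prof_rarefaction_L1 t)
  also have "\<dots> = ennreal (A1 + Cw * ((1 + t) powr (2 - \<alpha>) / (2 - \<alpha>)) + (8 + 4 * vmax * (up - um) + 4 * vmax * vmax))"
    using A1_nonneg Cw_pos alpha v um_up by (intro ennreal_plus[symmetric]) (auto intro!: add_nonneg_nonneg mult_nonneg_nonneg simp: less_imp_le)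
  also have "A1 + Cw * ((1 + t) powr (2 - \<alpha>) / (2 - \<alpha>)) + (8 + 4 * vmax * (up - um) + 4 * vmax * vmax) = A2 + Cw * ((1 + t) powr (2 - \<alpha>) / (2 - \<alpha>))"
    by (simp add: A2_def)
  finally show ?thesis .
qed

end

subsection \<open>The rate of convergence\<close>

text \<open>Only slopes from above are bounded, so a large value of \<open>f\<close> forces mass to its left
  and a very negative value forces mass to its right.\<close>

lemma sup_bound_of_one_sided_lipschitz:
  fixes f :: "real \<Rightarrow> real"
  assumes [measurable]: "f \<in> borel_measurable borel" and t: "0 < t" and N: "0 \<le> N"
    and lip: "\<And>x y. y \<le> x \<Longrightarrow> f x - f y \<le> (x - y) / t"
    and L1: "L1norm f \<le> ennreal N"
  shows "\<bar>f x\<bar> \<le> 2 * sqrt (N / t)"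
proof (cases "f x = 0")
  case False
  define m where "m = \<bar>f x\<bar>"
  have m: "0 < m" using False by (simp add: m_def)
  \<comment> \<open>On this interval of length m t / 2 the slope bound keeps |f| above m/2, so the
    mass is at least m^2 t / 4.\<close>
  define S where "S = (if 0 < f x then {x - m * t / 2..x} else {x..x + m * t / 2})"
  have S: "m / 2 \<le> \<bar>f y\<bar>" if "y \<in> S" for y
  proof (cases "0 < f x")
    case True
    then have y: "y \<le> x" "x - y \<le> m * t / 2" using that by (auto simp: S_def)
    have "(x - y) / t \<le> m / 2" using y t by (simp add: divide_le_eq mult.commute)
    moreover have "m = f x" using True by (simp add: m_def)
    ultimately show ?thesis using lip[OF y(1)] by linarith
  next
    case False
    then have y: "x \<le> y" "y - x \<le> m * t / 2" using that by (auto simp: S_def)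
    have "(y - x) / t \<le> m / 2" using y t by (simp add: divide_le_eq mult.commute)
    moreover have "m = - f x" using False by (simp add: m_def)
    ultimately show ?thesis using lip[OF y(1)] by linarith
  qed
  have emS: "emeasure lborel S = ennreal (m * t / 2)" using m t by (auto simp: S_def)
  have [measurable]: "S \<in> sets borel" by (simp add: S_def)
  have "ennreal (m / 2 * (m * t / 2)) = ennreal (m / 2) * emeasure lborel S"
    unfolding emS using m t by (intro ennreal_mult) auto
  also have "\<dots> = (\<integral>\<^sup>+y. ennreal (m / 2) * indicator S y \<partial>lborel)"
    by (rule nn_integral_cmult_indicator[symmetric]) simp
  also have "\<dots> \<le> L1norm f"
    by (intro nn_integral_mono) (use S in \<open>auto simp: indicator_def intro!: ennreal_leI\<close>)
  also have "\<dots> \<le> ennreal N" by (rule L1)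
  finally have "m / 2 * (m * t / 2) \<le> N" using N by (simp add: ennreal_le_iff)
  then have "(m / 2)\<^sup>2 \<le> N / t" using t by (simp add: power2_eq_square field_simps)
  then have "m / 2 \<le> sqrt (N / t)" by (rule real_le_rsqrt)
  then show ?thesis by (simp add: m_def)
qed (use t N in simp)

lemma Lp_norm_le_interpolation:
  fixes f :: "real \<Rightarrow> real"
  assumes [measurable]: "f \<in> borel_measurable borel" and p: "1 \<le> p" and S: "\<And>x. \<bar>f x\<bar> \<le> S" and N: "0 \<le> N"
    and L1: "L1norm f \<le> ennreal N"
  shows "Lp_norm (ereal p) f \<le> ennreal ((S powr (p - 1) * N) powr (1 / p))"
proof -
  have S0: "0 \<le> S" using S[of 0] abs_ge_zero order_trans by blast
  define I where "I = (\<integral>\<^sup>+x. ennreal (\<bar>f x\<bar> powr p) \<partial>lborel)"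
  have "I \<le> (\<integral>\<^sup>+x. ennreal (S powr (p - 1)) * ennreal \<bar>f x\<bar> \<partial>lborel)"
    unfolding I_def
  proof (intro nn_integral_mono)
    fix x
    have "\<bar>f x\<bar> powr p \<le> S powr (p - 1) * \<bar>f x\<bar>"
    proof (cases "f x = 0")
      case False
      then have "\<bar>f x\<bar> powr p = \<bar>f x\<bar> powr (p - 1) * \<bar>f x\<bar>" by (simp add: powr_diff)
      also have "\<dots> \<le> S powr (p - 1) * \<bar>f x\<bar>" using p S by (intro mult_right_mono powr_mono2) auto
      finally show ?thesis .
    qed simp
    then show "ennreal (\<bar>f x\<bar> powr p) \<le> ennreal (S powr (p - 1)) * ennreal \<bar>f x\<bar>"
      by (simp add: ennreal_mult[symmetric] ennreal_leI)
  qed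
  also have "\<dots> = ennreal (S powr (p - 1)) * L1norm f" by (rule nn_integral_cmult) measurable
  also have "\<dots> \<le> ennreal (S powr (p - 1)) * ennreal N" by (intro mult_left_mono L1) simp
  also have "\<dots> = ennreal (S powr (p - 1) * N)" using N by (simp add: ennreal_mult)
  finally have I: "I \<le> ennreal (S powr (p - 1) * N)" .
  then have fin: "I \<noteq> \<infinity>" by (auto simp: top_unique)
  have "enn2real I \<le> S powr (p - 1) * N" using I N by (intro enn2real_leI) auto
  then have "enn2real I powr (1 / p) \<le> (S powr (p - 1) * N) powr (1 / p)" using p by (intro powr_mono2) auto
  then show ?thesis using fin unfolding Lp_norm_def I_def[symmetric] by (simp add: Let_def I_def[symmetric] ennreal_leI)
qed

lemma Lp_norm_infinity_le:
  assumes "f \<in> borel_measurable borel" "\<And>x. \<bar>f x\<bar> \<le> S"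
  shows "Lp_norm \<infinity> f \<le> ennreal S"
  unfolding Lp_norm_def using assms by (auto intro!: esssup_I ennreal_leI)

lemma ereal_greater_cases:
  assumes "ereal a < p"
  obtains "p = \<infinity>" | q where "p = ereal q" "a < q"
  using assms by (cases p) auto

section \<open>Decay for large times, boundedness for small times\<close>

context rarefaction_approach
begin

lemma rarefaction_mono: "y \<le> x \<Longrightarrow> 0 < t \<Longrightarrow> rarefaction um up t y \<le> rarefaction um up t x"
  unfolding rarefaction_clamp by (intro max.mono min.mono order_refl divide_right_mono) auto

lemma rarefaction_measurable [measurable]: "rarefaction um up t \<in> borel_measurable borel"
  unfolding rarefaction_def[abs_def] by measurable

text \<open>One constant for both time ranges: 1 + t is at most 2 before time 1 and at most 2 t
  afterwards. The summand 1 makes it positive.\<close>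

definition N1 :: real where "N1 = A2 + Cw * (2 powr (2 - \<alpha>) / (2 - \<alpha>)) + 1"

lemma N1_pos: "1 \<le> N1"
  using A2_nonneg Cw_pos alpha unfolding N1_def by (auto intro!: add_nonneg_nonneg mult_nonneg_nonneg simp: less_imp_le)

lemma L1_early:
  assumes "0 < t" "t < 1"
  shows "L1norm (\<lambda>x. u t x - rarefaction um up t x) \<le> ennreal N1"
proof (rule order_trans[OF L1_rarefaction[OF assms(1)] ennreal_leI])
  have "(1 + t) powr (2 - \<alpha>) \<le> 2 powr (2 - \<alpha>)" using assms alpha by (intro powr_mono2) auto
  then have "Cw * ((1 + t) powr (2 - \<alpha>) / (2 - \<alpha>)) \<le> Cw * (2 powr (2 - \<alpha>) / (2 - \<alpha>))"
    using alpha Cw_pos by (intro mult_left_mono divide_right_mono) auto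
  then show "A2 + Cw * ((1 + t) powr (2 - \<alpha>) / (2 - \<alpha>)) \<le> N1" by (simp add: N1_def)
qed

lemma L1_late:
  assumes "1 \<le> t"
  shows "L1norm (\<lambda>x. u t x - rarefaction um up t x) \<le> ennreal (N1 * t powr (2 - \<alpha>))"
proof -
  have t: "0 < t" using assms by simp
  have "(1 + t) powr (2 - \<alpha>) \<le> (2 * t) powr (2 - \<alpha>)" using assms alpha by (intro powr_mono2) auto
  then have "Cw * ((1 + t) powr (2 - \<alpha>) / (2 - \<alpha>)) \<le> Cw * ((2 powr (2 - \<alpha>) * t powr (2 - \<alpha>)) / (2 - \<alpha>))"
    using alpha Cw_pos t by (intro mult_left_mono divide_right_mono) (auto simp: powr_mult)
  moreover have "1 \<le> t powr (2 - \<alpha>)" using assms alpha by (intro ge_one_powr_ge_zero) auto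
  then have "A2 * 1 \<le> A2 * t powr (2 - \<alpha>)" using A2_nonneg by (intro mult_left_mono) auto
  moreover have "0 \<le> t powr (2 - \<alpha>)" by simp
  moreover have "N1 * t powr (2 - \<alpha>) = A2 * t powr (2 - \<alpha>) + Cw * ((2 powr (2 - \<alpha>) * t powr (2 - \<alpha>)) / (2 - \<alpha>)) + t powr (2 - \<alpha>)"
    by (simp add: N1_def algebra_simps)
  ultimately have "A2 + Cw * ((1 + t) powr (2 - \<alpha>) / (2 - \<alpha>)) \<le> N1 * t powr (2 - \<alpha>)" by linarith
  then show ?thesis using L1_rarefaction[OF t] order_trans ennreal_leI by blast
qed

lemma sup_late:
  assumes "1 \<le> t"
  shows "\<bar>u t x - rarefaction um up t x\<bar> \<le> 2 * sqrt N1 * t powr ((1 - \<alpha>) / 2)"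
proof -
  have t: "0 < t" using assms by simp
  note [measurable] = u_measurable[OF t]
  have "\<bar>u t x - rarefaction um up t x\<bar> \<le> 2 * sqrt (N1 * t powr (2 - \<alpha>) / t)"
  proof (rule sup_bound_of_one_sided_lipschitz[OF _ t _ _ L1_late[OF assms]])
    show "(\<lambda>x. u t x - rarefaction um up t x) \<in> borel_measurable borel" by measurable
    show "0 \<le> N1 * t powr (2 - \<alpha>)" using N1_pos by simp
    fix x y :: real assume "y \<le> x"
    then show "u t x - rarefaction um up t x - (u t y - rarefaction um up t y) \<le> (x - y) / t"
      using oleinik[OF t, of y x] rarefaction_mono[OF _ t, of y x] by linarith
  qed
  also have "N1 * t powr (2 - \<alpha>) / t = N1 * t powr (1 - \<alpha>)"
    using powr_diff[of t "2 - \<alpha>" 1] t by simp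
  also have "sqrt (N1 * t powr (1 - \<alpha>)) = sqrt N1 * t powr ((1 - \<alpha>) / 2)"
    using t by (simp add: real_sqrt_mult powr_half_sqrt_powr)
  finally show ?thesis by (simp add: mult.assoc)
qed

text \<open>As e \<ge> 0, t^(-e) is at least 1 before time 1, where a uniform bound is therefore
  enough. The logarithm enters only through ln(2 + t) \<ge> ln 2, which explains the constant K / ln
  2.\<close>

lemma rate_of_bounds:
  fixes K e :: real and F :: "real \<Rightarrow> ennreal"
  assumes K: "0 < K" and e: "0 \<le> e"
    and early: "\<And>t. 0 < t \<Longrightarrow> t < 1 \<Longrightarrow> F t \<le> ennreal K"
    and late: "\<And>t. 1 \<le> t \<Longrightarrow> F t \<le> ennreal (K * t powr (- e))"
  shows "\<exists>C>0. \<forall>t>0. F t \<le> ennreal (C * t powr (- e) * ln (2 + t))"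
proof (intro exI[of _ "K / ln 2"] conjI allI impI)
  show "0 < K / ln 2" using K by simp
  fix t :: real assume t: "0 < t"
  have "ln 2 \<le> ln (2 + t)" using t by simp
  then have "K / ln 2 * t powr (- e) * ln 2 \<le> K / ln 2 * t powr (- e) * ln (2 + t)"
    using K by (intro mult_left_mono) auto
  then have le: "K * t powr (- e) \<le> K / ln 2 * t powr (- e) * ln (2 + t)" by simp
  have "F t \<le> ennreal (K * t powr (- e))"
  proof (cases "t < 1")
    case True
    have "1 powr (- e) \<le> t powr (- e)" using t True e by (intro powr_mono2') auto
    then have "K * 1 \<le> K * t powr (- e)" using K by (intro mult_left_mono) auto
    then show ?thesis using early[OF t True] order_trans ennreal_leI by (metis mult_1_right)
  qed (use late in simp)
  then show "F t \<le> ennreal (K / ln 2 * t powr (- e) * ln (2 + t))" using le order_trans ennreal_leI by blast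
qed

theorem convergence_rate:
  assumes p: "ereal ((3 - \<alpha>) / (\<alpha> - 1)) < p"
  shows "\<exists>C>0. \<forall>t>0. Lp_norm p (\<lambda>x. u t x - rarefaction um up t x)
      \<le> ennreal (C * t powr (- (\<alpha> - 1 - (3 - \<alpha>) * recip p) / 2) * ln (2 + t))"
proof -
  obtain M where M: "1 \<le> M" "\<And>t x. 0 < t \<Longrightarrow> t < 1 \<Longrightarrow> \<bar>u t x\<bar> \<le> M" using u_bounded by blast
  define S1 where "S1 = M + vmax"
  have v: "0 \<le> vmax" by (simp add: vmax_def)
  have S1: "1 \<le> S1" using M v by (simp add: S1_def)
  have sup_early: "\<bar>u t x - rarefaction um up t x\<bar> \<le> S1" if "0 < t" "t < 1" for t x
  proof -
    have "\<bar>rarefaction um up t x\<bar> \<le> vmax" unfolding rarefaction_clamp by (auto simp: vmax_def max_def min_def)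
    then show ?thesis using M(2)[OF that, of x] unfolding S1_def by linarith
  qed
  have N1: "0 < N1" using N1_pos by simp
  have meas: "(\<lambda>x. u t x - rarefaction um up t x) \<in> borel_measurable borel" if "0 < t" for t
    using u_measurable[OF that] by measurable
  from p show ?thesis
  proof (cases rule: ereal_greater_cases)
    case 1
    define K where "K = max S1 (2 * sqrt N1)"
    have "\<exists>C>0. \<forall>t>0. Lp_norm p (\<lambda>x. u t x - rarefaction um up t x) \<le> ennreal (C * t powr (- ((\<alpha> - 1) / 2)) * ln (2 + t))"
    proof (rule rate_of_bounds)
      show "0 < K" using S1 by (simp add: K_def less_max_iff_disj)
      show "0 \<le> (\<alpha> - 1) / 2" using alpha by simp
      fix t :: real
      show "Lp_norm p (\<lambda>x. u t x - rarefaction um up t x) \<le> ennreal K" if t: "0 < t" "t < 1"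
        unfolding 1 by (intro Lp_norm_infinity_le meas t) (use sup_early[OF t] in \<open>auto simp: K_def le_max_iff_disj\<close>)
      show "Lp_norm p (\<lambda>x. u t x - rarefaction um up t x) \<le> ennreal (K * t powr (- ((\<alpha> - 1) / 2)))" if t: "1 \<le> t"
        unfolding 1
      proof (intro Lp_norm_infinity_le meas)
        fix x
        have "2 * sqrt N1 * t powr ((1 - \<alpha>) / 2) \<le> K * t powr ((1 - \<alpha>) / 2)" by (intro mult_right_mono) (auto simp: K_def)
        with sup_late[OF t, of x] have "\<bar>u t x - rarefaction um up t x\<bar> \<le> K * t powr ((1 - \<alpha>) / 2)" by (rule order_trans)
        moreover have "(1 - \<alpha>) / 2 = - ((\<alpha> - 1) / 2)" by (metis minus_diff_eq minus_divide_left)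
        ultimately show "\<bar>u t x - rarefaction um up t x\<bar> \<le> K * t powr (- ((\<alpha> - 1) / 2))" by (simp only:)
      qed (use t in simp)
    qed
    moreover have "- (\<alpha> - 1 - (3 - \<alpha>) * recip p) / 2 = - ((\<alpha> - 1) / 2)"
      by (simp only: recip_def 1 simp_thms if_True mult_zero_right diff_zero minus_divide_left)
    ultimately show ?thesis by (simp only:)
  next
    case (2 q)
    \<comment> \<open>The threshold exceeds 1 because \<alpha> < 2, so interpolation with L^1
      applies to every admissible q.\<close>
    have "1 < (3 - \<alpha>) / (\<alpha> - 1)" using alpha by (simp add: less_divide_eq)
    then have q: "1 < q" using 2(2) by simp
    define e where "e = (\<alpha> - 1 - (3 - \<alpha>) / q) / 2"
    \<comment> \<open>The lower bound on q gives the sign of e, on which the early times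
      rely.\<close>
    have "3 - \<alpha> < q * (\<alpha> - 1)" using 2(2) alpha by (simp add: divide_less_eq)
    then have "(3 - \<alpha>) / q < \<alpha> - 1" using q by (simp add: divide_less_eq mult.commute)
    then have e: "0 \<le> e" by (simp add: e_def)
    define K1 where "K1 = (S1 powr (q - 1) * N1) powr (1 / q)"
    define K2 where "K2 = ((2 * sqrt N1) powr (q - 1) * N1) powr (1 / q)"
    define K where "K = max K1 K2"
    have "\<exists>C>0. \<forall>t>0. Lp_norm p (\<lambda>x. u t x - rarefaction um up t x) \<le> ennreal (C * t powr (- e) * ln (2 + t))"
    proof (rule rate_of_bounds[OF _ e])
      show "0 < K" using S1 N1 by (simp add: K_def K1_def less_max_iff_disj)
      fix t :: real
      show "Lp_norm p (\<lambda>x. u t x - rarefaction um up t x) \<le> ennreal K" if t: "0 < t" "t < 1"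
      proof -
        have "Lp_norm p (\<lambda>x. u t x - rarefaction um up t x) \<le> ennreal K1"
          unfolding 2(1) K1_def
          by (rule Lp_norm_le_interpolation[OF meas[OF t(1)] _ sup_early[OF t] _ L1_early[OF t]]) (use q N1 in auto)
        also have "\<dots> \<le> ennreal K" by (intro ennreal_leI) (simp add: K_def)
        finally show ?thesis .
      qed
      show "Lp_norm p (\<lambda>x. u t x - rarefaction um up t x) \<le> ennreal (K * t powr (- e))" if t: "1 \<le> t"
      proof -
        have t0: "0 < t" using t by simp
        have "Lp_norm p (\<lambda>x. u t x - rarefaction um up t x) \<le> 
            ennreal (((2 * sqrt N1 * t powr ((1 - \<alpha>) / 2)) powr (q - 1) * (N1 * t powr (2 - \<alpha>))) powr (1 / q))"
          unfolding 2(1)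
          by (rule Lp_norm_le_interpolation[OF meas[OF t0] _ sup_late[OF t] _ L1_late[OF t]]) (use q N1 in auto)
        also have "((2 * sqrt N1 * t powr ((1 - \<alpha>) / 2)) powr (q - 1) * (N1 * t powr (2 - \<alpha>))) powr (1 / q) = K2 * t powr (- e)"
        proof -
          have "(2 * sqrt N1 * t powr ((1 - \<alpha>) / 2)) powr (q - 1) * (N1 * t powr (2 - \<alpha>)) =
              ((2 * sqrt N1) powr (q - 1) * N1) * t powr ((1 - \<alpha>) / 2 * (q - 1) + (2 - \<alpha>))"
            using N1 by (simp add: powr_mult powr_powr powr_add)
          \<comment> \<open>The supremum contributes (1 - \<alpha>)/2 (1 - 1/q) and the L^1 norm (2
            - \<alpha>)/q; their sum is -e.\<close>
          moreover have "((1 - \<alpha>) / 2 * (q - 1) + (2 - \<alpha>)) * (1 / q) = - e"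
            using q unfolding e_def by (simp add: field_simps)
          moreover have "(k * t powr E) powr (1 / q) = k powr (1 / q) * t powr (E * (1 / q))" if "0 \<le> k" for k E
            using that by (simp add: powr_mult powr_powr)
          ultimately show ?thesis unfolding K2_def using N1 by (simp only: zero_le_mult_iff powr_ge_zero less_imp_le simp_thms)
        qed
        also have "ennreal (K2 * t powr (- e)) \<le> ennreal (K * t powr (- e))"
          by (intro ennreal_leI mult_right_mono) (auto simp: K_def)
        finally show ?thesis .
      qed
    qed
    moreover have "- (\<alpha> - 1 - (3 - \<alpha>) * recip p) / 2 = - e"
    proof -
      have "recip p = 1 / q" by (simp add: recip_def 2(1))
      then show ?thesis by (simp only: e_def times_divide_eq_right mult_1_right minus_divide_left)
    qed
    ultimately show ?thesis by (simp only:)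
  qed
qed

end

section \<open>Initial data given by a finite signed measure\<close>

theorem theorem1p1:
  fixes \<alpha> c :: real and M1 M2 :: "real measure"
    and u0 :: "real \<Rightarrow> real" and u :: "real \<Rightarrow> real \<Rightarrow> real"
  assumes alpha: "1 < \<alpha>" "\<alpha> < 2"
    and m: "finite_signed_borel M1 M2"
    and u0_def: "\<And>x. u0 x = c + smeasure M1 M2 {..x}"
    and L1_left: "set_integrable lborel {..<0} (\<lambda>x. u0 x - c)"
    and L1_right: "set_integrable lborel {0<..} (\<lambda>x. u0 x - (c + smeasure M1 M2 UNIV))"
    and less: "c < c + smeasure M1 M2 UNIV"
    and sol: "is_solution \<alpha> u0 u"
  shows "\<forall>p::ereal. ereal ((3 - \<alpha>) / (\<alpha> - 1)) < p \<longrightarrow>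
           (\<exists>C>0. \<forall>t>0.
              Lp_norm p (\<lambda>x. u t x - rarefaction c (c + smeasure M1 M2 UNIV) t x)
                \<le> ennreal (C * t powr (- (\<alpha> - 1 - (3 - \<alpha>) * recip p) / 2) * ln (2 + t)))"
proof -
  define d where "d = c + smeasure M1 M2 UNIV"
  interpret M1: finite_borel_measure M1
    using m by (simp add: finite_signed_borel_def finite_borel_measure_def finite_borel_measure_axioms_def)
  interpret M2: finite_borel_measure M2
    using m by (simp add: finite_signed_borel_def finite_borel_measure_def finite_borel_measure_axioms_def)
  \<comment> \<open>As a difference of distribution functions the datum is bounded, measurable and
    right continuous at every point.\<close>
  have u0_cdf: "u0 = (\<lambda>x. c + (cdf M1 x - cdf M2 x))"
    by (intro ext) (simp add: u0_def smeasure_def cdf_def)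
  have [measurable]: "cdf M1 \<in> borel_measurable borel" "cdf M2 \<in> borel_measurable borel"
    by (auto intro!: borel_measurable_mono monoI M1.cdf_nondecreasing M2.cdf_nondecreasing)
  have meas [measurable]: "u0 \<in> borel_measurable borel" unfolding u0_cdf by measurable
  let ?l = "\<lambda>x. indicator {..<0} x *\<^sub>R (u0 x - c)" and ?r = "\<lambda>x. indicator {0<..} x *\<^sub>R (u0 x - d)"
  have i: "integrable lborel (\<lambda>x. \<bar>?l x\<bar> + \<bar>?r x\<bar>)"
    using L1_left L1_right unfolding set_integrable_def d_def by (intro Bochner_Integration.integrable_add integrable_abs)
  have "rarefaction_approach \<alpha> u0 u c d (\<bar>c\<bar> + (measure M1 UNIV + measure M2 UNIV)) (LINT x|lborel. \<bar>?l x\<bar> + \<bar>?r x\<bar>)"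
  proof unfold_locales
    show "1 < \<alpha>" "\<alpha> < 2" "is_solution \<alpha> u0 u" "c < d" using alpha sol less by (auto simp: d_def)
    show "u0 \<in> borel_measurable borel" by (rule meas)
    show "\<bar>u0 x\<bar> \<le> \<bar>c\<bar> + (measure M1 UNIV + measure M2 UNIV)" for x
    proof -
      have "cdf M1 x \<le> measure M1 UNIV" "cdf M2 x \<le> measure M2 UNIV" "0 \<le> cdf M1 x" "0 \<le> cdf M2 x"
        using M1.cdf_bounded[of x] M2.cdf_bounded[of x] M1.cdf_nonneg[of x] M2.cdf_nonneg[of x]
          sets_eq_imp_space_eq[OF M1.M_is_borel] sets_eq_imp_space_eq[OF M2.M_is_borel] by auto
      then show ?thesis unfolding u0_cdf by linarith
    qed
    show "(u0 \<longlongrightarrow> u0 x) (at_right x)" for x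
      unfolding u0_cdf using M1.cdf_is_right_cont[of x] M2.cdf_is_right_cont[of x]
      by (intro tendsto_intros) (auto simp: continuous_within)
    show "0 \<le> (LINT x|lborel. \<bar>?l x\<bar> + \<bar>?r x\<bar>)" by (intro Bochner_Integration.integral_nonneg) auto
    have "L1norm (\<lambda>x. u0 x - (if x < 0 then c else d)) = (\<integral>\<^sup>+x. ennreal (\<bar>?l x\<bar> + \<bar>?r x\<bar>) \<partial>lborel)"
    proof (intro nn_integral_cong_AE)
      \<comment> \<open>The two half-lines of the integrability assumptions leave out 0, where the
        step takes the value \<open>d\<close>; a single point does not affect the norm.\<close>
      have "AE x in lborel. x \<noteq> (0::real)" by (rule AE_lborel_singleton)
      then show "AE x in lborel. ennreal \<bar>u0 x - (if x < 0 then c else d)\<bar> = ennreal (\<bar>?l x\<bar> + \<bar>?r x\<bar>)"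
        by eventually_elim (auto simp: indicator_def)
    qed
    also have "\<dots> = ennreal (LINT x|lborel. \<bar>?l x\<bar> + \<bar>?r x\<bar>)"
      by (intro nn_integral_eq_integral i) auto
    finally show "L1norm (\<lambda>x. u0 x - (if x < 0 then c else d)) \<le> ennreal (LINT x|lborel. \<bar>?l x\<bar> + \<bar>?r x\<bar>)"
      by simp
  qed
  then show ?thesis unfolding d_def[symmetric] using rarefaction_approach.convergence_rate by blast
qed

end
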